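(* Let $\beta_k$ be an s-tensor norm of order $k$ and let $X$ be a Banach space (real or complex). If $X^{**}$ has the $\lambda$-approximation property, then $\Theta_{\beta_k}$ embeds $\widehat{\bigotimes}^{k,s}_{\beta_k}X^{**}$ as a locally $\lambda^k$-complemented subspace of $\left(\widehat{\bigotimes}^{k,s}_{\beta_k}X\right)^{**}$. Equivalently, $\mathcal{P}_{\beta_k}(^kX^{**})$ is a $\lambda^k$-complemented subspace of $\mathcal{P}_{\beta_k}(^kX)^{**}$.
   Context: Tensor norms. $\bigotimes^{k,s}X$ is the linear span of the elementary tensors $\otimes^kx=x\otimes\cdots\otimes x$ in the $k$-fold tensor product of $X$. For a bounded operator $T\colon X\to Y$, $\otimes^{k,s}T\colon\bigotimes^{k,s}X\to\bigotimes^{k,s}Y$ is the linear map with $\otimes^kx\mapsto\otimes^k(Tx)$. The symmetric projective and injective norms are $\pi_{k,s}(v)=\inf\sum_j|\lambda_j|\|x_j\|^k$ (infimum over all representations $v=\sum_j\lambda_j\otimes^kx_j$) and $\varepsilon_{k,s}(v)=\sup_{\phi\in B_{X^*}}|\sum_j\lambda_j\phi(x_j)^k|$. An s-tensor norm $\beta_k$ of order $k$ assigns to each normed space $X$ a norm on $\bigotimes^{k,s}X$ such that $\varepsilon_{k,s}\le\beta_k\le\pi_{k,s}$ and $\|\otimes^{k,s}T\colon\bigotimes^{k,s}_{\beta_k}X\to\bigotimes^{k,s}_{\beta_k}Y\|\le\|T\|^k$ for every operator $T$. All s-tensor norms are assumed finitely generated: $\beta_k(v,\bigotimes^{k,s}X)=\inf\{\beta_k(v,\bigotimes^{k,s}M):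 M\subset X \text{ finite dimensional},\ v\in\bigotimes^{k,s}M\}$. $\widehat{\bigotimes}^{k,s}_{\beta_k}X$ is the completion of $(\bigotimes^{k,s}X,\beta_k)$. Polynomials. $\mathcal{P}_{\beta_k}(^kX)=\big(\widehat{\bigotimes}^{k,s}_{\beta_k}X\big)^*$ with the dual norm, a functional $\varphi$ being identified with the $k$-homogeneous polynomial $x\mapsto\varphi(\otimes^kx)$. The Aron-Berner extension of a polynomial $P$ with symmetric $k$-linear form $A$ is $\overline{P}(z)=\overline{A}(z,\dots,z)$ for $z\in X^{**}$, where $\overline{A}(z_1,\dots,z_k)=\lim_{i_1}\cdots\lim_{i_k}A(x_{i_1},\dots,x_{i_k})$ with $(x_{i_j})$ a net in $X$ converging weak* to $z_j$. It is known that $P\mapsto\overline{P}$ is an isometry from $\mathcal{P}_{\beta_k}(^kX)$ into $\mathcal{P}_{\beta_k}(^kX^{**})$. The canonical map is $$\Theta_{\beta_k}\colon\widehat{\bigotimes}^{k,s}_{\beta_k}X^{**}\to\Big(\widehat{\bigotimes}^{k,s}_{\beta_k}X\Big)^{**}=\mathcal{P}_{\beta_k}(^kX)^*,\qquad \Theta_{\beta_k}(v)(P)=\langle\overline{P},v\rangle .$$ Approximation property. A Banach space $Z$ has the $\lambda$-approximation property ($\lambda$-AP) if there is a net $(T_\gamma)$ of finite rank operators on $Z$ with $\|T_\gamma\|\le\lambda$ and $\|T_\gamma z-z\|\to0$ for all $z\in Z$. Local complementation. A subspace $Z$ of a Banach space $W$ (through an embedding $i\colon Z\to W$) is locally $\lambda$-complemented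 in $W$ if for every finite dimensional subspace $F\subset W$ there is an operator $r_F\colon F\to Z$ with $\|r_F\|\le\lambda$ and $r_F(i(z))=z$ whenever $i(z)\in F$. It is known that this holds if and only if there is a linear operator $E\colon Z^*\to W^*$ with $i^*\circ E=\mathrm{id}_{Z^*}$ and $\|E\|\le\lambda$; this is the sense in which $Z^*$ is a $\lambda$-complemented subspace of $W^*$ (here $i=\Theta_{\beta_k}$, $Z^*=\mathcal{P}_{\beta_k}(^kX^{**})$, $W^*=\mathcal{P}_{\beta_k}(^kX)^{**}$).
   Formalization: Local complementation is proved with every constant c > λ^k instead of λ^k itself: with the bound ‖r_F‖ ≤ λ^k attained the claim fails (e.g. k=2, λ=1, injective norm, X=c_0⊕B, B a renormed ℓ_2); the complementation of the duals keeps the exact constant λ^k. *)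

theory Defs
  imports
    "HOL-Analysis.Analysis"
    "HOL-Library.Function_Algebras"
    "HOL-Library.Multiset"
begin

section \<open>Scalars\<close>

text \<open>A type of this class is an isometric copy of the field of real or of complex numbers.\<close>

class real_or_complex = real_normed_field +
  assumes real_or_complex_embedding:
    "\<exists>e :: 'a \<Rightarrow> complex.
       (\<forall>x y. e (x + y) = e x + e y) \<and> (\<forall>x y. e (x * y) = e x * e y) \<and>
       (\<forall>x. cmod (e x) = norm x) \<and> (range e = \<real> \<or> range e = UNIV)"

instance real :: real_or_complex
  by standard (rule exI[of _ complex_of_real], simp add: Reals_def)

instance complex :: real_or_complex
  by standard (rule exI[of _ "\<lambda>z. z"], simp)


section \<open>Normed spaces\<close>

text \<open>
  A normed space is a linear subspace (the carrier) of a vector space given by an ambient type,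
  with a norm on that subspace. The values of the norm, and of operators, outside the carrier
  are irrelevant.
\<close>

record ('k, 'v) nspace =
  car :: "'v set"
  smul :: "'k \<Rightarrow> 'v \<Rightarrow> 'v"
  nrm :: "'v \<Rightarrow> real"

definition normed_space :: "('k::real_or_complex, 'v::ab_group_add) nspace \<Rightarrow> bool" where
  "normed_space X \<longleftrightarrow>
     vector_space (smul X) \<and> module.subspace (smul X) (car X) \<and>
     (\<forall>x\<in>car X. 0 \<le> nrm X x) \<and>
     (\<forall>x\<in>car X. nrm X x = 0 \<longleftrightarrow> x = 0) \<and>
     (\<forall>c. \<forall>x\<in>car X. nrm X (smul X c x) = norm c * nrm X x) \<and>
     (\<forall>x\<in>car X. \<forall>y\<in>car X. nrm X (x + y) \<le> nrm X x + nrm X y)"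

definition banach_space :: "('k::real_or_complex, 'v::ab_group_add) nspace \<Rightarrow> bool" where
  "banach_space X \<longleftrightarrow> normed_space X \<and>
     (\<forall>f :: nat \<Rightarrow> 'v. range f \<subseteq> car X \<longrightarrow>
        (\<forall>e>0. \<exists>N. \<forall>m\<ge>N. \<forall>n\<ge>N. nrm X (f m - f n) < e) \<longrightarrow>
        (\<exists>l\<in>car X. (\<lambda>n. nrm X (f n - l)) \<longlonglongrightarrow> 0))"

lemma normed_space_UNIV:
  "normed_space \<lparr>car = UNIV, smul = scaleR, nrm = (norm :: 'a::real_normed_vector \<Rightarrow> real)\<rparr>"
  by (simp add: normed_space_def real_vector.vector_space_axioms norm_triangle_ineq
      module.subspace_UNIV[OF real_vector.module_axioms])

text \<open>The subspace of \<open>X\<close> with carrier \<open>M\<close>, under the restricted norm.\<close>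

definition restr :: "('k, 'v) nspace \<Rightarrow> 'v set \<Rightarrow> ('k, 'v) nspace" where
  "restr X M = X\<lparr>car := M\<rparr>"

definition fin_dim_subspace ::
    "('k::real_or_complex, 'v::ab_group_add) nspace \<Rightarrow> 'v set \<Rightarrow> bool" where
  "fin_dim_subspace X M \<longleftrightarrow> M \<subseteq> car X \<and> (\<exists>B. finite B \<and> M = module.span (smul X) B)"

definition lin_op :: "('k::real_or_complex, 'v::ab_group_add) nspace \<Rightarrow>
    ('k, 'w::ab_group_add) nspace \<Rightarrow> ('v \<Rightarrow> 'w) \<Rightarrow> bool" where
  "lin_op X Y T \<longleftrightarrow> T ` car X \<subseteq> car Y \<and>
     (\<forall>x\<in>car X. \<forall>y\<in>car X. T (x + y) = T x + T y) \<and>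
     (\<forall>c. \<forall>x\<in>car X. T (smul X c x) = smul Y c (T x))"

definition bdd_op :: "('k::real_or_complex, 'v::ab_group_add) nspace \<Rightarrow>
    ('k, 'w::ab_group_add) nspace \<Rightarrow> ('v \<Rightarrow> 'w) \<Rightarrow> bool" where
  "bdd_op X Y T \<longleftrightarrow> lin_op X Y T \<and> (\<exists>K. \<forall>x\<in>car X. nrm Y (T x) \<le> K * nrm X x)"

definition op_norm :: "('k, 'v) nspace \<Rightarrow> ('k, 'w) nspace \<Rightarrow> ('v \<Rightarrow> 'w) \<Rightarrow> real" where
  "op_norm X Y T = Sup {nrm Y (T x) | x. x \<in> car X \<and> nrm X x \<le> 1}"

definition embedding :: "('k::real_or_complex, 'v::ab_group_add) nspace \<Rightarrow>
    ('k, 'w::ab_group_add) nspace \<Rightarrow> ('v \<Rightarrow> 'w) \<Rightarrow> bool" where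
  "embedding X Y i \<longleftrightarrow> bdd_op X Y i \<and> (\<exists>c>0. \<forall>x\<in>car X. c * nrm X x \<le> nrm Y (i x))"


section \<open>Duals, biduals and completions\<close>

definition fscale :: "'k::times \<Rightarrow> ('i \<Rightarrow> 'k) \<Rightarrow> 'i \<Rightarrow> 'k" where
  "fscale c f = (\<lambda>i. c * f i)"

lemma vector_space_fscale: "vector_space (fscale :: 'k::field \<Rightarrow> ('i \<Rightarrow> 'k) \<Rightarrow> 'i \<Rightarrow> 'k)"
  by unfold_locales (auto simp: fscale_def fun_eq_iff algebra_simps)

definition scalars :: "('k::real_or_complex, 'k) nspace" where
  "scalars = \<lparr>car = UNIV, smul = (*), nrm = norm\<rparr>"

text \<open>Functionals are extended by \<open>0\<close> outside the carrier, so that each has one representative.\<close>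

definition dual :: "('k::real_or_complex, 'v::ab_group_add) nspace \<Rightarrow> ('k, 'v \<Rightarrow> 'k) nspace" where
  "dual X = \<lparr>car = {\<phi>. bdd_op X scalars \<phi> \<and> (\<forall>x. x \<notin> car X \<longrightarrow> \<phi> x = 0)},
             smul = fscale, nrm = op_norm X scalars\<rparr>"

abbreviation bidual ::
    "('k::real_or_complex, 'v::ab_group_add) nspace \<Rightarrow> ('k, ('v \<Rightarrow> 'k) \<Rightarrow> 'k) nspace" where
  "bidual X \<equiv> dual (dual X)"

definition canon ::
    "('k::real_or_complex, 'v::ab_group_add) nspace \<Rightarrow> 'v \<Rightarrow> ('v \<Rightarrow> 'k) \<Rightarrow> 'k" where
  "canon X x = (\<lambda>\<phi>. if \<phi> \<in> car (dual X) then \<phi> x else 0)"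

definition adjoint :: "('k, 'v) nspace \<Rightarrow> ('v \<Rightarrow> 'w) \<Rightarrow> ('w \<Rightarrow> 'k::zero) \<Rightarrow> 'v \<Rightarrow> 'k" where
  "adjoint X T \<psi> = (\<lambda>x. if x \<in> car X then \<psi> (T x) else 0)"

text \<open>The completion, realized as the norm closure of the canonical image in the bidual.\<close>

definition completion ::
    "('k::real_or_complex, 'v::ab_group_add) nspace \<Rightarrow> ('k, ('v \<Rightarrow> 'k) \<Rightarrow> 'k) nspace" where
  "completion X = restr (bidual X)
     {z \<in> car (bidual X). \<forall>e>0. \<exists>x\<in>car X. nrm (bidual X) (z - canon X x) < e}"


section \<open>Symmetric tensor products\<close>

definition multilinear_on ::
    "nat \<Rightarrow> ('k::real_or_complex \<Rightarrow> 'v::ab_group_add \<Rightarrow> 'v) \<Rightarrow> 'v set \<Rightarrow> ('v list \<Rightarrow> 'k) \<Rightarrow> bool" where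
  "multilinear_on k s S A \<longleftrightarrow>
     (\<forall>xs ys. length xs + length ys + 1 = k \<longrightarrow> set xs \<subseteq> S \<longrightarrow> set ys \<subseteq> S \<longrightarrow>
        (\<forall>x\<in>S. \<forall>y\<in>S. A (xs @ (x + y) # ys) = A (xs @ x # ys) + A (xs @ y # ys)) \<and>
        (\<forall>c. \<forall>x\<in>S. A (xs @ s c x # ys) = c * A (xs @ x # ys)))"

text \<open>
  The tensor product of \<open>k\<close> copies of the ambient vector space, realized inside the algebraic
  dual of the space of \<open>k\<close>-linear forms: \<open>x1 \<otimes> \<dots> \<otimes> xk\<close> is evaluation at \<open>(x1, \<dots>, xk)\<close>. Since all
  forms on the ambient space are used, and every form on a linear subspace \<open>M\<close> extends to it,
  the span of the \<open>x1 \<otimes> \<dots> \<otimes> xk\<close> with \<open>xi \<in> M\<close> is the tensor product of \<open>k\<close> copies of \<open>M\<close>, and the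
  maps induced by inclusions of subspaces are inclusions.
\<close>

type_synonym ('k, 'v) tensor = "('v list \<Rightarrow> 'k) \<Rightarrow> 'k"

definition tens ::
    "('k::real_or_complex \<Rightarrow> 'v::ab_group_add \<Rightarrow> 'v) \<Rightarrow> 'v list \<Rightarrow> ('k, 'v) tensor" where
  "tens s xs = (\<lambda>A. if multilinear_on (length xs) s UNIV A then A xs else 0)"

definition tpow :: "nat \<Rightarrow> ('k::real_or_complex \<Rightarrow> 'v::ab_group_add \<Rightarrow> 'v) \<Rightarrow> 'v \<Rightarrow> ('k, 'v) tensor"
  where "tpow k s x = tens s (replicate k x)"

definition sym_tensors ::
    "nat \<Rightarrow> ('k::real_or_complex, 'v::ab_group_add) nspace \<Rightarrow> ('k, 'v) tensor set" where
  "sym_tensors k X = module.span fscale (tpow k (smul X) ` car X)"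

definition tsum :: "nat \<Rightarrow> ('k::real_or_complex \<Rightarrow> 'v::ab_group_add \<Rightarrow> 'v) \<Rightarrow>
    ('k \<times> 'v) list \<Rightarrow> ('k, 'v) tensor" where
  "tsum k s cs = (\<Sum>(c, x)\<leftarrow>cs. fscale c (tpow k s x))"

definition represents :: "nat \<Rightarrow> ('k::real_or_complex, 'v::ab_group_add) nspace \<Rightarrow>
    ('k \<times> 'v) list \<Rightarrow> ('k, 'v) tensor \<Rightarrow> bool" where
  "represents k X cs v \<longleftrightarrow> snd ` set cs \<subseteq> car X \<and> v = tsum k (smul X) cs"

definition sym_tensor_map :: "nat \<Rightarrow> ('k::real_or_complex, 'v::ab_group_add) nspace \<Rightarrow>
    ('k, 'w::ab_group_add) nspace \<Rightarrow> ('v \<Rightarrow> 'w) \<Rightarrow> ('k, 'v) tensor \<Rightarrow> ('k, 'w) tensor" where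
  "sym_tensor_map k X Y T v =
     (THE w. \<exists>cs. represents k X cs v \<and> w = tsum k (smul Y) (map (\<lambda>(c, x). (c, T x)) cs))"

definition pi_norm :: "nat \<Rightarrow> ('k::real_or_complex, 'v::ab_group_add) nspace \<Rightarrow>
    ('k, 'v) tensor \<Rightarrow> real" where
  "pi_norm k X v = Inf {(\<Sum>(c, x)\<leftarrow>cs. norm c * nrm X x ^ k) | cs. represents k X cs v}"

definition eps_norm :: "nat \<Rightarrow> ('k::real_or_complex, 'v::ab_group_add) nspace \<Rightarrow>
    ('k, 'v) tensor \<Rightarrow> real" where
  "eps_norm k X v = Sup {norm (\<Sum>(c, x)\<leftarrow>cs. c * \<phi> x ^ k) | cs \<phi>.
     represents k X cs v \<and> \<phi> \<in> car (dual X) \<and> nrm (dual X) \<phi> \<le> 1}"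


section \<open>s-tensor norms\<close>

text \<open>
  A map of the following type assigns a function on tensors to every space over the ambient type
  \<open>'v\<close>.
\<close>

type_synonym ('k, 'v) norm_assignment = "('k, 'v) nspace \<Rightarrow> ('k, 'v) tensor \<Rightarrow> real"

definition sym_tensor_space :: "nat \<Rightarrow> ('k::real_or_complex, 'v::ab_group_add) norm_assignment \<Rightarrow>
    ('k, 'v) nspace \<Rightarrow> ('k, ('k, 'v) tensor) nspace" where
  "sym_tensor_space k \<beta> X = \<lparr>car = sym_tensors k X, smul = fscale, nrm = \<beta> X\<rparr>"

definition metric_mapping_property :: "nat \<Rightarrow> ('k::real_or_complex, 'v::ab_group_add) norm_assignment \<Rightarrow>
    ('k, 'w::ab_group_add) norm_assignment \<Rightarrow> bool" where
  "metric_mapping_property k \<beta> \<beta>' \<longleftrightarrow>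
     (\<forall>X Y T. normed_space X \<longrightarrow> normed_space Y \<longrightarrow> bdd_op X Y T \<longrightarrow>
        (\<forall>v\<in>sym_tensors k X. \<beta>' Y (sym_tensor_map k X Y T v) \<le> op_norm X Y T ^ k * \<beta> X v))"

definition finitely_generated ::
    "nat \<Rightarrow> ('k::real_or_complex, 'v::ab_group_add) norm_assignment \<Rightarrow> bool" where
  "finitely_generated k \<beta> \<longleftrightarrow>
     (\<forall>X. normed_space X \<longrightarrow> (\<forall>v\<in>sym_tensors k X.
        \<beta> X v = Inf {\<beta> (restr X M) v | M. fin_dim_subspace X M \<and> v \<in> sym_tensors k (restr X M)}))"

definition s_tensor_norm_on ::
    "nat \<Rightarrow> ('k::real_or_complex, 'v::ab_group_add) norm_assignment \<Rightarrow> bool" where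
  "s_tensor_norm_on k \<beta> \<longleftrightarrow>
     (\<forall>X. normed_space X \<longrightarrow> normed_space (sym_tensor_space k \<beta> X) \<and>
        (\<forall>v\<in>sym_tensors k X. eps_norm k X v \<le> \<beta> X v \<and> \<beta> X v \<le> pi_norm k X v)) \<and>
     metric_mapping_property k \<beta> \<beta> \<and> finitely_generated k \<beta>"

text \<open>
  An s-tensor norm acts on all normed spaces, whatever their type, but a variable cannot be
  polymorphic. It is therefore given by its restrictions to the spaces over two types \<open>'v\<close> and
  \<open>'w\<close>, the mapping property being required for operators in all four directions.
\<close>

definition s_tensor_norm :: "nat \<Rightarrow> ('k::real_or_complex, 'v::ab_group_add) norm_assignment \<Rightarrow>
    ('k, 'w::ab_group_add) norm_assignment \<Rightarrow> bool" where
  "s_tensor_norm k \<beta> \<beta>' \<longleftrightarrow> s_tensor_norm_on k \<beta> \<and> s_tensor_norm_on k \<beta>' \<and>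
     metric_mapping_property k \<beta> \<beta>' \<and> metric_mapping_property k \<beta>' \<beta>"

definition completed_tensors :: "nat \<Rightarrow> ('k::real_or_complex, 'v::ab_group_add) norm_assignment \<Rightarrow>
    ('k, 'v) nspace \<Rightarrow> ('k, (('k, 'v) tensor \<Rightarrow> 'k) \<Rightarrow> 'k) nspace" where
  "completed_tensors k \<beta> X = completion (sym_tensor_space k \<beta> X)"

definition ctpow :: "nat \<Rightarrow> ('k::real_or_complex, 'v::ab_group_add) norm_assignment \<Rightarrow>
    ('k, 'v) nspace \<Rightarrow> 'v \<Rightarrow> (('k, 'v) tensor \<Rightarrow> 'k) \<Rightarrow> 'k" where
  "ctpow k \<beta> X x = canon (sym_tensor_space k \<beta> X) (tpow k (smul X) x)"


section \<open>Polynomials, the Aron-Berner extension and the canonical map\<close>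

definition polys :: "nat \<Rightarrow> ('k::real_or_complex, 'v::ab_group_add) norm_assignment \<Rightarrow>
    ('k, 'v) nspace \<Rightarrow> ('k, ((('k, 'v) tensor \<Rightarrow> 'k) \<Rightarrow> 'k) \<Rightarrow> 'k) nspace" where
  "polys k \<beta> X = dual (completed_tensors k \<beta> X)"

definition sym_form_of :: "nat \<Rightarrow> ('k::real_or_complex, 'v::ab_group_add) nspace \<Rightarrow>
    ('v \<Rightarrow> 'k) \<Rightarrow> ('v list \<Rightarrow> 'k) \<Rightarrow> bool" where
  "sym_form_of k X p A \<longleftrightarrow> multilinear_on k (smul X) (car X) A \<and>
     (\<forall>xs ys. length xs = k \<longrightarrow> set xs \<subseteq> car X \<longrightarrow> mset xs = mset ys \<longrightarrow> A xs = A ys) \<and>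
     (\<forall>x\<in>car X. p x = A (replicate k x))"

text \<open>
  The trace on \<open>X\<close> of the weak* neighbourhood filter of \<open>z\<close> in the bidual: a net in \<open>X\<close> converges
  weak* to \<open>z\<close> iff its tails refine this filter. A limit along the filter is thus a common limit
  of all such nets.
\<close>

definition wstar_nhds ::
    "('k::real_or_complex, 'v::ab_group_add) nspace \<Rightarrow> (('v \<Rightarrow> 'k) \<Rightarrow> 'k) \<Rightarrow> 'v filter" where
  "wstar_nhds X z = (INF (\<phi>, e) \<in> car (dual X) \<times> {0<..}.
     principal {x \<in> car X. norm (\<phi> x - z \<phi>) < (e::real)})"

primrec iter_lim :: "('k::real_or_complex, 'v::ab_group_add) nspace \<Rightarrow>
    (('v \<Rightarrow> 'k) \<Rightarrow> 'k) list \<Rightarrow> ('v list \<Rightarrow> 'k) \<Rightarrow> 'k" where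
  "iter_lim X [] A = A []"
| "iter_lim X (z # zs) A = Lim (wstar_nhds X z) (\<lambda>x. iter_lim X zs (\<lambda>xs. A (x # xs)))"

text \<open>
  The form \<open>A\<close> chosen here is determined on the carrier of \<open>X\<close>, and only its values there matter.
\<close>

definition aron_berner_poly :: "nat \<Rightarrow> ('k::real_or_complex, 'v::ab_group_add) nspace \<Rightarrow>
    ('v \<Rightarrow> 'k) \<Rightarrow> (('v \<Rightarrow> 'k) \<Rightarrow> 'k) \<Rightarrow> 'k" where
  "aron_berner_poly k X p z = iter_lim X (replicate k z) (SOME A. sym_form_of k X p A)"

text \<open>The Aron-Berner extension of \<open>P\<close>, as a functional on the completed tensor product.\<close>

definition aron_berner :: "nat \<Rightarrow> ('k::real_or_complex, 'v::ab_group_add) norm_assignment \<Rightarrow>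
    ('k, ('v \<Rightarrow> 'k) \<Rightarrow> 'k) norm_assignment \<Rightarrow> ('k, 'v) nspace \<Rightarrow>
    (((('k, 'v) tensor \<Rightarrow> 'k) \<Rightarrow> 'k) \<Rightarrow> 'k) \<Rightarrow>
    ((('k, ('v \<Rightarrow> 'k) \<Rightarrow> 'k) tensor \<Rightarrow> 'k) \<Rightarrow> 'k) \<Rightarrow> 'k" where
  "aron_berner k \<beta> \<beta>' X P =
     (THE Q. Q \<in> car (polys k \<beta>' (bidual X)) \<and>
        (\<forall>z\<in>car (bidual X). Q (ctpow k \<beta>' (bidual X) z) =
           aron_berner_poly k X (\<lambda>x. P (ctpow k \<beta> X x)) z))"

definition Theta :: "nat \<Rightarrow> ('k::real_or_complex, 'v::ab_group_add) norm_assignment \<Rightarrow>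
    ('k, ('v \<Rightarrow> 'k) \<Rightarrow> 'k) norm_assignment \<Rightarrow> ('k, 'v) nspace \<Rightarrow>
    ((('k, ('v \<Rightarrow> 'k) \<Rightarrow> 'k) tensor \<Rightarrow> 'k) \<Rightarrow> 'k) \<Rightarrow>
    (((('k, 'v) tensor \<Rightarrow> 'k) \<Rightarrow> 'k) \<Rightarrow> 'k) \<Rightarrow> 'k" where
  "Theta k \<beta> \<beta>' X v = (\<lambda>P. if P \<in> car (polys k \<beta> X) then aron_berner k \<beta> \<beta>' X P v else 0)"


section \<open>Approximation property and complementation\<close>

text \<open>The net of operators is rendered by a proper filter on operators (its filter of tails).\<close>

definition approximation_property ::
    "real \<Rightarrow> ('k::real_or_complex, 'v::ab_group_add) nspace \<Rightarrow> bool" where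
  "approximation_property l Z \<longleftrightarrow>
     (\<exists>F :: ('v \<Rightarrow> 'v) filter. F \<noteq> bot \<and>
        (\<forall>\<^sub>F T in F. bdd_op Z Z T \<and> fin_dim_subspace Z (T ` car Z) \<and> op_norm Z Z T \<le> l) \<and>
        (\<forall>z\<in>car Z. ((\<lambda>T. nrm Z (T z - z)) \<longlongrightarrow> 0) F))"

text \<open>
  Here the bound \<open>l\<close> on the norms is attained. Complementation of the dual with constant \<open>l\<close> is
  equivalent to this property for all constants greater than \<open>l\<close>, and in general not to the
  property for \<open>l\<close> itself: e.g. for \<open>Z\<close> in its bidual and \<open>l = 1\<close> the latter fails if some finite
  subset of \<open>Z\<close> has no Chebyshev centre in \<open>Z\<close>.
\<close>

definition locally_complemented :: "real \<Rightarrow> ('k::real_or_complex, 'v::ab_group_add) nspace \<Rightarrow>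
    ('k, 'w::ab_group_add) nspace \<Rightarrow> ('v \<Rightarrow> 'w) \<Rightarrow> bool" where
  "locally_complemented l Z W i \<longleftrightarrow>
     (\<forall>F. fin_dim_subspace W F \<longrightarrow>
        (\<exists>r. bdd_op (restr W F) Z r \<and> op_norm (restr W F) Z r \<le> l \<and>
             (\<forall>z\<in>car Z. i z \<in> F \<longrightarrow> r (i z) = z)))"

text \<open>The dual of \<open>Z\<close> is an \<open>l\<close>-complemented subspace of the dual of \<open>W\<close> (through \<open>i\<close>).\<close>

definition dual_complemented :: "real \<Rightarrow> ('k::real_or_complex, 'v::ab_group_add) nspace \<Rightarrow>
    ('k, 'w::ab_group_add) nspace \<Rightarrow> ('v \<Rightarrow> 'w) \<Rightarrow> bool" where
  "dual_complemented l Z W i \<longleftrightarrow>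
     (\<exists>E. bdd_op (dual Z) (dual W) E \<and> op_norm (dual Z) (dual W) E \<le> l \<and>
          (\<forall>\<phi>\<in>car (dual Z). adjoint Z i (E \<phi>) = \<phi>))"

end

theory Submission
  imports Defs "HOL-Combinatorics.Permutations"
begin

text \<open>
  Write \<open>Z\<close> for the completed tensor product of \<open>X**\<close> and \<open>P(X)\<close> for the polynomials on \<open>X\<close>, so that
  \<open>\<Theta>\<close> maps \<open>Z\<close> into \<open>P(X)*\<close>. Everything follows from an operator \<open>E\<close> from \<open>Z* = P(X**)\<close> into \<open>P(X)**\<close>
  of norm at most \<open>l^k\<close> with \<open>\<Theta>* \<circ> E = id\<close> (\<open>dual_complemented_Theta\<close>).

  Suppose first that the finite rank operators \<open>T_i\<close> of norm at most \<open>l\<close> on \<open>X**\<close> that tend to the identity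
  are weak* continuous, \<open>T_i z = \<Sum>j. z(\<phi>_j) e_j\<close> with \<open>\<phi>_j\<close> in \<open>X*\<close>. For a polynomial \<open>Q\<close> on \<open>X**\<close> let \<open>Q_i\<close> be the
  restriction of \<open>Q \<circ> T_i\<close> to \<open>X\<close>; its norm is at most \<open>l^k\<close> times that of \<open>Q\<close> by the mapping property. Since \<open>T_i\<close> is
  weak* continuous of finite rank, the Aron-Berner extension of \<open>Q_i\<close> is \<open>Q \<circ> T_i\<close> (\<open>ab_ext_pull_tpow\<close>), which
  tends to \<open>Q\<close> on \<open>Z\<close>. So \<open>\<Theta> w (Q_i)\<close> tends to \<open>Q w\<close> for \<open>w\<close> in \<open>Z\<close>, and \<open>E Q \<xi> = lim \<xi>(Q_i)\<close> is as required,
  where \<open>lim\<close> is a linear functional of norm one on the bounded nets that extends the limit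
  (\<open>generalized_limit\<close>). In general the operators of the approximation property are not weak*
  continuous, but local reflexivity of \<open>X*\<close> replaces them by operators that are, of norm at most
  \<open>l + \<epsilon>\<close> (\<open>weak_star_continuous_approximation\<close>).

  That \<open>\<Theta>\<close> is defined and bounded means that the extension of a polynomial \<open>P\<close> on \<open>X\<close> is a bounded functional on
  the tensors over \<open>X**\<close> (\<open>aron_berner_form_bound\<close>). By finite generation it is enough to consider tensors over a
  finite dimensional subspace \<open>M\<close>. There local reflexivity gives operators \<open>T_1, \<dots>, T_k\<close> from \<open>M\<close> into \<open>X\<close>, of norm
  at most two and chosen one after the other as the iterated limit prescribes, such that the extension is
  approximately \<open>z \<mapsto> A(T_1 z, \<dots>, T_k z)\<close>, where \<open>A\<close> is the form of \<open>P\<close>. Polarization writes this as a combination of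
  the polynomials \<open>P \<circ> (\<Sum>i\<in>D. T_i)\<close>, and these are bounded by the mapping property. The lower bound
  of \<open>\<Theta>\<close> comes from \<open>E\<close>: the functionals \<open>E Q \<circ> \<Theta> = Q\<close> norm \<open>Z\<close>.

  Local complementation follows from \<open>E\<close> (\<open>locally_complemented_if_dual_complemented\<close>): evaluation of \<open>E\<close> at the points of a
  finite dimensional subspace is an operator into the bidual of \<open>Z\<close>, and local reflexivity moves it into \<open>Z\<close>
  without changing it at the points in the range of \<open>\<Theta>\<close>.

  All three uses of local reflexivity are instances of \<open>local_reflexivity\<close>, whose core is the solvability
  criterion \<open>helly\<close> for finite systems of seminorm inequalities. The analytic input is the Hahn-Banach
  theorem for seminorms over real or complex scalars (\<open>norming_functional\<close>).
\<close>

section \<open>Normed spaces, operators and duals\<close>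

lemma sum_fun_apply: "(\<Sum>i\<in>I. f i) x = (\<Sum>i\<in>I. (f i x :: 'b::comm_monoid_add))"
  by (induction I rule: infinite_finite_induct) (auto simp: zero_fun_def)

lemma normed_spaceD:
  assumes "normed_space X"
  shows ns_vector_space: "vector_space (smul X)"
    and ns_module: "module (smul X)"
    and ns_subspace: "module.subspace (smul X) (car X)"
    and nrm_nonneg: "x \<in> car X \<Longrightarrow> 0 \<le> nrm X x"
    and nrm_eq_0: "x \<in> car X \<Longrightarrow> nrm X x = 0 \<longleftrightarrow> x = 0"
    and nrm_smul: "x \<in> car X \<Longrightarrow> nrm X (smul X c x) = norm c * nrm X x"
    and nrm_add_le: "x \<in> car X \<Longrightarrow> y \<in> car X \<Longrightarrow> nrm X (x + y) \<le> nrm X x + nrm X y"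
  using assms by (auto simp: normed_space_def vector_space_def module_def)

lemma
  assumes "normed_space X"
  shows ns_zero: "0 \<in> car X"
    and ns_add: "x \<in> car X \<Longrightarrow> y \<in> car X \<Longrightarrow> x + y \<in> car X"
    and ns_smul: "x \<in> car X \<Longrightarrow> smul X c x \<in> car X"
    and ns_uminus: "x \<in> car X \<Longrightarrow> - x \<in> car X"
    and ns_diff: "x \<in> car X \<Longrightarrow> y \<in> car X \<Longrightarrow> x - y \<in> car X"
    and ns_sum: "(\<And>i. i \<in> I \<Longrightarrow> f i \<in> car X) \<Longrightarrow> (\<Sum>i\<in>I. f i) \<in> car X"
    and smul_minus_one: "smul X (-1) x = - x"
    and nrm_zero: "nrm X 0 = 0"
proof -
  interpret vector_space "smul X" by (rule ns_vector_space[OF assms])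
  note s = ns_subspace[OF assms]
  show z: "0 \<in> car X" and "x \<in> car X \<Longrightarrow> y \<in> car X \<Longrightarrow> x + y \<in> car X"
    "x \<in> car X \<Longrightarrow> smul X c x \<in> car X" "x \<in> car X \<Longrightarrow> - x \<in> car X"
    "x \<in> car X \<Longrightarrow> y \<in> car X \<Longrightarrow> x - y \<in> car X"
    "(\<And>i. i \<in> I \<Longrightarrow> f i \<in> car X) \<Longrightarrow> (\<Sum>i\<in>I. f i) \<in> car X"
    using s by (auto intro: subspace_0 subspace_add subspace_scale subspace_neg subspace_diff subspace_sum)
  show "smul X (-1) x = - x" by simp
  show "nrm X 0 = 0" using nrm_eq_0[OF assms z] by simp
qed

lemma nrm_diff_le:
  assumes "normed_space X" "x \<in> car X" "y \<in> car X"
  shows "nrm X (x - y) \<le> nrm X x + nrm X y"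
proof -
  have "nrm X (- y) = nrm X y"
    using nrm_smul[OF assms(1,3), of "-1"] by (simp add: smul_minus_one[OF assms(1)])
  then show ?thesis
    using nrm_add_le[OF assms(1,2), of "-y"] ns_uminus[OF assms(1,3)] by simp
qed

lemma nrm_sum_le:
  assumes "normed_space X" "\<And>i. i \<in> I \<Longrightarrow> f i \<in> car X"
  shows "nrm X (\<Sum>i\<in>I. f i) \<le> (\<Sum>i\<in>I. nrm X (f i))"
  using assms(2)
proof (induction I rule: infinite_finite_induct)
  case (insert i I)
  have "nrm X (f i + sum f I) \<le> nrm X (f i) + nrm X (sum f I)"
    by (intro nrm_add_le[OF assms(1)] ns_sum[OF assms(1)]) (use insert in auto)
  then show ?case using insert by fastforce
qed (auto simp: nrm_zero[OF assms(1)])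

lemma normed_space_restr:
  assumes "normed_space X" "module.subspace (smul X) M" "M \<subseteq> car X"
  shows "normed_space (restr X M)"
  using assms unfolding normed_space_def restr_def by (auto simp: subset_eq)

lemma restr_simps [simp]:
  "car (restr X M) = M" "smul (restr X M) = smul X" "nrm (restr X M) = nrm X"
  by (simp_all add: restr_def)

lemma fin_dim_subspaceD:
  assumes "normed_space X" "fin_dim_subspace X M"
  shows "normed_space (restr X M)" "M \<subseteq> car X" "module.subspace (smul X) M"
proof -
  interpret vector_space "smul X" by (rule ns_vector_space[OF assms(1)])
  show "M \<subseteq> car X" "subspace M" using assms by (auto simp: fin_dim_subspace_def)
  then show "normed_space (restr X M)" using normed_space_restr assms(1) by blast
qed

lemma normed_space_scalars: "normed_space (scalars :: ('k::real_or_complex, 'k) nspace)"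
proof -
  have "vector_space ((*) :: 'k \<Rightarrow> 'k \<Rightarrow> 'k)"
    by unfold_locales (auto simp: algebra_simps)
  then show ?thesis
    using module.subspace_UNIV[of "(*) :: 'k \<Rightarrow> 'k \<Rightarrow> 'k"]
    by (auto simp: normed_space_def scalars_def norm_mult norm_triangle_ineq vector_space_def module_def)
qed

lemma scalars_simps [simp]:
  "car (scalars :: ('k::real_or_complex, 'k) nspace) = UNIV"
  "smul (scalars :: ('k::real_or_complex, 'k) nspace) = (*)"
  "nrm (scalars :: ('k::real_or_complex, 'k) nspace) = norm"
  by (simp_all add: scalars_def)

lemma
  assumes "lin_op X Y T"
  shows lin_op_in: "x \<in> car X \<Longrightarrow> T x \<in> car Y"
    and lin_op_add: "x \<in> car X \<Longrightarrow> y \<in> car X \<Longrightarrow> T (x + y) = T x + T y"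
    and lin_op_smul: "x \<in> car X \<Longrightarrow> T (smul X c x) = smul Y c (T x)"
  using assms by (auto simp: lin_op_def)

lemma
  assumes X: "normed_space X" and T: "lin_op X Y T"
  shows lin_op_zero: "T 0 = 0"
    and lin_op_diff: "x \<in> car X \<Longrightarrow> y \<in> car X \<Longrightarrow> T (x - y) = T x - T y"
    and lin_op_sum: "(\<And>i. i \<in> I \<Longrightarrow> f i \<in> car X) \<Longrightarrow> T (\<Sum>i\<in>I. f i) = (\<Sum>i\<in>I. T (f i))"
proof -
  show z: "T 0 = 0" using lin_op_add[OF T, of 0 0] ns_zero[OF X] by simp
  show "T (x - y) = T x - T y" if "x \<in> car X" "y \<in> car X"
    using lin_op_add[OF T, of "x - y" y] that ns_diff[OF X] by simp
  show "(\<And>i. i \<in> I \<Longrightarrow> f i \<in> car X) \<Longrightarrow> T (\<Sum>i\<in>I. f i) = (\<Sum>i\<in>I. T (f i))"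
    by (induction I rule: infinite_finite_induct)
      (auto simp: z lin_op_add[OF T] ns_sum[OF X])
qed

lemma lin_op_lincomb:
  assumes "normed_space X" "lin_op X Y T" "\<And>i. i \<in> I \<Longrightarrow> x i \<in> car X"
  shows "T (\<Sum>i\<in>I. smul X (c i) (x i)) = (\<Sum>i\<in>I. smul Y (c i) (T (x i)))"
  using assms by (simp add: lin_op_sum ns_smul lin_op_smul cong: sum.cong)

lemma op_norm_le:
  assumes "normed_space X" "lin_op X Y T" "0 \<le> K" "\<And>x. x \<in> car X \<Longrightarrow> nrm Y (T x) \<le> K * nrm X x"
  shows "op_norm X Y T \<le> K"
  unfolding op_norm_def
proof (rule cSup_least)
  show "{nrm Y (T x) |x. x \<in> car X \<and> nrm X x \<le> 1} \<noteq> {}"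
    using ns_zero[OF assms(1)] nrm_zero[OF assms(1)] by force
  fix a assume "a \<in> {nrm Y (T x) |x. x \<in> car X \<and> nrm X x \<le> 1}"
  then obtain x where x: "a = nrm Y (T x)" "x \<in> car X" "nrm X x \<le> 1" by blast
  have "a \<le> K * nrm X x" using x assms(4) by simp
  also have "\<dots> \<le> K * 1" by (intro mult_left_mono x assms)
  finally show "a \<le> K" by simp
qed

lemma bdd_op_nonneg_bound:
  assumes "normed_space X" "bdd_op X Y T"
  obtains K where "0 \<le> K" "\<And>x. x \<in> car X \<Longrightarrow> nrm Y (T x) \<le> K * nrm X x"
proof -
  obtain K where K: "\<And>x. x \<in> car X \<Longrightarrow> nrm Y (T x) \<le> K * nrm X x"
    using assms(2) by (auto simp: bdd_op_def)
  have "nrm Y (T x) \<le> max K 0 * nrm X x" if "x \<in> car X" for x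
    using K[OF that] mult_right_mono[OF max.cobounded1[of K 0] nrm_nonneg[OF assms(1) that]] by simp
  then show thesis using that[of "max K 0"] by simp
qed

lemma
  assumes X: "normed_space X" and Y: "normed_space Y" and T: "bdd_op X Y T"
  shows op_norm_nonneg: "0 \<le> op_norm X Y T"
    and op_norm_bound: "x \<in> car X \<Longrightarrow> nrm Y (T x) \<le> op_norm X Y T * nrm X x"
proof -
  let ?S = "{nrm Y (T x) |x. x \<in> car X \<and> nrm X x \<le> 1}"
  have lin: "lin_op X Y T" using T by (simp add: bdd_op_def)
  obtain K where K: "0 \<le> K" "\<And>x. x \<in> car X \<Longrightarrow> nrm Y (T x) \<le> K * nrm X x"
    using bdd_op_nonneg_bound[OF X T] by blast
  have bdd: "bdd_above ?S"
  proof (rule bdd_aboveI[of _ K])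
    fix a assume "a \<in> ?S"
    then obtain x where x: "a = nrm Y (T x)" "x \<in> car X" "nrm X x \<le> 1" by blast
    have "a \<le> K * nrm X x" using x K by simp
    also have "\<dots> \<le> K * 1" by (intro mult_left_mono x K)
    finally show "a \<le> K" by simp
  qed
  have "nrm Y (T 0) \<in> ?S" using ns_zero[OF X] nrm_zero[OF X] by force
  from cSup_upper[OF this bdd] show "0 \<le> op_norm X Y T"
    by (simp add: op_norm_def lin_op_zero[OF X lin] nrm_zero[OF Y])
  show "nrm Y (T x) \<le> op_norm X Y T * nrm X x" if x: "x \<in> car X"
  proof (cases "x = 0")
    case True
    then show ?thesis by (simp add: lin_op_zero[OF X lin] nrm_zero[OF Y] nrm_zero[OF X])
  next
    case False
    define r where "r = nrm X x"
    have r: "r > 0" using nrm_nonneg[OF X x] nrm_eq_0[OF X x] False by (simp add: r_def)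
    let ?u = "smul X (of_real (1 / r)) x"
    have u: "?u \<in> car X" "nrm X ?u = 1"
      using r x by (auto simp: ns_smul[OF X] nrm_smul[OF X] norm_divide r_def[symmetric])
    then have "nrm Y (T ?u) \<in> ?S" by force
    from cSup_upper[OF this bdd] have "nrm Y (T ?u) \<le> op_norm X Y T"
      by (simp add: op_norm_def)
    moreover have "nrm Y (T ?u) = nrm Y (T x) / r"
      using r by (simp add: lin_op_smul[OF lin x] nrm_smul[OF Y lin_op_in[OF lin x]] norm_divide)
    ultimately show ?thesis using r by (simp add: r_def divide_le_eq)
  qed
qed

lemma dual_simps [simp]: "smul (dual X) = fscale" "nrm (dual X) = op_norm X scalars"
  by (simp_all add: dual_def)

lemma fscale_apply [simp]: "fscale c f x = c * f x"
  by (simp add: fscale_def)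

lemma mem_dual_iff:
  "\<phi> \<in> car (dual X) \<longleftrightarrow> bdd_op X scalars \<phi> \<and> (\<forall>x. x \<notin> car X \<longrightarrow> \<phi> x = 0)"
  by (simp add: dual_def)

lemma
  assumes "\<phi> \<in> car (dual X)"
  shows dual_bdd_op: "bdd_op X scalars \<phi>"
    and dual_lin_op: "lin_op X scalars \<phi>"
    and dual_off: "x \<notin> car X \<Longrightarrow> \<phi> x = 0"
    and dual_add: "x \<in> car X \<Longrightarrow> y \<in> car X \<Longrightarrow> \<phi> (x + y) = \<phi> x + \<phi> y"
    and dual_smul: "x \<in> car X \<Longrightarrow> \<phi> (smul X c x) = c * \<phi> x"
  using assms by (auto simp: mem_dual_iff bdd_op_def lin_op_def)

lemma dual_bound:
  assumes "normed_space X" "\<phi> \<in> car (dual X)" "x \<in> car X"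
  shows "norm (\<phi> x) \<le> op_norm X scalars \<phi> * nrm X x"
  using op_norm_bound[OF assms(1) normed_space_scalars dual_bdd_op[OF assms(2)] assms(3)] by simp

text \<open>
  Elements of a dual space vanish off the carrier; this turns a functional that is given on the
  carrier into such an element.
\<close>

definition zero_off :: "'v set \<Rightarrow> ('v \<Rightarrow> 'k::zero) \<Rightarrow> 'v \<Rightarrow> 'k" where
  "zero_off S f = (\<lambda>x. if x \<in> S then f x else 0)"

lemma zero_off_in [simp]: "x \<in> S \<Longrightarrow> zero_off S f x = f x"
  by (simp add: zero_off_def)

lemma zero_off_dual:
  assumes X: "normed_space X"
    and "\<And>x y. x \<in> car X \<Longrightarrow> y \<in> car X \<Longrightarrow> f (x + y) = f x + f y"
    and "\<And>c x. x \<in> car X \<Longrightarrow> f (smul X c x) = c * f x"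
    and "0 \<le> K" "\<And>x. x \<in> car X \<Longrightarrow> norm (f x) \<le> K * nrm X x"
  shows "zero_off (car X) f \<in> car (dual X)" "op_norm X scalars (zero_off (car X) f) \<le> K"
proof -
  have l: "lin_op X scalars (zero_off (car X) f)"
    using assms ns_add[OF X] ns_smul[OF X] by (auto simp: lin_op_def)
  then show "zero_off (car X) f \<in> car (dual X)"
    using assms by (auto simp: mem_dual_iff bdd_op_def zero_off_def intro!: exI[of _ K])
  show "op_norm X scalars (zero_off (car X) f) \<le> K"
    using assms by (intro op_norm_le[OF X l]) auto
qed

lemma dual_eqI:
  assumes "\<phi> \<in> car (dual X)" "\<psi> \<in> car (dual X)" "\<And>x. x \<in> car X \<Longrightarrow> \<phi> x = \<psi> x"
  shows "\<phi> = \<psi>"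
proof
  show "\<phi> x = \<psi> x" for x
    using assms(3) dual_off[OF assms(1)] dual_off[OF assms(2)] by (cases "x \<in> car X") auto
qed

lemma dual_norm_le:
  assumes X: "normed_space X" and "\<phi> \<in> car (dual X)" "0 \<le> K"
    "\<And>x. x \<in> car X \<Longrightarrow> norm (\<phi> x) \<le> K * nrm X x"
  shows "op_norm X scalars \<phi> \<le> K"
  using assms by (intro op_norm_le[OF X dual_lin_op]) auto

lemma normed_space_dual:
  fixes X :: "('k::real_or_complex, 'v::ab_group_add) nspace"
  assumes X: "normed_space X"
  shows "normed_space (dual X)"
proof -
  interpret vector_space "fscale :: 'k \<Rightarrow> ('v \<Rightarrow> 'k) \<Rightarrow> 'v \<Rightarrow> 'k" by (rule vector_space_fscale)
  note on = op_norm_nonneg[OF X normed_space_scalars dual_bdd_op]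
  note ob = dual_bound[OF X]
  have z: "0 \<in> car (dual X)"
    by (auto simp: mem_dual_iff bdd_op_def lin_op_def intro!: exI[of _ 0])
  have scale: "fscale c \<phi> \<in> car (dual X)" "op_norm X scalars (fscale c \<phi>) \<le> norm c * op_norm X scalars \<phi>"
    if "\<phi> \<in> car (dual X)" for c \<phi>
  proof -
    have e: "fscale c \<phi> = zero_off (car X) (\<lambda>x. c * \<phi> x)"
      using dual_off[OF that] by (auto simp: zero_off_def)
    have b: "norm (c * \<phi> x) \<le> (norm c * op_norm X scalars \<phi>) * nrm X x" if "x \<in> car X" for x
      using ob[OF \<open>\<phi> \<in> _\<close> that] by (simp add: norm_mult mult.assoc mult_left_mono)
    show "fscale c \<phi> \<in> car (dual X)" "op_norm X scalars (fscale c \<phi>) \<le> norm c * op_norm X scalars \<phi>"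
      unfolding e using dual_add[OF that] dual_smul[OF that] on[OF that] b
      by (intro zero_off_dual[OF X, where K = "norm c * op_norm X scalars \<phi>"];
          simp add: algebra_simps)+
  qed
  have add: "\<phi> + \<psi> \<in> car (dual X)"
    "op_norm X scalars (\<phi> + \<psi>) \<le> op_norm X scalars \<phi> + op_norm X scalars \<psi>"
    if "\<phi> \<in> car (dual X)" "\<psi> \<in> car (dual X)" for \<phi> \<psi>
  proof -
    have e: "\<phi> + \<psi> = zero_off (car X) (\<lambda>x. \<phi> x + \<psi> x)"
      using dual_off[OF that(1)] dual_off[OF that(2)] by (auto simp: zero_off_def)
    have b: "norm (\<phi> x + \<psi> x) \<le> (op_norm X scalars \<phi> + op_norm X scalars \<psi>) * nrm X x"
      if "x \<in> car X" for x
      using norm_triangle_ineq[of "\<phi> x" "\<psi> x"] ob[OF \<open>\<phi> \<in> _\<close> that] ob[OF \<open>\<psi> \<in> _\<close> that]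
      by (simp add: algebra_simps)
    show "\<phi> + \<psi> \<in> car (dual X)"
      "op_norm X scalars (\<phi> + \<psi>) \<le> op_norm X scalars \<phi> + op_norm X scalars \<psi>"
      unfolding e using dual_add[OF that(1)] dual_smul[OF that(1)] on[OF that(1)]
        dual_add[OF that(2)] dual_smul[OF that(2)] on[OF that(2)] b
      by (intro zero_off_dual[OF X, where K = "op_norm X scalars \<phi> + op_norm X scalars \<psi>"];
          simp add: algebra_simps)+
  qed
  have eq0: "op_norm X scalars \<phi> = 0 \<longleftrightarrow> \<phi> = 0" if "\<phi> \<in> car (dual X)" for \<phi>
  proof
    assume "op_norm X scalars \<phi> = 0"
    then have "\<phi> x = 0" if "x \<in> car X" for x using ob[OF \<open>\<phi> \<in> _\<close> that] by simp
    then show "\<phi> = 0" using that z by (intro dual_eqI[of _ X]) auto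
  next
    assume "\<phi> = 0"
    then show "op_norm X scalars \<phi> = 0"
      using on[OF z] op_norm_le[OF X dual_lin_op[OF z], of 0] by simp
  qed
  have sc: "op_norm X scalars (fscale c \<phi>) = norm c * op_norm X scalars \<phi>"
    if "\<phi> \<in> car (dual X)" for c \<phi>
  proof (cases "c = 0")
    case True
    then show ?thesis using eq0[OF z] by simp
  next
    case False
    have "op_norm X scalars (fscale (1/c) (fscale c \<phi>)) \<le> norm (1/c) * op_norm X scalars (fscale c \<phi>)"
      using scale that by blast
    then show ?thesis using scale(2)[OF that, of c] False
      by (simp add: norm_divide field_simps)
  qed
  show ?thesis
    unfolding normed_space_def dual_simps
    using z scale(1) sc add on eq0 by (auto simp: vector_space_axioms subspace_def)
qed

lemmas normed_space_bidual = normed_space_dual[OF normed_space_dual]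

lemma canon_bidual:
  assumes X: "normed_space X" and x: "x \<in> car X"
  shows "canon X x \<in> car (bidual X)" "nrm (bidual X) (canon X x) \<le> nrm X x"
proof -
  have e: "canon X x = zero_off (car (dual X)) (\<lambda>\<phi>. \<phi> x)"
    by (simp add: canon_def zero_off_def)
  show "canon X x \<in> car (bidual X)" "nrm (bidual X) (canon X x) \<le> nrm X x"
    unfolding e dual_simps
    using dual_bound[OF X _ x] nrm_nonneg[OF X x]
    by (intro zero_off_dual[OF normed_space_dual[OF X], where K = "nrm X x"]; simp add: mult.commute)+
qed

lemma canon_apply [simp]: "\<phi> \<in> car (dual X) \<Longrightarrow> canon X x \<phi> = \<phi> x"
  by (simp add: canon_def)

lemma
  assumes "normed_space X"
  shows canon_add: "x \<in> car X \<Longrightarrow> y \<in> car X \<Longrightarrow> canon X (x + y) = canon X x + canon X y"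
    and canon_smul: "x \<in> car X \<Longrightarrow> canon X (smul X c x) = fscale c (canon X x)"
  by (auto simp: canon_def fun_eq_iff dual_add dual_smul)

lemma lin_op_canon: "normed_space X \<Longrightarrow> lin_op X (bidual X) (canon X)"
  by (auto simp: lin_op_def canon_bidual canon_add canon_smul)

section \<open>The Hahn-Banach theorem\<close>

definition sublinear :: "('k::real_or_complex \<Rightarrow> 'v::ab_group_add \<Rightarrow> 'v) \<Rightarrow> ('v \<Rightarrow> real) \<Rightarrow> bool" where
  "sublinear s q \<longleftrightarrow> (\<forall>x y. q (x + y) \<le> q x + q y) \<and> (\<forall>t\<ge>0. \<forall>x. q (s (of_real t) x) \<le> t * q x)"

lemma
  assumes "vector_space s" "sublinear s q"
  shows sublinear_zero: "q 0 = 0"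
    and sublinear_neg: "- q (- x) \<le> q x"
    and sublinear_scale: "t \<ge> 0 \<Longrightarrow> q (s (of_real t) x) = t * q x"
proof -
  interpret vector_space s by fact
  have add: "q (x + y) \<le> q x + q y" and sc: "t \<ge> 0 \<Longrightarrow> q (s (of_real t) x) \<le> t * q x" for x y t
    using assms(2) by (auto simp: sublinear_def)
  show z: "q 0 = 0" using add[of 0 0] sc[of 0 0] by simp
  show "- q (- x) \<le> q x" using add[of x "-x"] z by simp
  show "q (s (of_real t) x) = t * q x" if "t \<ge> 0"
  proof (cases "t = 0")
    case False
    have "q (s (of_real (1/t)) (s (of_real t) x)) \<le> (1/t) * q (s (of_real t) x)"
      using that by (intro sc) simp
    moreover have "s (of_real (1/t)) (s (of_real t) x) = x"
      using False by simp
    ultimately have "q x \<le> (1/t) * q (s (of_real t) x)" by metis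
    then have "t * q x \<le> q (s (of_real t) x)" using that False
      by (simp add: field_simps)
    then show ?thesis using sc[OF that, of x] by simp
  qed (simp add: z)
qed

text \<open>
  The infimum of \<open>q (x + s (of_real t) y) - t * q y\<close> over \<open>t \<ge> 0\<close> is sublinear and, for \<open>x = - y\<close> and
  \<open>t = 1\<close>, at most \<open>- q y\<close>. A minimal sublinear function thus satisfies \<open>q (- y) \<le> - q y\<close> for all \<open>y\<close>.
\<close>

lemma sublinear_below_linear_along:
  assumes vs: "vector_space s" and q: "sublinear s q"
  obtains q' where "sublinear s q'" "\<And>x. q' x \<le> q x" "q' (- y) \<le> - q y"
proof -
  interpret vector_space s by (rule vs)
  have add: "q (x + y) \<le> q x + q y" for x y
    using q by (auto simp: sublinear_def)
  note sc = sublinear_scale[OF vs q] and z = sublinear_zero[OF vs q]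
  define R where "R x = (\<lambda>t. q (x + s (of_real t) y) - t * q y) ` {0..}" for x
  define q' where "q' x = Inf (R x)" for x
  have bdd: "bdd_below (R x)" for x
  proof (rule bdd_belowI[of _ "- q (- x)"])
    fix a assume "a \<in> R x"
    then obtain t where t: "t \<ge> 0" "a = q (x + s (of_real t) y) - t * q y" by (auto simp: R_def)
    have "q (s (of_real t) y) \<le> q (x + s (of_real t) y) + q (- x)"
      using add[of "x + s (of_real t) y" "- x"] by simp
    then show "- q (- x) \<le> a" using sc[OF t(1), of y] t by simp
  qed
  have le: "q' x \<le> q (x + s (of_real t) y) - t * q y" if "t \<ge> 0" for x t
    unfolding q'_def by (rule cInf_lower[OF _ bdd]) (use that in \<open>auto simp: R_def\<close>)
  have ge: "c \<le> q' x" if "\<And>t. t \<ge> 0 \<Longrightarrow> c \<le> q (x + s (of_real t) y) - t * q y" for c x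
    unfolding q'_def by (rule cInf_greatest) (use that in \<open>auto simp: R_def\<close>)
  show thesis
  proof
    show "q' x \<le> q x" for x using le[of 0 x] by simp
    show "q' (- y) \<le> - q y" using le[of 1 "-y"] z by simp
    show "sublinear s q'"
      unfolding sublinear_def
    proof (intro conjI allI impI)
      fix x x'
      have "q' (x + x') - (q (x' + s (of_real t') y) - t' * q y) \<le> q' x" if t': "t' \<ge> 0" for t'
      proof (rule ge)
        fix t :: real assume t: "t \<ge> 0"
        have "q' (x + x') \<le> q ((x + x') + s (of_real (t + t')) y) - (t + t') * q y"
          using t t' by (intro le) auto
        also have "(x + x') + s (of_real (t + t')) y = (x + s (of_real t) y) + (x' + s (of_real t') y)"
          by (simp add: scale_left_distrib)
        finally show "q' (x + x') - (q (x' + s (of_real t') y) - t' * q y)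
            \<le> q (x + s (of_real t) y) - t * q y"
          using add[of "x + s (of_real t) y" "x' + s (of_real t') y"] by (simp add: algebra_simps)
      qed
      then have "q' (x + x') - q' x \<le> q' x'" by (intro ge) (simp add: algebra_simps)
      then show "q' (x + x') \<le> q' x + q' x'" by simp
    next
      fix c :: real and x assume c: "0 \<le> c"
      show "q' (s (of_real c) x) \<le> c * q' x"
      proof (cases "c = 0")
        case True
        then show ?thesis using le[of 0 0] z by simp
      next
        case False
        have "q' (s (of_real c) x) / c \<le> q' x"
        proof (rule ge)
          fix t :: real assume t: "t \<ge> 0"
          have "q' (s (of_real c) x) \<le> q (s (of_real c) x + s (of_real (c * t)) y) - (c * t) * q y"
            using c t by (intro le) auto
          also have "s (of_real c) x + s (of_real (c * t)) y = s (of_real c) (x + s (of_real t) y)"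
            by (simp add: scale_right_distrib)
          also have "q \<dots> = c * q (x + s (of_real t) y)" by (rule sc[OF c])
          finally show "q' (s (of_real c) x) / c \<le> q (x + s (of_real t) y) - t * q y"
            using c False by (simp add: field_simps)
        qed
        then show ?thesis using c False by (simp add: field_simps)
      qed
    qed
  qed
qed

text \<open>
  The infimum of a chain of sublinear functions is sublinear, so that Zorn's lemma gives a minimal
  one below \<open>p\<close>. It is odd by the previous lemma, and odd sublinear functions are linear.
\<close>

lemma sublinear_above_linear:
  assumes vs: "vector_space s" and p: "sublinear s p"
  obtains g where "\<And>x y. g (x + y) = g x + g y" "\<And>t x. g (s (of_real t) x) = t * g x"
    "\<And>x. g x \<le> p x"
proof -
  interpret vector_space s by (rule vs)
  define A where "A = {q. sublinear s q \<and> q \<le> p}"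
  have "\<exists>m\<in>A. \<forall>a\<in>A. a \<le> m \<longrightarrow> a = m"
  proof (rule predicate_Zorn[of A "\<lambda>a b. b \<le> a"])
    show "partial_order_on A (relation_of (\<lambda>a b. b \<le> a) A)"
      by (rule partial_order_on_relation_ofI) auto
    fix C assume C: "C \<in> Chains (relation_of (\<lambda>a b. b \<le> a) A)"
    show "\<exists>u\<in>A. \<forall>a\<in>C. u \<le> a"
    proof (cases "C = {}")
      case True
      then show ?thesis using p by (auto simp: A_def)
    next
      case ne: False
      have CA: "q \<in> A" if "q \<in> C" for q
        using that C by (auto simp: Chains_def relation_of_def)
      have ch: "q \<le> q' \<or> q' \<le> q" if "q \<in> C" "q' \<in> C" for q q'
        using that C by (auto simp: Chains_def relation_of_def)
      define u where "u x = (INF q\<in>C. q x)" for x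
      have bdd: "bdd_below ((\<lambda>q. q x) ` C)" for x
      proof (rule bdd_belowI2[of _ "- p (- x)"])
        fix q assume "q \<in> C"
        then have "sublinear s q" "q (-x) \<le> p (-x)" using CA by (auto simp: A_def le_fun_def)
        then show "- p (- x) \<le> q x" using sublinear_neg[OF vs, of q x] by simp
      qed
      have ul: "u x \<le> q x" if "q \<in> C" for q x
        unfolding u_def by (rule cINF_lower[OF bdd that])
      have ug: "c \<le> u x" if "\<And>q. q \<in> C \<Longrightarrow> c \<le> q x" for c x
        unfolding u_def by (rule cINF_greatest[OF ne that])
      have "sublinear s u"
        unfolding sublinear_def
      proof (intro conjI allI impI)
        fix x y
        have *: "u (x + y) \<le> q x + q' y" if q: "q \<in> C" "q' \<in> C" for q q'
        proof -
          obtain r where r: "r \<in> C" "r \<le> q" "r \<le> q'" using ch[OF q] q by blast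
          have "u (x + y) \<le> r (x + y)" using ul r by blast
          also have "\<dots> \<le> r x + r y" using CA[of r] r by (auto simp: A_def sublinear_def)
          also have "\<dots> \<le> q x + q' y" using r by (auto simp: le_fun_def intro: add_mono)
          finally show ?thesis .
        qed
        have "u (x + y) - q' y \<le> u x" if "q' \<in> C" for q'
          by (rule ug) (use *[OF _ that] in \<open>simp add: algebra_simps\<close>)
        then have "u (x + y) - u x \<le> u y" by (intro ug) (simp add: algebra_simps)
        then show "u (x + y) \<le> u x + u y" by simp
      next
        fix t :: real and x assume t: "0 \<le> t"
        have b: "u (s (of_real t) x) \<le> t * q x" if "q \<in> C" for q
          using order_trans[OF ul[OF that, of "s (of_real t) x"], of "t * q x"] CA[OF that] t
          by (auto simp: A_def sublinear_def)
        show "u (s (of_real t) x) \<le> t * u x"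
        proof (cases "t = 0")
          case True
          then show ?thesis using b ne by auto
        next
          case False
          then have "u (s (of_real t) x) / t \<le> u x"
            using b t by (intro ug) (simp add: field_simps)
          then show ?thesis using t False by (simp add: field_simps)
        qed
      qed
      moreover have "u \<le> p"
      proof -
        obtain q where "q \<in> C" using ne by blast
        then show ?thesis using ul[of q] CA[of q] by (fastforce simp: A_def le_fun_def intro: order_trans)
      qed
      ultimately show ?thesis using ul by (auto simp: A_def le_fun_def)
    qed
  qed
  then obtain g where g: "sublinear s g" "g \<le> p" and min: "\<And>q. sublinear s q \<Longrightarrow> q \<le> g \<Longrightarrow> q = g"
    unfolding A_def by (blast intro: order_trans)
  have neg: "g (- y) = - g y" for y
  proof -
    obtain q' where "sublinear s q'" "\<And>x. q' x \<le> g x" "q' (- y) \<le> - g y"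
      using sublinear_below_linear_along[OF vs g(1)] by blast
    then have "g (- y) \<le> - g y" using min[of q'] by (auto simp: le_fun_def)
    then show ?thesis using sublinear_neg[OF vs g(1), of y] by simp
  qed
  have sub: "g (x + y) \<le> g x + g y" for x y using g(1) by (auto simp: sublinear_def)
  show thesis
  proof
    show "g (x + y) = g x + g y" for x y
      using sub[of x y] sub[of "-x" "-y"] neg[of "x + y"] neg[of x] neg[of y] by simp
    show "g (s (of_real t) x) = t * g x" for t x
    proof (cases "t \<ge> 0")
      case True
      then show ?thesis by (rule sublinear_scale[OF vs g(1)])
    next
      case False
      then have "g (s (of_real (- t)) x) = (- t) * g x"
        by (intro sublinear_scale[OF vs g(1)]) simp
      then show ?thesis using neg[of "s (of_real t) x"] by (simp add: scale_minus_left)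
    qed
    show "g x \<le> p x" for x using g(2) by (simp add: le_fun_def)
  qed
qed

text \<open>
  An additive isometry that fixes one fixes every real number: its value at \<open>t\<close> is at distance \<open>\<bar>t\<bar>\<close> from
  zero and at distance \<open>\<bar>t - 1\<bar>\<close> from one.
\<close>

lemma scalar_embedding:
  "\<exists>e :: 'k::real_or_complex \<Rightarrow> complex.
    (\<forall>x y. e (x + y) = e x + e y) \<and> (\<forall>x y. e (x * y) = e x * e y) \<and> (\<forall>x. cmod (e x) = norm x) \<and>
    (range e = \<real> \<or> range e = UNIV) \<and> (\<forall>t. e (of_real t) = of_real t) \<and> inj e"
proof -
  obtain e :: "'k \<Rightarrow> complex" where e: "\<And>x y. e (x + y) = e x + e y" "\<And>x y. e (x * y) = e x * e y"
    "\<And>x. cmod (e x) = norm x" "range e = \<real> \<or> range e = UNIV"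
    using real_or_complex_embedding by blast
  have z: "e 0 = 0" using e(3)[of 0] by simp
  have minus: "e (x - y) = e x - e y" for x y
    using e(1)[of "x - y" y] by simp
  have "e 1 * e 1 = e 1" using e(2)[of 1 1] by simp
  then have one: "e 1 = 1" using e(3)[of 1] by auto
  have r: "e (of_real t) = of_real t" for t
  proof -
    define c where "c = e (of_real t)"
    have n: "cmod c = \<bar>t\<bar>" using e(3)[of "of_real t"] by (simp add: c_def)
    have "c - 1 = e (of_real (t - 1))" by (simp add: c_def minus one)
    then have n1: "cmod (c - 1) = \<bar>t - 1\<bar>" using e(3)[of "of_real (t - 1)"] by (simp only: norm_of_real)
    have "(Re c)\<^sup>2 + (Im c)\<^sup>2 = t\<^sup>2" using n cmod_power2[of c] by simp
    moreover have "(Re c - 1)\<^sup>2 + (Im c)\<^sup>2 = (t - 1)\<^sup>2" using n1 cmod_power2[of "c - 1"] by simp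
    ultimately have "Re c = t" by (simp add: power2_eq_square algebra_simps)
    then have "Im c = 0" using \<open>(Re c)\<^sup>2 + (Im c)\<^sup>2 = t\<^sup>2\<close> by simp
    then show ?thesis using \<open>Re c = t\<close> by (simp add: c_def complex_eq_iff)
  qed
  have "inj e"
  proof (rule injI)
    fix x y assume "e x = e y"
    then have "cmod (e (x - y)) = 0" by (simp add: minus)
    then show "x = y" by (simp add: e(3))
  qed
  then show ?thesis using e r by auto
qed

definition seminorm_on :: "('k::real_or_complex \<Rightarrow> 'v::ab_group_add \<Rightarrow> 'v) \<Rightarrow> 'v set \<Rightarrow> ('v \<Rightarrow> real) \<Rightarrow> bool" where
  "seminorm_on s V p \<longleftrightarrow> (\<forall>x\<in>V. \<forall>y\<in>V. p (x + y) \<le> p x + p y) \<and> (\<forall>c. \<forall>x\<in>V. p (s c x) = norm c * p x)"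

text \<open>
  A real linear functional \<open>g \<le> p\<close> with \<open>g y = p y\<close> exists because \<open>p\<close> may first be replaced by a
  sublinear function below it with value at most \<open>- p y\<close> at \<open>- y\<close>. Over the complex numbers \<open>g\<close> is the real part of
  \<open>f x = g x - \<iota> g (\<iota> x)\<close>, and rotating \<open>x\<close> until \<open>f x\<close> is real and nonnegative gives \<open>norm (f x) \<le> p x\<close>.
\<close>

lemma norming_functional_UNIV:
  fixes s :: "'k::real_or_complex \<Rightarrow> 'v::ab_group_add \<Rightarrow> 'v"
  assumes vs: "vector_space s" and p: "seminorm_on s UNIV p"
  obtains f where "\<And>x y. f (x + y) = f x + f y" "\<And>c x. f (s c x) = c * f x"
    "\<And>x. norm (f x) \<le> p x" "f y = of_real (p y)"
proof -
  interpret vector_space s by (rule vs)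
  have add: "p (x + y) \<le> p x + p y" and sc: "p (s c x) = norm c * p x" for x y c
    using p by (auto simp: seminorm_on_def)
  have p0: "p 0 = 0" using sc[of 0 0] by simp
  have pneg: "p (- x) = p x" for x using sc[of "-1" x] by simp
  have "sublinear s p" using add sc by (auto simp: sublinear_def)
  then obtain q where q: "sublinear s q" "\<And>x. q x \<le> p x" "q (- y) \<le> - p y"
    using sublinear_below_linear_along[OF vs] by blast
  obtain g where g: "\<And>x y. g (x + y) = g x + g y" "\<And>t x. g (s (of_real t) x) = t * g x" "\<And>x. g x \<le> q x"
    using sublinear_above_linear[OF vs q(1)] by blast
  have gp: "g x \<le> p x" for x using g(3) q(2) order_trans by blast
  have gneg: "g (- x) = - g x" for x using g(2)[of "-1" x] by simp
  have gy: "g y = p y" using g(3)[of "-y"] q(3) gneg[of y] gp[of y] by simp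
  obtain e :: "'k \<Rightarrow> complex" where e: "\<And>x y. e (x + y) = e x + e y" "\<And>x y. e (x * y) = e x * e y"
    "\<And>x. cmod (e x) = norm x" "range e = \<real> \<or> range e = UNIV" "\<And>t. e (of_real t) = of_real t" "inj e"
    using scalar_embedding[where ?'k = 'k] by auto
  from e(4) show thesis
  proof
    assume R: "range e = \<real>"
    have re: "\<exists>r. c = of_real r" for c :: 'k
    proof -
      obtain r where "e c = of_real r" using R by (metis Reals_cases rangeI)
      then have "e c = e (of_real r)" using e(5) by simp
      then show ?thesis using e(6) by (auto dest: injD)
    qed
    show thesis
    proof (rule that[of "\<lambda>x. of_real (g x)"])
      show "of_real (g (s c x)) = c * of_real (g x)" for c x
      proof -
        obtain r where "c = of_real r" using re by blast
        then show ?thesis using g(2) by simp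
      qed
      show "norm (of_real (g x) :: 'k) \<le> p x" for x
        using gp[of x] gp[of "-x"] gneg[of x] pneg[of x] by simp
    qed (simp_all add: g gy)
  next
    assume "range e = UNIV"
    then obtain \<iota> where i: "e \<iota> = \<i>" by (metis rangeE UNIV_I)
    have "e (\<iota> * \<iota>) = e (of_real (-1))" unfolding e(2,5) i by simp
    then have ii: "\<iota> * \<iota> = -1" using e(6) by (auto dest: injD)
    define f where "f x = of_real (g x) - \<iota> * of_real (g (s \<iota> x))" for x
    have fadd: "f (x + y) = f x + f y" for x y
      by (simp add: f_def g scale_right_distrib algebra_simps)
    have fr: "f (s (of_real r) x) = of_real r * f x" for r x
    proof -
      have "g (s \<iota> (s (of_real r) x)) = r * g (s \<iota> x)" by (metis g(2) scale_left_commute)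
      then show ?thesis unfolding f_def g(2) by (simp add: algebra_simps)
    qed
    have fi: "f (s \<iota> x) = \<iota> * f x" for x
    proof -
      have "s \<iota> (s \<iota> x) = - x" by (simp add: ii)
      moreover have "\<iota> * (\<iota> * z) = - z" for z using ii by (simp add: mult.assoc[symmetric])
      ultimately show ?thesis by (simp add: f_def gneg right_diff_distrib)
    qed
    have fs: "f (s c x) = c * f x" for c x
    proof -
      have "e c = e (of_real (Re (e c)) + \<iota> * of_real (Im (e c)))"
        unfolding e(1,2,5) i by (rule complex_eq)
      then have c: "c = of_real (Re (e c)) + \<iota> * of_real (Im (e c))"
        by (rule injD[OF e(6)])
      have "f (s (of_real a + \<iota> * of_real b) x) = (of_real a + \<iota> * of_real b) * f x" for a b
      proof -
        have "s (of_real a + \<iota> * of_real b) x = s (of_real a) x + s \<iota> (s (of_real b) x)"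
          by (simp add: scale_left_distrib)
        then show ?thesis by (simp only: fadd fr fi) (simp add: algebra_simps)
      qed
      then show ?thesis using c by metis
    qed
    have Re: "Re (e (f x)) = g x" for x
      unfolding f_def
      using e(1)[of "of_real (g x)" "- (\<iota> * of_real (g (s \<iota> x)))"]
        e(2)[of "-1" "\<iota> * of_real (g (s \<iota> x))"] e(2)[of \<iota> "of_real (g (s \<iota> x))"] e(5)[of "-1"]
      by (simp add: e(5) i)
    have fle: "norm (f x) \<le> p x" for x
    proof (cases "f x = 0")
      case True
      then show ?thesis using gp[of x] gp[of "-x"] gneg[of x] pneg[of x] by simp
    next
      case False
      define u where "u = of_real (norm (f x)) / f x"
      have "f (s u x) = of_real (norm (f x))" using False by (simp add: fs u_def)
      then have "norm (f x) = g (s u x)" using Re[of "s u x"] by (simp add: e(5))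
      also have "\<dots> \<le> p (s u x)" by (rule gp)
      also have "\<dots> = p x" using False by (simp add: sc u_def norm_divide)
      finally show ?thesis .
    qed
    have "cmod (e (f y)) \<le> Re (e (f y))" using fle[of y] by (simp add: e(3) Re gy)
    then have "cmod (e (f y)) = Re (e (f y))" using complex_Re_le_cmod order_antisym by blast
    then have "(Im (e (f y)))\<^sup>2 = 0" using cmod_power2[of "e (f y)"] by simp
    then have "e (f y) = of_real (p y)" using Re[of y] gy by (simp add: complex_eq_iff)
    then have "f y = of_real (p y)" using e(5) e(6) by (metis injD)
    then show thesis using that fadd fs fle by blast
  qed
qed

text \<open>
  Composition with a projection onto a subspace extends seminorms and multilinear forms from the
  subspace to the ambient space.
\<close>

lemma linear_projection_onto:
  assumes "vector_space s" "module.subspace s V"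
  obtains pr where "\<And>x y. pr (x + y) = pr x + pr y" "\<And>c x. pr (s c x) = s c (pr x)"
    "\<And>x. pr x \<in> V" "\<And>x. x \<in> V \<Longrightarrow> pr x = x"
proof -
  interpret vector_space_pair s s using assms(1) by (simp add: vector_space_pair_def)
  have "Vector_Spaces.linear s s (\<lambda>x. x)" using vs1.linear_id by (simp add: id_def)
  from linear_exists_left_inverse_on[OF this assms(2)] obtain pr where
    pr: "range pr \<subseteq> V" "Vector_Spaces.linear s s pr" "\<forall>v\<in>V. pr v = v" by auto
  interpret pr: Vector_Spaces.linear s s pr by (rule pr(2))
  show thesis using that[of pr] pr pr.add pr.scale by auto
qed

lemma norming_functional:
  fixes s :: "'k::real_or_complex \<Rightarrow> 'v::ab_group_add \<Rightarrow> 'v"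
  assumes vs: "vector_space s" and V: "module.subspace s V" and p: "seminorm_on s V p" and y: "y \<in> V"
  obtains f where "\<And>x y. f (x + y) = f x + f y" "\<And>c x. f (s c x) = c * f x"
    "\<And>x. x \<in> V \<Longrightarrow> norm (f x) \<le> p x" "f y = of_real (p y)"
proof -
  obtain pr where pr: "\<And>x y. pr (x + y) = pr x + pr y" "\<And>c x. pr (s c x) = s c (pr x)"
    "\<And>x. pr x \<in> V" "\<And>x. x \<in> V \<Longrightarrow> pr x = x"
    using linear_projection_onto[OF vs V] by blast
  have "seminorm_on s UNIV (\<lambda>x. p (pr x))"
    using p pr by (simp add: seminorm_on_def)
  then obtain f where "\<And>x y. f (x + y) = f x + f y" "\<And>c x. f (s c x) = c * f x"
    "\<And>x. norm (f x) \<le> p (pr x)" "f y = of_real (p (pr y))"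
    using norming_functional_UNIV[OF vs, of "\<lambda>x. p (pr x)" y] by blast
  then show thesis using that[of f] pr y by metis
qed

lemma norming_functional_dual:
  assumes X: "normed_space X" and x: "x \<in> car X"
  obtains \<phi> where "\<phi> \<in> car (dual X)" "op_norm X scalars \<phi> \<le> 1" "\<phi> x = of_real (nrm X x)"
proof -
  have "seminorm_on (smul X) (car X) (nrm X)"
    using nrm_add_le[OF X] nrm_smul[OF X] by (auto simp: seminorm_on_def)
  then obtain f where f: "\<And>x y. f (x + y) = f x + f y" "\<And>c x. f (smul X c x) = c * f x"
    "\<And>x. x \<in> car X \<Longrightarrow> norm (f x) \<le> nrm X x" "f x = of_real (nrm X x)"
    using norming_functional[OF ns_vector_space[OF X] ns_subspace[OF X] _ x, of "nrm X"] by blast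
  show thesis
    using zero_off_dual[OF X, of f 1] f x by (intro that[of "zero_off (car X) f"]) auto
qed

section \<open>Finite dimensional spaces\<close>

lemma bdd_opI:
  assumes "lin_op X Y T" "\<And>x. x \<in> car X \<Longrightarrow> nrm Y (T x) \<le> K * nrm X x"
  shows "bdd_op X Y T"
  using assms by (auto simp: bdd_op_def)

lemma bdd_op_finite_rank:
  assumes X: "normed_space X" and Y: "normed_space Y"
    and c: "\<And>j. j < n \<Longrightarrow> c j \<in> car (dual X)" and e: "\<And>j. j < n \<Longrightarrow> e j \<in> car Y"
  shows "bdd_op X Y (\<lambda>x. \<Sum>j<n. smul Y (c j x) (e j))" (is "bdd_op X Y ?T")
proof (rule bdd_opI[where K = "\<Sum>j<n. op_norm X scalars (c j) * nrm Y (e j)"])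
  interpret vector_space "smul Y" by (rule ns_vector_space[OF Y])
  show "lin_op X Y ?T"
    unfolding lin_op_def
  proof (intro conjI ballI allI)
    show "?T ` car X \<subseteq> car Y" using e by (auto intro!: ns_sum[OF Y] ns_smul[OF Y])
    show "?T (x + y) = ?T x + ?T y" if "x \<in> car X" "y \<in> car X" for x y
      unfolding sum.distrib[symmetric]
      by (rule sum.cong) (use that in \<open>auto simp: dual_add[OF c] scale_left_distrib\<close>)
    show "?T (smul X a x) = smul Y a (?T x)" if "x \<in> car X" for a x
      unfolding scale_sum_right by (rule sum.cong) (use that in \<open>auto simp: dual_smul[OF c]\<close>)
  qed
  fix x assume x: "x \<in> car X"
  have "nrm Y (?T x) \<le> (\<Sum>j<n. nrm Y (smul Y (c j x) (e j)))"
    using e by (intro nrm_sum_le[OF Y] ns_smul[OF Y]) auto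
  also have "\<dots> \<le> (\<Sum>j<n. op_norm X scalars (c j) * nrm Y (e j) * nrm X x)"
  proof (rule sum_mono)
    fix j assume "j \<in> {..<n}"
    then show "nrm Y (smul Y (c j x) (e j)) \<le> op_norm X scalars (c j) * nrm Y (e j) * nrm X x"
      using mult_right_mono[OF dual_bound[OF X c x] nrm_nonneg[OF Y e], of j j]
      by (simp add: nrm_smul[OF Y e] mult_ac)
  qed
  finally show "nrm Y (?T x) \<le> (\<Sum>j<n. op_norm X scalars (c j) * nrm Y (e j)) * nrm X x"
    by (simp add: sum_distrib_right)
qed

lemma bdd_op_diff_proj:
  assumes X: "normed_space X" and P: "bdd_op X X P"
  shows "bdd_op X X (\<lambda>x. x - P x)"
proof -
  obtain K where K: "\<And>x. x \<in> car X \<Longrightarrow> nrm X (P x) \<le> K * nrm X x"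
    using P by (auto simp: bdd_op_def)
  have l: "lin_op X X P" using P by (simp add: bdd_op_def)
  interpret vector_space "smul X" by (rule ns_vector_space[OF X])
  show ?thesis
  proof (rule bdd_opI[where K = "1 + K"])
    show "lin_op X X (\<lambda>x. x - P x)"
      using l ns_diff[OF X] by (auto simp: lin_op_def scale_right_diff_distrib)
    show "nrm X (x - P x) \<le> (1 + K) * nrm X x" if "x \<in> car X" for x
      using nrm_diff_le[OF X that lin_op_in[OF l that]] K[OF that] by (simp add: algebra_simps)
  qed
qed

lemma bdd_op_compose:
  assumes X: "normed_space X" and Y: "normed_space Y" and Z: "normed_space Z"
    and S: "bdd_op X Y S" and T: "bdd_op Y Z T"
  shows "bdd_op X Z (\<lambda>x. T (S x))"
proof -
  have l: "lin_op X Y S" "lin_op Y Z T" using S T by (auto simp: bdd_op_def)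
  show ?thesis
  proof (rule bdd_opI[where K = "op_norm Y Z T * op_norm X Y S"])
    show "lin_op X Z (\<lambda>x. T (S x))" using l by (auto simp: lin_op_def image_subset_iff)
    show "nrm Z (T (S x)) \<le> op_norm Y Z T * op_norm X Y S * nrm X x" if "x \<in> car X" for x
    proof -
      have "nrm Z (T (S x)) \<le> op_norm Y Z T * nrm Y (S x)"
        by (rule op_norm_bound[OF Y Z T lin_op_in[OF l(1) that]])
      also have "\<dots> \<le> op_norm Y Z T * (op_norm X Y S * nrm X x)"
        by (intro mult_left_mono op_norm_bound[OF X Y S that] op_norm_nonneg[OF Y Z T])
      finally show ?thesis by (simp add: mult.assoc)
    qed
  qed
qed

lemma zero_off_bdd_op:
  assumes X: "normed_space X" and f: "bdd_op X scalars f"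
  shows "zero_off (car X) f \<in> car (dual X)"
proof -
  obtain K where "0 \<le> K" "\<And>x. x \<in> car X \<Longrightarrow> nrm scalars (f x) \<le> K * nrm X x"
    using bdd_op_nonneg_bound[OF X f] by blast
  then show ?thesis
    using f by (intro zero_off_dual(1)[OF X]) (auto simp: bdd_op_def lin_op_def)
qed

text \<open>
  Bounded coordinates, by induction on a spanning set. If \<open>P\<close> is the projection that the coordinates
  found so far define and \<open>b' = b - P b \<noteq> 0\<close> for the next vector \<open>b\<close>, then \<open>b'\<close> is added with the coordinate
  \<open>x \<mapsto> \<psi> (x - P x)\<close>, where \<open>\<psi>\<close> is a multiple of a norming functional of \<open>b'\<close>.
\<close>

lemma dual_frame_exists:
  assumes X: "normed_space X" and V: "fin_dim_subspace X V"
  shows "\<exists>(n::nat) e c. (\<forall>j<n. e j \<in> V \<and> c j \<in> car (dual X)) \<and> (\<forall>x\<in>V. x = (\<Sum>j<n. smul X (c j x) (e j)))"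
proof -
  interpret vector_space "smul X" by (rule ns_vector_space[OF X])
  obtain B where B: "finite B" "V = span B" "V \<subseteq> car X" using V by (auto simp: fin_dim_subspace_def)
  have "\<exists>(n::nat) e c. (\<forall>j<n. e j \<in> span B \<and> c j \<in> car (dual X)) \<and>
      (\<forall>x\<in>span B. x = (\<Sum>j<n. smul X (c j x) (e j)))" if "finite B" "B \<subseteq> car X" for B
    using that
  proof (induction B rule: finite_induct)
    case empty
    show ?case by (intro exI[of _ 0]) auto
  next
    case (insert b B)
    have "B \<subseteq> car X" using insert.prems by simp
    from insert.IH[OF this] obtain n :: nat and e c where ec': "\<forall>j<n. e j \<in> span B \<and> c j \<in> car (dual X)"
      "\<forall>x\<in>span B. x = (\<Sum>j<n. smul X (c j x) (e j))" by (elim exE conjE)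
    then have e: "\<And>j. j < n \<Longrightarrow> e j \<in> span B" and c: "\<And>j. j < n \<Longrightarrow> c j \<in> car (dual X)"
      and ec: "\<And>x. x \<in> span B \<Longrightarrow> x = (\<Sum>j<n. smul X (c j x) (e j))" by blast+
    have spB: "span B \<subseteq> car X" using insert.prems ns_subspace[OF X] span_minimal by auto
    define P where "P = (\<lambda>x. \<Sum>j<n. smul X (c j x) (e j))"
    have P: "bdd_op X X P"
      unfolding P_def using e c spB by (intro bdd_op_finite_rank[OF X X]) auto
    then have lP: "lin_op X X P" by (simp add: bdd_op_def)
    have Pin: "P x \<in> span B" for x
      unfolding P_def using e by (auto intro!: span_sum span_scale)
    have Pid: "P x = x" if "x \<in> span B" for x using ec[OF that] by (simp add: P_def)
    have b: "b \<in> car X" using insert by simp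
    define b' where "b' = b - P b"
    have b': "b' \<in> car X" using b Pin spB by (auto simp: b'_def intro!: ns_diff[OF X])
    show ?case
    proof (cases "b' = 0")
      case True
      then have "b \<in> span B" using Pin[of b] by (simp add: b'_def)
      then have "span (insert b B) = span B" by (rule span_redundant)
      then show ?thesis using ec' by auto
    next
      case False
      obtain \<phi> where \<phi>: "\<phi> \<in> car (dual X)" "\<phi> b' = of_real (nrm X b')"
        using norming_functional_dual[OF X b'] by metis
      have nb: "of_real (nrm X b') \<noteq> (0::'a)" using nrm_eq_0[OF X b'] False by simp
      define \<psi> where "\<psi> = fscale (inverse (of_real (nrm X b'))) \<phi>"
      have \<psi>: "\<psi> \<in> car (dual X)" "\<psi> b' = 1"
        using ns_smul[OF normed_space_dual[OF X] \<phi>(1)] \<phi>(2) nb by (auto simp: \<psi>_def)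
      define c' where "c' = zero_off (car X) (\<lambda>x. \<psi> (x - P x))"
      have c': "c' \<in> car (dual X)"
        unfolding c'_def
        by (rule zero_off_bdd_op[OF X bdd_op_compose[OF X X normed_space_scalars
              bdd_op_diff_proj[OF X P] dual_bdd_op[OF \<psi>(1)]]])
      let ?e = "e(n := b')" and ?c = "c(n := c')"
      have "x = (\<Sum>j<Suc n. smul X (?c j x) (?e j))" if x: "x \<in> span (insert b B)" for x
      proof -
        obtain t where t: "x - smul X t b \<in> span B" using x by (auto simp: span_breakdown_eq)
        have xc: "x \<in> car X" using t spB ns_add[OF X, of "x - smul X t b" "smul X t b"]
            ns_smul[OF X b] by auto
        have "P (x - smul X t b) = P x - smul X t (P b)"
          using lin_op_diff[OF X lP xc ns_smul[OF X b]] lin_op_smul[OF lP b] by simp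
        then have xP: "x - P x = smul X t b'"
          using Pid[OF t] by (simp add: b'_def scale_right_diff_distrib algebra_simps)
        then have "c' x = t" using xc dual_smul[OF \<psi>(1) b'] \<psi>(2) by (simp add: c'_def)
        moreover have "(\<Sum>j<n. smul X (?c j x) (?e j)) = P x" by (simp add: P_def)
        ultimately show ?thesis using xP by (simp add: algebra_simps)
      qed
      moreover have "?e j \<in> span (insert b B)" if "j < Suc n" for j
      proof (cases "j = n")
        case True
        have "b' \<in> span (insert b B)"
          unfolding b'_def using Pin span_mono[of B "insert b B"]
          by (intro span_diff) (auto intro: span_base)
        then show ?thesis using True by simp
      next
        case False
        then show ?thesis using that e[of j] span_mono[of B "insert b B"] by auto
      qed
      moreover have "?c j \<in> car (dual X)" if "j < Suc n" for j
        using c' c[of j] that by auto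
      ultimately show ?thesis
        by (intro exI[of _ "Suc n"] exI[of _ ?e] exI[of _ ?c]) blast
    qed
  qed
  from this[OF B(1)] B span_superset show ?thesis by blast
qed

text \<open>
  The vectors \<open>e j\<close> may be dependent. Exchanging vectors and coordinates then gives a frame of the dual space.
\<close>

definition finite_frame :: "('k::real_or_complex, 'v::ab_group_add) nspace \<Rightarrow> nat \<Rightarrow>
    (nat \<Rightarrow> 'v) \<Rightarrow> (nat \<Rightarrow> 'v \<Rightarrow> 'k) \<Rightarrow> bool" where
  "finite_frame M n e c \<longleftrightarrow> (\<forall>j<n. e j \<in> car M \<and> c j \<in> car (dual M)) \<and>
     (\<forall>x\<in>car M. x = (\<Sum>j<n. smul M (c j x) (e j)))"

lemma zero_off_restr_dual:
  assumes "normed_space X" "normed_space (restr X V)" "V \<subseteq> car X" "\<phi> \<in> car (dual X)"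
  shows "zero_off V \<phi> \<in> car (dual (restr X V))"
    "op_norm (restr X V) scalars (zero_off V \<phi>) \<le> op_norm X scalars \<phi>"
proof -
  have "bdd_op X scalars \<phi>" using assms dual_bdd_op by blast
  from zero_off_dual[OF assms(2), of \<phi> "op_norm X scalars \<phi>"]
  show "zero_off V \<phi> \<in> car (dual (restr X V))"
    "op_norm (restr X V) scalars (zero_off V \<phi>) \<le> op_norm X scalars \<phi>"
    using assms dual_add[OF assms(4)] dual_smul[OF assms(4)] dual_bound[OF assms(1,4)]
      op_norm_nonneg[OF assms(1) normed_space_scalars \<open>bdd_op X scalars \<phi>\<close>]
    by (auto simp: subset_eq)
qed

lemma finite_frame_exists:
  assumes X: "normed_space X" and V: "fin_dim_subspace X V"
  shows "\<exists>n e c. finite_frame (restr X V) n e c"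
proof -
  obtain n :: nat and e c where *: "\<forall>j<n. e j \<in> V \<and> c j \<in> car (dual X)"
    "\<forall>x\<in>V. x = (\<Sum>j<n. smul X (c j x) (e j))"
    using dual_frame_exists[OF X V] by blast
  have "finite_frame (restr X V) n e (\<lambda>j. zero_off V (c j))"
    using * zero_off_restr_dual(1)[OF X fin_dim_subspaceD(1,2)[OF X V]]
    by (auto simp: finite_frame_def)
  then show ?thesis by blast
qed

lemma finite_frame_dual:
  assumes M: "normed_space M" and f: "finite_frame M n e c"
  shows "finite_frame (dual M) n c (\<lambda>j. canon M (e j))"
  unfolding finite_frame_def
proof (intro conjI allI impI ballI)
  show "c j \<in> car (dual M)" if "j < n" for j using f that by (simp add: finite_frame_def)
  show "canon M (e j) \<in> car (bidual M)" if "j < n" for j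
    using f that canon_bidual[OF M] by (simp add: finite_frame_def)
  fix \<phi> assume \<phi>: "\<phi> \<in> car (dual M)"
  show "\<phi> = (\<Sum>j<n. smul (dual M) (canon M (e j) \<phi>) (c j))" (is "_ = ?r")
  proof (rule dual_eqI[OF \<phi>])
    show "?r \<in> car (dual M)"
      using f by (intro ns_sum[OF normed_space_dual[OF M]] ns_smul[OF normed_space_dual[OF M]])
        (auto simp: finite_frame_def)
    fix x assume x: "x \<in> car M"
    have "\<phi> x = \<phi> (\<Sum>j<n. smul M (c j x) (e j))" using f x by (auto simp: finite_frame_def)
    also have "\<dots> = (\<Sum>j<n. c j x * \<phi> (e j))"
      using lin_op_lincomb[OF M dual_lin_op[OF \<phi>], of "{..<n}" e "\<lambda>j. c j x"] f
      by (simp add: finite_frame_def)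
    finally show "\<phi> x = ?r x" using \<phi> by (simp add: sum_fun_apply mult.commute)
  qed
qed

lemma scalar_net:
  assumes "\<eta> > 0"
  shows "\<exists>G :: 'k::real_or_complex set. finite G \<and> (\<forall>c. norm c \<le> C \<longrightarrow> (\<exists>g\<in>G. norm (c - g) \<le> \<eta>))"
proof -
  obtain e :: "'k \<Rightarrow> complex" where e: "\<forall>x y. e (x + y) = e x + e y" "\<forall>x. cmod (e x) = norm x"
    using real_or_complex_embedding[where ?'a = 'k] by (elim exE conjE)
  note e = e[rule_format]
  have minus: "e (x - y) = e x - e y" for x y
    using e(1)[of "x - y" y] by simp
  have "compact (cball (0::complex) C)" by simp
  then have "\<forall>r>0. \<exists>K. finite K \<and> cball 0 C \<subseteq> (\<Union>x::complex\<in>K. ball x r)"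
    unfolding compact_eq_totally_bounded by (rule conjunct2)
  then obtain K where K: "finite K" "cball 0 C \<subseteq> (\<Union>x::complex\<in>K. ball x (\<eta>/2))"
    using assms by (meson half_gt_zero)
  define g where "g z = (SOME c. dist z (e c) < \<eta>/2)" for z
  have "\<exists>z\<in>K. norm (c - g z) \<le> \<eta>" if "norm c \<le> C" for c
  proof -
    have "e c \<in> cball 0 C" using that e(2) by simp
    then obtain z where z: "z \<in> K" "dist z (e c) < \<eta>/2" using K by auto
    then have "dist z (e (g z)) < \<eta>/2" unfolding g_def by (metis (mono_tags, lifting) someI)
    then have "dist (e c) (e (g z)) < \<eta>" using z(2) by (metis dist_triangle_half_r)
    then show ?thesis using z(1) e(2)[of "c - g z"] by (auto simp: dist_norm minus intro!: bexI[of _ z])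
  qed
  then show ?thesis using K(1) by (intro exI[of _ "g ` K"]) auto
qed

text \<open>
  The coordinates of the vectors in the unit ball lie in a common disc of scalars; they are rounded to
  a finite net of that disc.
\<close>

lemma finite_net_unit_ball:
  assumes M: "normed_space M" and f: "finite_frame M n e c" and \<eta>: "\<eta> > 0"
  obtains N where "finite N" "N \<subseteq> car M" "\<And>x. x \<in> car M \<Longrightarrow> nrm M x \<le> 1 \<Longrightarrow> \<exists>y\<in>N. nrm M (x - y) \<le> \<eta>"
proof -
  interpret vector_space "smul M" by (rule ns_vector_space[OF M])
  have e: "\<And>j. j < n \<Longrightarrow> e j \<in> car M" and c: "\<And>j. j < n \<Longrightarrow> c j \<in> car (dual M)"
    and ec: "\<And>x. x \<in> car M \<Longrightarrow> x = (\<Sum>j<n. smul M (c j x) (e j))"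
    using f by (auto simp: finite_frame_def)
  define C where "C = (\<Sum>j<n. op_norm M scalars (c j))"
  have C: "norm (c j x) \<le> C" if "j < n" "x \<in> car M" "nrm M x \<le> 1" for j x
  proof -
    note nn = op_norm_nonneg[OF M normed_space_scalars dual_bdd_op]
    have "norm (c j x) \<le> op_norm M scalars (c j) * nrm M x" using dual_bound[OF M c] that by blast
    also have "\<dots> \<le> op_norm M scalars (c j)" using nn[OF c] that by (simp add: mult_left_le)
    also have "\<dots> \<le> C" unfolding C_def
      using nn[OF c] that(1) by (intro member_le_sum) auto
    finally show ?thesis .
  qed
  define E where "E = 1 + (\<Sum>j<n. nrm M (e j))"
  have E: "E > 0" using e nrm_nonneg[OF M] by (auto simp: E_def intro!: add_pos_nonneg sum_nonneg)
  obtain G :: "'a set" where G: "finite G" "\<And>t. norm t \<le> C \<Longrightarrow> \<exists>g\<in>G. norm (t - g) \<le> \<eta> / E"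
    using scalar_net[of "\<eta>/E" C] \<eta> E by auto
  define N where "N = (\<lambda>g. \<Sum>j<n. smul M (g j) (e j)) ` ({..<n} \<rightarrow>\<^sub>E G)"
  show thesis
  proof
    show "finite N" using G(1) by (auto simp: N_def intro!: finite_PiE)
    show "N \<subseteq> car M" using e by (auto simp: N_def intro!: ns_sum[OF M] ns_smul[OF M])
    fix x assume x: "x \<in> car M" "nrm M x \<le> 1"
    define g where "g = (\<lambda>j. if j < n then SOME g. g \<in> G \<and> norm (c j x - g) \<le> \<eta> / E else undefined)"
    have g: "g j \<in> G \<and> norm (c j x - g j) \<le> \<eta> / E" if "j < n" for j
      using someI_ex[of "\<lambda>g. g \<in> G \<and> norm (c j x - g) \<le> \<eta> / E"] G(2)[OF C[OF that x]] that
      by (auto simp: g_def)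
    let ?y = "\<Sum>j<n. smul M (g j) (e j)"
    have "x - ?y = (\<Sum>j<n. smul M (c j x - g j) (e j))"
      by (subst ec[OF x(1)]) (simp add: sum_subtractf scale_left_diff_distrib)
    then have "nrm M (x - ?y) \<le> (\<Sum>j<n. nrm M (smul M (c j x - g j) (e j)))"
      using e by (auto intro!: nrm_sum_le[OF M] ns_smul[OF M])
    also have "\<dots> \<le> (\<Sum>j<n. \<eta> / E * nrm M (e j))"
      using e g by (intro sum_mono) (simp add: nrm_smul[OF M] del: times_divide_eq_left,
        intro mult_right_mono nrm_nonneg[OF M], auto)
    also have "\<dots> = \<eta> / E * (E - 1)" unfolding sum_distrib_left[symmetric] by (simp add: E_def)
    also have "\<dots> = \<eta> * ((E - 1) / E)" by simp
    also have "\<dots> \<le> \<eta> * 1" using E \<eta> by (intro mult_left_mono) auto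
    finally have "nrm M (x - ?y) \<le> \<eta>" by simp
    moreover have "?y \<in> N" unfolding N_def
    proof (rule imageI)
      show "g \<in> {..<n} \<rightarrow>\<^sub>E G"
        by (rule PiE_I) (use g in \<open>auto simp: g_def\<close>)
    qed
    ultimately show "\<exists>y\<in>N. nrm M (x - y) \<le> \<eta>" by blast
  qed
qed

section \<open>Local reflexivity\<close>

lemma additive_sum:
  fixes f :: "'a::ab_group_add \<Rightarrow> 'b::ab_group_add"
  assumes "\<And>x y. f (x + y) = f x + f y"
  shows "f (sum g I) = (\<Sum>i\<in>I. f (g i))"
proof -
  have "f 0 = 0" using assms[of 0 0] by simp
  then show ?thesis by (induction I rule: infinite_finite_induct) (auto simp: assms)
qed

lemma seminorm_onI:
  assumes vs: "vector_space s" and V: "module.subspace s V"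
    and add: "\<And>x y. x \<in> V \<Longrightarrow> y \<in> V \<Longrightarrow> p (x + y) \<le> p x + p y"
    and sc: "\<And>c x. x \<in> V \<Longrightarrow> p (s c x) \<le> norm c * p x"
  shows "seminorm_on s V p"
proof -
  interpret vector_space s by (rule vs)
  have 0: "0 \<in> V" by (rule subspace_0[OF V])
  have p0: "p 0 = 0" using add[OF 0 0] sc[OF 0, of 0] by simp
  have "p (s c x) = norm c * p x" if x: "x \<in> V" for c x
  proof (cases "c = 0")
    case False
    have "p (s (1/c) (s c x)) \<le> norm (1/c) * p (s c x)"
      by (intro sc subspace_scale[OF V] x)
    then have "norm c * p x \<le> p (s c x)" using False by (simp add: norm_divide field_simps)
    then show ?thesis using sc[OF x, of c] by simp
  qed (simp add: p0)
  then show ?thesis using add by (auto simp: seminorm_on_def)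
qed

lemma
  assumes "vector_space s" "module.subspace s V" "seminorm_on s V p"
  shows seminorm_on_zero: "p 0 = 0"
    and seminorm_on_nonneg: "x \<in> V \<Longrightarrow> 0 \<le> p x"
proof -
  interpret vector_space s by fact
  have add: "\<And>x y. x \<in> V \<Longrightarrow> y \<in> V \<Longrightarrow> p (x + y) \<le> p x + p y"
    and sc: "\<And>c x. x \<in> V \<Longrightarrow> p (s c x) = norm c * p x"
    using assms(3) by (auto simp: seminorm_on_def)
  have "0 \<in> V" by (rule subspace_0[OF assms(2)])
  from sc[OF this, of 0] show p0: "p 0 = 0" by simp
  show "0 \<le> p x" if x: "x \<in> V"
    using add[OF x subspace_neg[OF assms(2) x]] sc[OF x, of "-1"] p0 by simp
qed

text \<open>
  Rotating almost norming arguments \<open>y l\<close> so that all \<open>\<psi> l (y l)\<close> are nonnegative shows that the norms of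
  the \<open>\<psi> l\<close> with respect to \<open>p l\<close> add up to at most one: the dual of a maximum is a sum.
\<close>

lemma dominated_by_max_of_seminorms:
  fixes Y :: "('k::real_or_complex, 'y::ab_group_add) nspace" and \<psi> :: "'l \<Rightarrow> 'y \<Rightarrow> 'k"
  assumes Y: "normed_space Y" and L: "finite L"
    and p: "\<And>l. l \<in> L \<Longrightarrow> seminorm_on (smul Y) (car Y) (p l)"
and lin: "\<And>l. l \<in> L \<Longrightarrow> lin_op Y scalars (\<psi> l)"
    and dom: "\<And>y. (\<And>l. l \<in> L \<Longrightarrow> y l \<in> car Y \<and> p l (y l) \<le> 1) \<Longrightarrow> norm (\<Sum>l\<in>L. \<psi> l (y l)) \<le> 1"
  shows "\<exists>\<theta>. (\<forall>l\<in>L. 0 \<le> \<theta> l) \<and> sum \<theta> L \<le> 1 \<and>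
    (\<forall>l\<in>L. \<forall>y\<in>car Y. norm (\<psi> l y) \<le> \<theta> l * p l y)"
proof -
  have p0: "p l 0 = 0" and pge: "y \<in> car Y \<Longrightarrow> 0 \<le> p l y" if "l \<in> L" for l y
    using seminorm_on_zero seminorm_on_nonneg ns_vector_space[OF Y] ns_subspace[OF Y] p[OF that]
    by blast+
  have psc: "p l (smul Y a y) = norm a * p l y" if "l \<in> L" "y \<in> car Y" for l a y
    using p[OF that(1)] that(2) by (auto simp: seminorm_on_def)
  have psi0: "\<psi> l 0 = 0" if "l \<in> L" for l by (rule lin_op_zero[OF Y lin[OF that]])
  have dom1: "norm (\<psi> l y) \<le> 1" if l: "l \<in> L" and y: "y \<in> car Y" "p l y \<le> 1" for l y
  proof -
    have "norm (\<Sum>m\<in>L. \<psi> m (if m = l then y else 0)) \<le> 1"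
      using y ns_zero[OF Y] p0 by (intro dom) auto
    also have "(\<Sum>m\<in>L. \<psi> m (if m = l then y else 0)) = (\<Sum>m\<in>L. if m = l then \<psi> l y else 0)"
      by (rule sum.cong) (auto simp: psi0)
    finally show ?thesis using l L by simp
  qed
  define R where "R l = {norm (\<psi> l y) | y. y \<in> car Y \<and> p l y \<le> 1}" for l
  define \<theta> where "\<theta> l = Sup (R l)" for l
  have bdd: "bdd_above (R l)" if "l \<in> L" for l
    using dom1[OF that] by (intro bdd_aboveI[of _ 1]) (auto simp: R_def)
  have up: "norm (\<psi> l y) \<le> \<theta> l" if "l \<in> L" "y \<in> car Y" "p l y \<le> 1" for l y
    unfolding \<theta>_def by (rule cSup_upper[OF _ bdd[OF that(1)]]) (use that in \<open>auto simp: R_def\<close>)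
  show ?thesis
  proof (intro exI[of _ \<theta>] conjI ballI)
    show "0 \<le> \<theta> l" if "l \<in> L" for l
      using up[OF that ns_zero[OF Y]] p0[OF that] psi0[OF that] by simp
    show "norm (\<psi> l y) \<le> \<theta> l * p l y" if l: "l \<in> L" and y: "y \<in> car Y" for l y
    proof (cases "p l y = 0")
      case True
      have "norm (of_nat m * \<psi> l y) \<le> 1" for m
        using dom1[OF l ns_smul[OF Y y], of "of_nat m"] psc[OF l y] True lin_op_smul[OF lin[OF l] y]
        by simp
      then have m: "real m * norm (\<psi> l y) \<le> 1" for m by (simp add: norm_mult)
      have "norm (\<psi> l y) = 0"
      proof (rule ccontr)
        assume "norm (\<psi> l y) \<noteq> 0"
        then obtain m where "1 < real m * norm (\<psi> l y)"
          using reals_Archimedean3[of "norm (\<psi> l y)"] by auto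
        then show False using m[of m] by simp
      qed
      then show ?thesis using True by simp
    next
      case False
      define r where "r = p l y"
      have r: "r > 0" using pge[OF l y] False by (simp add: r_def)
      have "norm (\<psi> l (smul Y (of_real (1 / r)) y)) \<le> \<theta> l"
        using r by (intro up[OF l ns_smul[OF Y y]]) (simp add: psc[OF l y] norm_divide r_def[symmetric])
      then show ?thesis using r
        by (simp add: lin_op_smul[OF lin[OF l] y] norm_mult norm_divide r_def[symmetric] divide_le_eq)
    qed
    show "sum \<theta> L \<le> 1"
    proof (rule field_le_epsilon)
      fix e :: real assume e: "e > 0"
      define d where "d = e / (1 + card L)"
      have d: "d > 0" using e by (simp add: d_def)
      have "\<exists>y. y \<in> car Y \<and> p l y \<le> 1 \<and> \<theta> l - d \<le> norm (\<psi> l y)" if l: "l \<in> L" for l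
      proof -
        have ne: "R l \<noteq> {}" using ns_zero[OF Y] p0[OF l] by (force simp: R_def)
        have "\<theta> l - d < Sup (R l)" using d by (simp add: \<theta>_def)
        then show ?thesis using less_cSup_iff[OF ne bdd[OF l]] by (force simp: R_def)
      qed
      then obtain y where y: "\<And>l. l \<in> L \<Longrightarrow> y l \<in> car Y" "\<And>l. l \<in> L \<Longrightarrow> p l (y l) \<le> 1"
        "\<And>l. l \<in> L \<Longrightarrow> \<theta> l - d \<le> norm (\<psi> l (y l))" by metis
      define u where "u l = (if \<psi> l (y l) = 0 then 1 else of_real (norm (\<psi> l (y l))) / \<psi> l (y l))" for l
      have u: "norm (u l) = 1" "u l * \<psi> l (y l) = of_real (norm (\<psi> l (y l)))" for l
        by (auto simp: u_def norm_divide)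
      have "norm (\<Sum>l\<in>L. \<psi> l (smul Y (u l) (y l))) \<le> 1"
        using y u by (intro dom) (auto simp: ns_smul[OF Y] psc)
      also have "(\<Sum>l\<in>L. \<psi> l (smul Y (u l) (y l))) = (\<Sum>l\<in>L. of_real (norm (\<psi> l (y l))))"
        using y(1) u(2) by (intro sum.cong) (auto simp: lin_op_smul[OF lin])
      finally have 1: "(\<Sum>l\<in>L. norm (\<psi> l (y l))) \<le> 1"
        unfolding of_real_sum[symmetric] norm_of_real by simp
      have "sum \<theta> L \<le> (\<Sum>l\<in>L. norm (\<psi> l (y l)) + d)"
        using y(3) by (intro sum_mono) (simp add: algebra_simps)
      also have "\<dots> \<le> 1 + card L * d" using 1 by (simp add: sum.distrib)
      also have "\<dots> \<le> 1 + e" using e by (simp add: d_def field_simps)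
      finally show "sum \<theta> L \<le> 1 + e" .
    qed
  qed
qed

text \<open>
  Suppose that the system has no solution. Then in the space of families \<open>(v l)\<close>, with the maximum of the
  \<open>p l (v l)\<close> as seminorm, the family \<open>u\<close> has distance at least one from the range of the linear part \<open>\<Phi>\<close>.
  A functional that norms \<open>u\<close> for the quotient seminorm \<open>d\<close> vanishes on the range of \<open>\<Phi>\<close>, that is, its
  components \<open>\<psi> l\<close> satisfy \<open>(\<Sum>l. a l j \<psi> l) = 0\<close> for each \<open>j\<close>. Hence also \<open>(\<Sum>l. a l j * \<zeta> j (\<psi> l)) = 0\<close>, and the
  value \<open>(\<Sum>l. \<psi> l (u l)) \<ge> 1\<close> at \<open>u\<close> is the sum of the quantities that the hypothesis bounds. Since the \<open>\<psi> l\<close> are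
  dominated by \<open>\<theta> l * p l\<close> with \<open>\<theta> l\<close> of sum at most one, that sum is at most \<open>\<rho> < 1\<close>.
\<close>

lemma helly:
  fixes Y :: "('k::real_or_complex, 'y::ab_group_add) nspace" and a :: "'l \<Rightarrow> nat \<Rightarrow> 'k"
  assumes Y: "normed_space Y" and L: "finite L"
    and u: "\<And>l. l \<in> L \<Longrightarrow> u l \<in> car Y"
    and p: "\<And>l. l \<in> L \<Longrightarrow> seminorm_on (smul Y) (car Y) (p l)"
    and pK: "\<And>l. l \<in> L \<Longrightarrow> \<exists>K. \<forall>y\<in>car Y. p l y \<le> K * nrm Y y"
    and \<zeta>: "\<And>j. j < n \<Longrightarrow> \<zeta> j \<in> car (bidual Y)"
    and \<rho>: "\<rho> < 1"
    and hyp: "\<And>l \<psi>. l \<in> L \<Longrightarrow> \<psi> \<in> car (dual Y) \<Longrightarrow> (\<And>y. y \<in> car Y \<Longrightarrow> norm (\<psi> y) \<le> p l y) \<Longrightarrow>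
      norm (\<psi> (u l) + (\<Sum>j<n. a l j * \<zeta> j \<psi>)) \<le> \<rho>"
  shows "\<exists>x. (\<forall>j<n. x j \<in> car Y) \<and> (\<forall>l\<in>L. p l (u l + (\<Sum>j<n. smul Y (a l j) (x j))) < 1)"
proof (cases "L = {}")
  case True
  then show ?thesis using ns_zero[OF Y] by (intro exI[of _ "\<lambda>j. 0"]) auto
next
  case ne: False
  interpret vector_space "smul Y" by (rule ns_vector_space[OF Y])
  define S :: "'k \<Rightarrow> ('l \<Rightarrow> 'y) \<Rightarrow> 'l \<Rightarrow> 'y" where "S c v = (\<lambda>l. smul Y c (v l))" for c v
  have vsS: "vector_space S"
    by unfold_locales (auto simp: S_def fun_eq_iff scale_right_distrib scale_left_distrib)
  interpret S: vector_space S by (rule vsS)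
  define V :: "('l \<Rightarrow> 'y) set" where "V = {v. \<forall>l. v l \<in> car Y}"
  have subV: "S.subspace V"
    by (auto simp: S.subspace_def V_def S_def ns_zero[OF Y] ns_add[OF Y] ns_smul[OF Y])
  have p0: "p l 0 = 0" and pge: "y \<in> car Y \<Longrightarrow> 0 \<le> p l y" if "l \<in> L" for l y
    using seminorm_on_zero seminorm_on_nonneg ns_vector_space[OF Y] ns_subspace[OF Y] p[OF that]
    by blast+
  have padd: "p l (x + y) \<le> p l x + p l y" if "l \<in> L" "x \<in> car Y" "y \<in> car Y" for l x y
    using p[OF that(1)] that(2,3) by (auto simp: seminorm_on_def)
  have psc: "p l (smul Y a y) = norm a * p l y" if "l \<in> L" "y \<in> car Y" for l a y
    using p[OF that(1)] that(2) by (auto simp: seminorm_on_def)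
  define N where "N v = Max ((\<lambda>l. p l (v l)) ` L)" for v :: "'l \<Rightarrow> 'y"
  have Nup: "p l (v l) \<le> N v" if "l \<in> L" for l v
    unfolding N_def using L that by (intro Max_ge) auto
  have Nle: "N v \<le> c" if "\<And>l. l \<in> L \<Longrightarrow> p l (v l) \<le> c" for v c
    unfolding N_def using L ne that by (subst Max_le_iff) auto
  have N0: "0 \<le> N v" if "v \<in> V" for v
  proof -
    obtain l where l: "l \<in> L" using ne by blast
    have "0 \<le> p l (v l)" using pge[OF l] that by (auto simp: V_def)
    then show ?thesis using Nup[OF l, of v] by simp
  qed
  have Nadd: "N (v + w) \<le> N v + N w" if "v \<in> V" "w \<in> V" for v w
  proof (rule Nle)
    fix l assume l: "l \<in> L"
    have "p l (v l + w l) \<le> p l (v l) + p l (w l)" using that l by (intro padd) (auto simp: V_def)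
    then show "p l ((v + w) l) \<le> N v + N w" using Nup[OF l, of v] Nup[OF l, of w] by simp
  qed
  have Nsc: "N (S c v) \<le> norm c * N v" if "v \<in> V" for c v
    using that Nup by (intro Nle) (auto simp: S_def psc V_def intro!: mult_left_mono)
  define \<Phi> where "\<Phi> x = (\<lambda>l. \<Sum>j<n. smul Y (a l j) (x j))" for x :: "nat \<Rightarrow> 'y"
  define X0 :: "(nat \<Rightarrow> 'y) set" where "X0 = {x. \<forall>j. x j \<in> car Y}"
  have \<Phi>V: "\<Phi> x \<in> V" if "x \<in> X0" for x
    using that by (auto simp: \<Phi>_def V_def X0_def intro!: ns_sum[OF Y] ns_smul[OF Y])
  have \<Phi>add: "\<Phi> (x + y) = \<Phi> x + \<Phi> y" for x y
    by (auto simp: \<Phi>_def scale_right_distrib sum.distrib fun_eq_iff)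
  have \<Phi>sc: "\<Phi> (\<lambda>j. smul Y c (x j)) = S c (\<Phi> x)" for c x
    by (auto simp: \<Phi>_def S_def scale_sum_right mult.commute)
  have X0: "(0::nat \<Rightarrow> 'y) \<in> X0" "x \<in> X0 \<Longrightarrow> y \<in> X0 \<Longrightarrow> x + y \<in> X0"
    "x \<in> X0 \<Longrightarrow> (\<lambda>j. smul Y c (x j)) \<in> X0" for x y c
    by (auto simp: X0_def ns_zero[OF Y] ns_add[OF Y] ns_smul[OF Y])
  define d where "d v = (INF x\<in>X0. N (v + \<Phi> x))" for v
  have V\<Phi>: "v + \<Phi> x \<in> V" if "v \<in> V" "x \<in> X0" for v x
    using that \<Phi>V S.subspace_add[OF subV] by blast
  have bdd: "bdd_below ((\<lambda>x. N (v + \<Phi> x)) ` X0)" if "v \<in> V" for v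
    using N0[OF V\<Phi>[OF that]] by (intro bdd_belowI2[of _ 0]) auto
  have dle: "d v \<le> N (v + \<Phi> x)" if "v \<in> V" "x \<in> X0" for v x
    unfolding d_def by (rule cINF_lower[OF bdd]) (use that in auto)
  have dge: "c \<le> d v" if "\<And>x. x \<in> X0 \<Longrightarrow> c \<le> N (v + \<Phi> x)" for c v
    unfolding d_def by (rule cINF_greatest) (use that X0 in auto)
  have semi: "seminorm_on S V d"
  proof (rule seminorm_onI[OF vsS subV])
    fix v w assume v: "v \<in> V" and w: "w \<in> V"
    have "d (v + w) - N (w + \<Phi> y) \<le> d v" if y: "y \<in> X0" for y
    proof (rule dge)
      fix x assume x: "x \<in> X0"
      have "d (v + w) \<le> N ((v + w) + \<Phi> (x + y))"
        using v w x y X0 S.subspace_add[OF subV] by (intro dle) auto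
      also have "(v + w) + \<Phi> (x + y) = (v + \<Phi> x) + (w + \<Phi> y)" by (simp add: \<Phi>add algebra_simps)
      finally show "d (v + w) - N (w + \<Phi> y) \<le> N (v + \<Phi> x)"
        using Nadd[OF V\<Phi>[OF v x] V\<Phi>[OF w y]] by linarith
    qed
    then have "d (v + w) - d v \<le> d w" by (intro dge) (simp add: algebra_simps)
    then show "d (v + w) \<le> d v + d w" by simp
  next
    fix c v assume v: "v \<in> V"
    have *: "d (S c v) \<le> norm c * N (v + \<Phi> x)" if x: "x \<in> X0" for x
    proof -
      have "d (S c v) \<le> N (S c v + \<Phi> (\<lambda>j. smul Y c (x j)))"
        using v x X0 S.subspace_scale[OF subV] by (intro dle) auto
      also have "S c v + \<Phi> (\<lambda>j. smul Y c (x j)) = S c (v + \<Phi> x)"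
        by (simp add: \<Phi>sc S.scale_right_distrib)
      finally show ?thesis using Nsc[OF V\<Phi>[OF v x], of c] by simp
    qed
    show "d (S c v) \<le> norm c * d v"
    proof (cases "c = 0")
      case True
      then show ?thesis using *[OF X0(1)] by simp
    next
      case False
      then have "d (S c v) / norm c \<le> d v"
        using * by (intro dge) (simp add: field_simps)
      then show ?thesis using False by (simp add: field_simps)
    qed
  qed
  define w where "w l = (if l \<in> L then u l else 0)" for l
  have wV: "w \<in> V" using u ns_zero[OF Y] by (auto simp: w_def V_def)
  show ?thesis
  proof (rule ccontr)
    assume contra: "\<not> ?thesis"
    have "1 \<le> d w"
    proof (rule dge, rule ccontr)
      fix x assume x: "x \<in> X0" "\<not> 1 \<le> N (w + \<Phi> x)"
      have "p l (u l + (\<Sum>j<n. smul Y (a l j) (x j))) < 1" if "l \<in> L" for l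
        using Nup[OF that, of "w + \<Phi> x"] x(2) that by (simp add: w_def \<Phi>_def)
      then show False using contra x(1) by (auto simp: X0_def)
    qed
    obtain f where fadd: "\<And>x y. f (x + y) = f x + f y" and fsc: "\<And>c x. f (S c x) = c * f x"
      and fd: "\<And>x. x \<in> V \<Longrightarrow> norm (f x) \<le> d x" and fw: "f w = of_real (d w)"
      using norming_functional[OF vsS subV semi wV] by blast
    have fN: "norm (f v) \<le> N v" if "v \<in> V" for v
      using fd[OF that] dle[OF that X0(1)] by (simp add: \<Phi>_def zero_fun_def[symmetric])
    have f\<Phi>: "f (\<Phi> x) = 0" if x: "x \<in> X0" for x
    proof -
      have "\<Phi> x + \<Phi> (\<lambda>j. smul Y (-1) (x j)) = 0" unfolding \<Phi>sc by simp
      then have "d (\<Phi> x) \<le> N 0" using dle[OF \<Phi>V[OF x] X0(3)[OF x, of "-1"]] by simp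
      also have "N 0 \<le> 0" by (rule Nle) (simp add: p0)
      finally have "norm (f (\<Phi> x)) \<le> 0" using fd[OF \<Phi>V[OF x]] by linarith
      then show ?thesis by simp
    qed
    define \<delta> where "\<delta> l y = (\<lambda>m. if m = l then y else 0)" for l :: 'l and y :: 'y
    have \<delta>V: "\<delta> l y \<in> V" if "y \<in> car Y" for l y using that ns_zero[OF Y] by (auto simp: \<delta>_def V_def)
    have fsum: "f (\<lambda>l. if l \<in> L then v l else 0) = (\<Sum>l\<in>L. f (\<delta> l (v l)))" for v
    proof -
      have "(\<lambda>l. if l \<in> L then v l else 0) = (\<Sum>l\<in>L. \<delta> l (v l))"
        using L by (auto simp: fun_eq_iff sum_fun_apply \<delta>_def)
      then show ?thesis by (simp add: additive_sum[of f, OF fadd])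
    qed
    define \<psi> where "\<psi> l = zero_off (car Y) (\<lambda>y. f (\<delta> l y))" for l
    have \<delta>add: "\<delta> l (x + y) = \<delta> l x + \<delta> l y" and \<delta>sc: "\<delta> l (smul Y c x) = S c (\<delta> l x)" for l x y c
      by (auto simp: \<delta>_def S_def)
    have \<psi>dual: "\<psi> l \<in> car (dual Y)" if l: "l \<in> L" for l
    proof -
      obtain K where K: "\<And>y. y \<in> car Y \<Longrightarrow> p l y \<le> K * nrm Y y" using pK[OF l] by blast
      have "norm (f (\<delta> l y)) \<le> max K 0 * nrm Y y" if y: "y \<in> car Y" for y
      proof -
        have "N (\<delta> l y) \<le> p l y"
          by (rule Nle) (use pge[OF l y] p0 in \<open>auto simp: \<delta>_def\<close>)
        also have "\<dots> \<le> max K 0 * nrm Y y"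
          using K[OF y] mult_right_mono[OF max.cobounded1[of K 0] nrm_nonneg[OF Y y]] by simp
        finally show ?thesis using fN[OF \<delta>V[OF y]] by (meson order_trans)
      qed
      then show ?thesis unfolding \<psi>_def
        by (intro zero_off_dual(1)[OF Y, where K = "max K 0"]) (auto simp: \<delta>add \<delta>sc fadd fsc)
    qed
    have dom: "norm (\<Sum>l\<in>L. \<psi> l (y l)) \<le> 1" if y: "\<And>l. l \<in> L \<Longrightarrow> y l \<in> car Y \<and> p l (y l) \<le> 1" for y
    proof -
      let ?v = "\<lambda>l. if l \<in> L then y l else 0"
      have "(\<Sum>l\<in>L. \<psi> l (y l)) = f ?v"
        unfolding fsum using y by (intro sum.cong) (auto simp: \<psi>_def)
      moreover have "?v \<in> V" using y ns_zero[OF Y] by (auto simp: V_def)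
      moreover have "N ?v \<le> 1" using y by (intro Nle) auto
      ultimately show ?thesis using fN[of ?v] by simp
    qed
    have "\<exists>\<theta>. (\<forall>l\<in>L. 0 \<le> \<theta> l) \<and> sum \<theta> L \<le> 1 \<and>
      (\<forall>l\<in>L. \<forall>y\<in>car Y. norm (\<psi> l y) \<le> \<theta> l * p l y)"
    proof (rule dominated_by_max_of_seminorms[OF Y L])
      show "seminorm_on (smul Y) (car Y) (p l)" if "l \<in> L" for l by (rule p[OF that])
      show "lin_op Y scalars (\<psi> l)" if "l \<in> L" for l by (rule dual_lin_op[OF \<psi>dual[OF that]])
      show "norm (\<Sum>l\<in>L. \<psi> l (y l)) \<le> 1" if "\<And>l. l \<in> L \<Longrightarrow> y l \<in> car Y \<and> p l (y l) \<le> 1" for y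
        using that by (rule dom)
    qed
    then obtain \<theta> where \<theta>: "\<forall>l\<in>L. 0 \<le> \<theta> l" "sum \<theta> L \<le> 1"
      "\<forall>l\<in>L. \<forall>y\<in>car Y. norm (\<psi> l y) \<le> \<theta> l * p l y" by (elim exE conjE)
    note \<theta> = \<theta>[rule_format]
    have est: "norm (\<psi> l (u l) + (\<Sum>j<n. a l j * \<zeta> j (\<psi> l))) \<le> \<rho> * \<theta> l" if l: "l \<in> L" for l
    proof (cases "\<theta> l = 0")
      case True
      then have "\<psi> l = 0"
        using \<theta>(3)[OF l] ns_zero[OF normed_space_dual[OF Y]] by (intro dual_eqI[OF \<psi>dual[OF l]]) auto
      moreover have "\<zeta> j 0 = 0" if "j < n" for j
        by (rule lin_op_zero[OF normed_space_dual[OF Y] dual_lin_op[OF \<zeta>[OF that]]])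
      ultimately show ?thesis using True by simp
    next
      case False
      define b :: 'k where "b = of_real (1 / \<theta> l)"
      have t: "\<theta> l > 0" using False \<theta>(1)[OF l] by simp
      let ?\<psi> = "fscale b (\<psi> l)"
      have d: "?\<psi> \<in> car (dual Y)" using ns_smul[OF normed_space_dual[OF Y] \<psi>dual[OF l]] by simp
      have "norm (?\<psi> y) \<le> p l y" if "y \<in> car Y" for y
        using \<theta>(3)[OF l that] t by (simp add: b_def norm_mult norm_divide divide_le_eq mult.commute)
      from hyp[OF l d this]
      have "norm (?\<psi> (u l) + (\<Sum>j<n. a l j * \<zeta> j ?\<psi>)) \<le> \<rho>" .
      also have "(\<Sum>j<n. a l j * \<zeta> j ?\<psi>) = (\<Sum>j<n. b * (a l j * \<zeta> j (\<psi> l)))"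
        using dual_smul[OF \<zeta> \<psi>dual[OF l]] by (intro sum.cong) auto
      also have "?\<psi> (u l) + (\<Sum>j<n. b * (a l j * \<zeta> j (\<psi> l)))
          = b * (\<psi> l (u l) + (\<Sum>j<n. a l j * \<zeta> j (\<psi> l)))"
        by (simp add: sum_distrib_left distrib_left)
      finally show ?thesis using t by (simp add: norm_mult norm_divide b_def divide_le_eq)
    qed
    have zero: "(\<Sum>l\<in>L. a l j * \<zeta> j (\<psi> l)) = 0" if j: "j < n" for j
    proof -
      have "(\<Sum>l\<in>L. fscale (a l j) (\<psi> l)) = 0"
      proof (rule dual_eqI[of _ Y])
        show "(\<Sum>l\<in>L. fscale (a l j) (\<psi> l)) \<in> car (dual Y)"
          using \<psi>dual ns_sum[OF normed_space_dual[OF Y], of L "\<lambda>l. fscale (a l j) (\<psi> l)"]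
            ns_smul[OF normed_space_dual[OF Y]] by simp
        show "0 \<in> car (dual Y)" by (rule ns_zero[OF normed_space_dual[OF Y]])
        fix y assume y: "y \<in> car Y"
        let ?x = "\<lambda>i. if i = j then y else 0"
        have x: "?x \<in> X0" using y ns_zero[OF Y] by (auto simp: X0_def)
        have \<Phi>x: "\<Phi> ?x = (\<lambda>l. smul Y (a l j) y)"
          using j by (auto simp: \<Phi>_def if_distrib[of "smul Y _"] cong: if_cong)
        have V1: "(\<lambda>l. if l \<in> L then \<Phi> ?x l else 0) \<in> V" "(\<lambda>l. if l \<in> L then 0 else \<Phi> ?x l) \<in> V"
          using \<Phi>V[OF x] ns_zero[OF Y] by (auto simp: V_def)
        have "N (\<lambda>l. if l \<in> L then 0 else \<Phi> ?x l) \<le> 0" by (rule Nle) (simp add: p0)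
        then have "f (\<lambda>l. if l \<in> L then 0 else \<Phi> ?x l) = 0"
          using order_trans[OF fN[OF V1(2)]] norm_le_zero_iff by blast
        moreover have "\<Phi> ?x = (\<lambda>l. if l \<in> L then \<Phi> ?x l else 0) + (\<lambda>l. if l \<in> L then 0 else \<Phi> ?x l)"
          by auto
        from arg_cong[OF this, of f, unfolded fadd f\<Phi>[OF x]]
        have "0 = f (\<lambda>l. if l \<in> L then \<Phi> ?x l else 0) + f (\<lambda>l. if l \<in> L then 0 else \<Phi> ?x l)" .
        ultimately have "0 = f (\<lambda>l. if l \<in> L then \<Phi> ?x l else 0)" by simp
        also have "\<dots> = (\<Sum>l\<in>L. a l j * \<psi> l y)"
          unfolding fsum \<Phi>x using y by (intro sum.cong) (auto simp: \<delta>sc fsc \<psi>_def)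
        finally show "(\<Sum>l\<in>L. fscale (a l j) (\<psi> l)) y = 0 y" by (simp add: sum_fun_apply)
      qed
      moreover have "\<zeta> j (\<Sum>l\<in>L. fscale (a l j) (\<psi> l)) = (\<Sum>l\<in>L. a l j * \<zeta> j (\<psi> l))"
        using lin_op_lincomb[OF normed_space_dual[OF Y] dual_lin_op[OF \<zeta>[OF j]] \<psi>dual, of L "\<lambda>l. l" "\<lambda>l. a l j"]
        by simp
      ultimately show ?thesis
        using lin_op_zero[OF normed_space_dual[OF Y] dual_lin_op[OF \<zeta>[OF j]]] by simp
    qed
    have "f w = (\<Sum>l\<in>L. \<psi> l (u l))"
      unfolding w_def fsum using u by (intro sum.cong) (auto simp: \<psi>_def)
    moreover have "(\<Sum>l\<in>L. \<Sum>j<n. a l j * \<zeta> j (\<psi> l)) = 0"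
      by (subst sum.swap) (simp add: zero)
    ultimately have "f w = (\<Sum>l\<in>L. \<psi> l (u l) + (\<Sum>j<n. a l j * \<zeta> j (\<psi> l)))"
      by (simp add: sum.distrib)
    then have "norm (f w) \<le> (\<Sum>l\<in>L. \<rho> * \<theta> l)" using est by (simp add: sum_norm_le)
    moreover have "0 \<le> \<rho>"
    proof -
      obtain l where l: "l \<in> L" using ne by blast
      have "norm ((0::'y \<Rightarrow> 'k) (u l) + (\<Sum>j<n. a l j * \<zeta> j 0)) \<le> \<rho>"
        by (rule hyp[OF l ns_zero[OF normed_space_dual[OF Y]]]) (simp add: pge[OF l])
      then show ?thesis using norm_ge_zero order_trans by blast
    qed
    ultimately have "norm (f w) \<le> \<rho>" using \<theta>(2) mult_left_mono[of "sum \<theta> L" 1 \<rho>]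
      by (simp add: sum_distrib_left[symmetric])
    then show False using fw \<open>1 \<le> d w\<close> \<rho> by simp
  qed
qed

lemma dual_dominated_multiple:
  assumes Y: "normed_space Y" and \<phi>: "\<phi> \<in> car (dual Y)" and \<psi>: "\<psi> \<in> car (dual Y)"
    and dom: "\<And>y. y \<in> car Y \<Longrightarrow> norm (\<psi> y) \<le> C * norm (\<phi> y)"
  shows "\<exists>b. \<psi> = fscale b \<phi>"
proof (cases "\<exists>y0\<in>car Y. \<phi> y0 \<noteq> 0")
  case True
  then obtain y0 where y0: "y0 \<in> car Y" "\<phi> y0 \<noteq> 0" by blast
  have "\<psi> = fscale (\<psi> y0 / \<phi> y0) \<phi>"
  proof (rule dual_eqI[OF \<psi>])
    show "fscale (\<psi> y0 / \<phi> y0) \<phi> \<in> car (dual Y)"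
      using ns_smul[OF normed_space_dual[OF Y] \<phi>] by simp
    fix y assume y: "y \<in> car Y"
    let ?z = "y - smul Y (\<phi> y / \<phi> y0) y0"
    have z: "?z \<in> car Y" by (intro ns_diff[OF Y] ns_smul[OF Y] y y0)
    have e: "\<theta> ?z = \<theta> y - \<phi> y / \<phi> y0 * \<theta> y0" if "\<theta> \<in> car (dual Y)" for \<theta>
      using lin_op_diff[OF Y dual_lin_op[OF that] y ns_smul[OF Y y0(1)]] dual_smul[OF that y0(1)]
      by simp
    have "\<phi> ?z = 0" using e[OF \<phi>] y0 by simp
    then have "\<psi> ?z = 0" using dom[OF z] by simp
    then show "\<psi> y = fscale (\<psi> y0 / \<phi> y0) \<phi> y" using e[OF \<psi>] y0 by (simp add: field_simps)
  qed
  then show ?thesis by blast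
next
  case False
  have "\<psi> = fscale 0 \<phi>"
    using False dom ns_smul[OF normed_space_dual[OF Y] \<phi>, of 0]
    by (intro dual_eqI[OF \<psi>, of "fscale 0 \<phi>"]) force+
  then show ?thesis by blast
qed

lemma bdd_op_add:
  assumes X: "normed_space X" and Y: "normed_space Y" and S: "bdd_op X Y S" and T: "bdd_op X Y T"
  shows "bdd_op X Y (\<lambda>x. S x + T x)"
proof -
  have l: "lin_op X Y S" "lin_op X Y T" using S T by (auto simp: bdd_op_def)
  interpret vector_space "smul Y" by (rule ns_vector_space[OF Y])
  show ?thesis
  proof (rule bdd_opI[where K = "op_norm X Y S + op_norm X Y T"])
    show "lin_op X Y (\<lambda>x. S x + T x)"
      using l ns_add[OF Y] by (auto simp: lin_op_def scale_right_distrib image_subset_iff)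
    show "nrm Y (S x + T x) \<le> (op_norm X Y S + op_norm X Y T) * nrm X x" if "x \<in> car X" for x
      using nrm_add_le[OF Y lin_op_in[OF l(1) that] lin_op_in[OF l(2) that]]
        op_norm_bound[OF X Y S that] op_norm_bound[OF X Y T that] by (simp add: distrib_right)
  qed
qed

lemma op_norm_le_unit_ball:
  assumes X: "normed_space X" and "\<And>x. x \<in> car X \<Longrightarrow> nrm X x \<le> 1 \<Longrightarrow> nrm Y (T x) \<le> K"
  shows "op_norm X Y T \<le> K"
  unfolding op_norm_def
proof (rule cSup_least)
  show "{nrm Y (T x) |x. x \<in> car X \<and> nrm X x \<le> 1} \<noteq> {}"
    using ns_zero[OF X] nrm_zero[OF X] by force
qed (use assms(2) in auto)

lemma bdd_op_finite_frame:
  assumes M: "normed_space M" and Y: "normed_space Y" and f: "finite_frame M n e c"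
    and T: "lin_op M Y T"
  shows "bdd_op M Y T"
proof -
  have b: "bdd_op M Y (\<lambda>m. \<Sum>j<n. smul Y (c j m) (T (e j)))"
    using f lin_op_in[OF T] by (intro bdd_op_finite_rank[OF M Y]) (auto simp: finite_frame_def)
  then obtain K where K: "\<And>m. m \<in> car M \<Longrightarrow> nrm Y (\<Sum>j<n. smul Y (c j m) (T (e j))) \<le> K * nrm M m"
    by (auto simp: bdd_op_def)
  show ?thesis
  proof (rule bdd_opI[OF T])
    fix m assume m: "m \<in> car M"
    have "T m = T (\<Sum>j<n. smul M (c j m) (e j))" using f m by (auto simp: finite_frame_def)
    also have "\<dots> = (\<Sum>j<n. smul Y (c j m) (T (e j)))"
      using f by (intro lin_op_lincomb[OF M T]) (auto simp: finite_frame_def)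
    finally show "nrm Y (T m) \<le> K * nrm M m" using K[OF m] by simp
  qed
qed

text \<open>
  The operator \<open>m \<mapsto> T0 m + (\<Sum>j. c j m \<zeta> j)\<close> into the bidual is moved into \<open>Y\<close> by a change of the \<open>\<zeta> j\<close> only, so that the
  result agrees with \<open>T0\<close> where all \<open>c j\<close> vanish. The norm bound, on a finite net of the unit ball, and
  the approximate values at \<open>\<Phi>\<close> are finitely many seminorm inequalities for the unknown vectors \<open>x j\<close>.
\<close>

lemma local_reflexivity:
  fixes M :: "('k::real_or_complex, 'm::ab_group_add) nspace"
    and Y :: "('k, 'y::ab_group_add) nspace" and n :: nat
  assumes M: "normed_space M" and frame: "finite_frame M n0 e0 c0" and Y: "normed_space Y"
    and T0: "lin_op M Y T0"
    and c: "\<And>j. j < n \<Longrightarrow> c j \<in> car (dual M)" and \<zeta>: "\<And>j. j < n \<Longrightarrow> \<zeta> j \<in> car (bidual Y)"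
    and K: "0 \<le> K" "K < K'"
    and bound: "\<And>m. m \<in> car M \<Longrightarrow>
      nrm (bidual Y) (canon Y (T0 m) + (\<Sum>j<n. fscale (c j m) (\<zeta> j))) \<le> K * nrm M m"
    and \<Phi>: "finite \<Phi>" "\<Phi> \<subseteq> car (dual Y)" and \<delta>: "\<delta> > 0"
  shows "\<exists>x. (\<forall>j<n. x j \<in> car Y) \<and>
    (\<forall>m\<in>car M. nrm Y (T0 m + (\<Sum>j<n. smul Y (c j m) (x j))) \<le> K' * nrm M m) \<and>
    (\<forall>j<n. \<forall>\<phi>\<in>\<Phi>. norm (\<phi> (x j) - \<zeta> j \<phi>) < \<delta>)"
proof -
  \<comment> \<open>The operator to be found is bounded by \<open>K1\<close> on a net of mesh \<open>\<eta>\<close>, so that its norm \<open>\<tau>\<close> satisfies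
    \<open>\<tau> \<le> K1 + \<tau> * \<eta>\<close>. The constants are such that \<open>K1 / (1 - \<eta>) = K'\<close> and that the hypothesis of
    \<open>helly\<close> holds with \<open>\<rho> = K * (1 + \<eta>) / K1 < 1\<close>.\<close>
  define \<eta> where "\<eta> = (K' - K) / (2 * K')"
  define K1 where "K1 = (K + K') / 2"
  have \<eta>: "0 < \<eta>" "\<eta> < 1" using K by (auto simp: \<eta>_def)
  have K1: "K1 > 0" "K1 = K' * (1 - \<eta>)" using K by (auto simp: K1_def \<eta>_def field_simps)
  have "K * \<eta> < K' * \<eta>" using K \<eta> by simp
  moreover have "K' * \<eta> = (K' - K) / 2" using K by (simp add: \<eta>_def)
  ultimately have \<rho>: "K * (1 + \<eta>) < K1" by (simp add: K1_def field_simps)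
  interpret vector_space "smul Y" by (rule ns_vector_space[OF Y])
  obtain N where N: "finite N" "N \<subseteq> car M"
    "\<And>x. x \<in> car M \<Longrightarrow> nrm M x \<le> 1 \<Longrightarrow> \<exists>y\<in>N. nrm M (x - y) \<le> \<eta>"
    using finite_net_unit_ball[OF M frame \<eta>(1)] by blast
  define N' where "N' = {y \<in> N. nrm M y \<le> 1 + \<eta>}"
  define L :: "('m + nat \<times> ('y \<Rightarrow> 'k)) set" where "L = Inl ` N' \<union> Inr ` ({..<n} \<times> \<Phi>)"
  have finL: "finite L" using N \<Phi> by (auto simp: L_def N'_def)
  \<comment> \<open>The condition \<open>norm (\<phi> (x j) - \<zeta> j \<phi>) < \<delta>\<close> is a seminorm inequality for \<open>w + x j\<close>.\<close>
  have "\<exists>w. w \<in> car Y \<and> \<phi> w = - \<zeta> j \<phi>" if j: "j < n" and \<phi>: "\<phi> \<in> \<Phi>" for j \<phi>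
  proof (cases "\<exists>y0\<in>car Y. \<phi> y0 \<noteq> 0")
    case True
    then obtain y0 where "y0 \<in> car Y" "\<phi> y0 \<noteq> 0" by blast
    moreover from this have "\<phi> (smul Y (- \<zeta> j \<phi> / \<phi> y0) y0) = - \<zeta> j \<phi>"
      using \<Phi> \<phi> dual_smul[of \<phi> Y y0 "- \<zeta> j \<phi> / \<phi> y0"] by auto
    ultimately show ?thesis using ns_smul[OF Y] by blast
  next
    case False
    then have "\<phi> = 0" using \<Phi> \<phi> ns_zero[OF normed_space_dual[OF Y]]
      by (intro dual_eqI[of \<phi> Y 0]) auto
    then have "\<zeta> j \<phi> = 0"
      using lin_op_zero[OF normed_space_dual[OF Y] dual_lin_op[OF \<zeta>[OF j]]] by simp
    then show ?thesis using \<open>\<phi> = 0\<close> ns_zero[OF Y] by (intro exI[of _ 0]) auto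
  qed
  then obtain w where w: "\<And>j \<phi>. j < n \<Longrightarrow> \<phi> \<in> \<Phi> \<Longrightarrow> w j \<phi> \<in> car Y"
    "\<And>j \<phi>. j < n \<Longrightarrow> \<phi> \<in> \<Phi> \<Longrightarrow> \<phi> (w j \<phi>) = - \<zeta> j \<phi>" by metis
  define u :: "'m + nat \<times> ('y \<Rightarrow> 'k) \<Rightarrow> 'y" where "u = case_sum T0 (\<lambda>(j, \<phi>). w j \<phi>)"
  define a :: "'m + nat \<times> ('y \<Rightarrow> 'k) \<Rightarrow> nat \<Rightarrow> 'k" where
    "a = case_sum (\<lambda>m j. c j m) (\<lambda>(i, \<phi>) j. if j = i then 1 else 0)"
  define p :: "'m + nat \<times> ('y \<Rightarrow> 'k) \<Rightarrow> 'y \<Rightarrow> real" where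
    "p = case_sum (\<lambda>m y. nrm Y y / K1) (\<lambda>(i, \<phi>) y. norm (\<phi> y) / \<delta>)"
  have "\<exists>x. (\<forall>j<n. x j \<in> car Y) \<and> (\<forall>l\<in>L. p l (u l + (\<Sum>j<n. smul Y (a l j) (x j))) < 1)"
  proof (rule helly[OF Y finL _ _ _ \<zeta>, where \<rho> = "K * (1 + \<eta>) / K1"])
    show "K * (1 + \<eta>) / K1 < 1" using \<rho> K1 by simp
    show "u l \<in> car Y" if "l \<in> L" for l
      using that N(2) lin_op_in[OF T0] w by (auto simp: L_def u_def N'_def)
    show "seminorm_on (smul Y) (car Y) (p l)" if "l \<in> L" for l
    proof (cases l)
      case (Inl m)
      have "p l = (\<lambda>y. nrm Y y / K1)" by (simp add: p_def Inl)
      then show ?thesis using nrm_add_le[OF Y] nrm_smul[OF Y] K1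
        by (auto simp: seminorm_on_def add_divide_distrib[symmetric] divide_right_mono)
    next
      case (Inr q)
      obtain i \<phi> where q: "q = (i, \<phi>)" by (cases q)
      then have \<phi>: "\<phi> \<in> car (dual Y)" using that Inr \<Phi> by (auto simp: L_def)
      have "p l = (\<lambda>y. norm (\<phi> y) / \<delta>)" by (simp add: p_def Inr q)
      then show ?thesis using \<delta>
        by (auto simp: seminorm_on_def add_divide_distrib[symmetric] divide_right_mono
            dual_add[OF \<phi>] dual_smul[OF \<phi>] norm_triangle_ineq norm_mult)
    qed
    show "\<exists>K. \<forall>y\<in>car Y. p l y \<le> K * nrm Y y" if "l \<in> L" for l
    proof (cases l)
      case (Inl m)
      show ?thesis by (rule exI[of _ "1 / K1"]) (simp add: p_def Inl)
    next
      case (Inr q)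
      obtain i \<phi> where q: "q = (i, \<phi>)" by (cases q)
      then have \<phi>: "\<phi> \<in> car (dual Y)" using that Inr \<Phi> by (auto simp: L_def)
      show ?thesis using dual_bound[OF Y \<phi>] \<delta>
        by (intro exI[of _ "op_norm Y scalars \<phi> / \<delta>"]) (auto simp: p_def Inr q divide_right_mono)
    qed
    fix l \<psi> assume l: "l \<in> L" and \<psi>: "\<psi> \<in> car (dual Y)"
      and dom: "\<And>y. y \<in> car Y \<Longrightarrow> norm (\<psi> y) \<le> p l y"
    show "norm (\<psi> (u l) + (\<Sum>j<n. a l j * \<zeta> j \<psi>)) \<le> K * (1 + \<eta>) / K1"
    proof (cases l)
      case (Inl m)
      then have m: "m \<in> car M" "nrm M m \<le> 1 + \<eta>" using l N by (auto simp: L_def N'_def)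
      define z where "z = canon Y (T0 m) + (\<Sum>j<n. fscale (c j m) (\<zeta> j))"
      have zin: "z \<in> car (bidual Y)"
        unfolding z_def using \<zeta> ns_smul[OF normed_space_bidual[OF Y]]
        by (intro ns_add[OF normed_space_bidual[OF Y]] canon_bidual[OF Y] lin_op_in[OF T0 m(1)]
            ns_sum[OF normed_space_bidual[OF Y]]) simp_all
      have "op_norm Y scalars \<psi> \<le> 1 / K1"
        using dom K1 by (intro dual_norm_le[OF Y \<psi>]) (auto simp: p_def Inl)
      moreover have "nrm (bidual Y) z \<le> K * (1 + \<eta>)"
        using bound[OF m(1)] mult_left_mono[OF m(2) K(1)] by (simp add: z_def)
      moreover have "norm (z \<psi>) \<le> nrm (bidual Y) z * op_norm Y scalars \<psi>"
        using dual_bound[OF normed_space_dual[OF Y] zin \<psi>] by simp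
      ultimately have "norm (z \<psi>) \<le> K * (1 + \<eta>) * (1 / K1)"
        using K \<eta> nrm_nonneg[OF normed_space_dual[OF Y] \<psi>]
        by (smt (verit) mult_mono' dual_simps(2) nrm_nonneg[OF normed_space_bidual[OF Y] zin])
      moreover have "z \<psi> = \<psi> (u l) + (\<Sum>j<n. a l j * \<zeta> j \<psi>)"
        using \<psi> by (simp add: z_def sum_fun_apply Inl u_def a_def)
      ultimately show ?thesis by simp
    next
      case (Inr q)
      obtain i \<phi> where q: "q = (i, \<phi>)" by (cases q)
      then have \<phi>: "\<phi> \<in> car (dual Y)" "\<phi> \<in> \<Phi>" "i < n" using l Inr \<Phi> by (auto simp: L_def)
      have "norm (\<psi> y) \<le> (1 / \<delta>) * norm (\<phi> y)" if "y \<in> car Y" for y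
        using dom[OF that] by (simp add: p_def Inr q)
      then obtain b where b: "\<psi> = fscale b \<phi>"
        using dual_dominated_multiple[OF Y \<phi>(1) \<psi>] by blast
      have "(\<Sum>j<n. a l j * \<zeta> j \<psi>) = \<zeta> i \<psi>"
        using \<phi>(3) by (simp add: a_def Inr q if_distrib[of "\<lambda>x. x * _"] cong: if_cong)
      moreover have "\<zeta> i \<psi> = b * \<zeta> i \<phi>" using dual_smul[OF \<zeta>[OF \<phi>(3)] \<phi>(1)] by (simp add: b)
      ultimately have "\<psi> (u l) + (\<Sum>j<n. a l j * \<zeta> j \<psi>) = 0"
        using w(2)[OF \<phi>(3,2)] by (simp add: b u_def Inr q)
      then show ?thesis using K K1 \<eta> by simp
    qed
  qed
  then obtain x where x: "\<And>j. j < n \<Longrightarrow> x j \<in> car Y"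
    and xp: "\<And>l. l \<in> L \<Longrightarrow> p l (u l + (\<Sum>j<n. smul Y (a l j) (x j))) < 1" by blast
  define T where "T m = T0 m + (\<Sum>j<n. smul Y (c j m) (x j))" for m
  have T: "bdd_op M Y T"
    unfolding T_def using c x
    by (intro bdd_op_add[OF M Y] bdd_op_finite_frame[OF M Y frame T0] bdd_op_finite_rank[OF M Y])
  then have lT: "lin_op M Y T" by (simp add: bdd_op_def)
  have "op_norm M Y T \<le> K1 + op_norm M Y T * \<eta>"
  proof (rule op_norm_le_unit_ball[OF M])
    fix m assume m: "m \<in> car M" "nrm M m \<le> 1"
    obtain y where y: "y \<in> N" "nrm M (m - y) \<le> \<eta>" using N(3)[OF m] by blast
    have yM: "y \<in> car M" using y N by blast
    have my: "m - y \<in> car M" by (rule ns_diff[OF M m(1) yM])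
    have "nrm M (m - (m - y)) \<le> nrm M m + nrm M (m - y)" by (rule nrm_diff_le[OF M m(1) my])
    then have "nrm M y \<le> 1 + \<eta>" using m(2) y(2) by simp
    then have "Inl y \<in> L" using y by (auto simp: L_def N'_def)
    from xp[OF this] have Ty: "nrm Y (T y) < K1"
      using K1 by (simp add: p_def u_def a_def T_def)
    have "T m = T y + T (m - y)" using lin_op_add[OF lT yM my] by simp
    then have "nrm Y (T m) \<le> nrm Y (T y) + nrm Y (T (m - y))"
      using nrm_add_le[OF Y lin_op_in[OF lT yM] lin_op_in[OF lT my]] by simp
    also have "nrm Y (T (m - y)) \<le> op_norm M Y T * nrm M (m - y)" by (rule op_norm_bound[OF M Y T my])
    also have "\<dots> \<le> op_norm M Y T * \<eta>" by (intro mult_left_mono y op_norm_nonneg[OF M Y T])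
    finally show "nrm Y (T m) \<le> K1 + op_norm M Y T * \<eta>" using Ty by simp
  qed
  then have "op_norm M Y T * (1 - \<eta>) \<le> K' * (1 - \<eta>)" using K1 by (simp add: algebra_simps)
  then have TK: "op_norm M Y T \<le> K'" using \<eta> by simp
  show ?thesis
  proof (intro exI[of _ x] conjI allI ballI impI)
    show "x j \<in> car Y" if "j < n" for j by (rule x[OF that])
    show "nrm Y (T0 m + (\<Sum>j<n. smul Y (c j m) (x j))) \<le> K' * nrm M m" if "m \<in> car M" for m
      using op_norm_bound[OF M Y T that] mult_right_mono[OF TK nrm_nonneg[OF M that]]
      by (simp add: T_def)
    fix j \<phi> assume j: "j < n" and \<phi>: "\<phi> \<in> \<Phi>"
    then have "Inr (j, \<phi>) \<in> L" by (simp add: L_def)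
    from xp[OF this] have "norm (\<phi> (w j \<phi> + (\<Sum>i<n. smul Y (if i = j then 1 else 0) (x i)))) < \<delta>"
      using \<delta> by (simp add: p_def u_def a_def)
    also have "(\<Sum>i<n. smul Y (if i = j then 1 else 0) (x i)) = x j"
      using j by (simp add: if_distrib[of "\<lambda>c. smul Y c _"] cong: if_cong)
    finally show "norm (\<phi> (x j) - \<zeta> j \<phi>) < \<delta>"
      using \<Phi> \<phi> w[OF j \<phi>] x[OF j] dual_add[of \<phi> Y "w j \<phi>" "x j"] by auto
  qed
qed

section \<open>Multilinear forms and polarization\<close>

lemma multilinear_onD:
  assumes "multilinear_on k s S A" "length xs + length ys + 1 = k" "set xs \<subseteq> S" "set ys \<subseteq> S"
  shows multilinear_on_add: "x \<in> S \<Longrightarrow> y \<in> S \<Longrightarrow> A (xs @ (x + y) # ys) = A (xs @ x # ys) + A (xs @ y # ys)"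
    and multilinear_on_scale: "x \<in> S \<Longrightarrow> A (xs @ s c x # ys) = c * A (xs @ x # ys)"
  using assms(1)[unfolded multilinear_on_def, THEN spec[of _ xs], THEN spec[of _ ys],
      THEN mp, THEN mp, THEN mp, OF assms(2-4)] by blast+

lemma multilinear_on_Cons:
  assumes A: "multilinear_on (Suc k) s S A" and x: "x \<in> S"
  shows "multilinear_on k s S (\<lambda>xs. A (x # xs))"
  unfolding multilinear_on_def
proof (intro allI impI conjI ballI)
  fix xs ys y z c
  assume *: "length xs + length ys + 1 = k" "set xs \<subseteq> S" "set ys \<subseteq> S" "y \<in> S"
  then have **: "length (x # xs) + length ys + 1 = Suc k" "set (x # xs) \<subseteq> S" using x by auto
  show "z \<in> S \<Longrightarrow> A (x # xs @ (y + z) # ys) = A (x # xs @ y # ys) + A (x # xs @ z # ys)"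
    using multilinear_on_add[OF A ** *(3,4), of z] by simp
  show "A (x # xs @ s c y # ys) = c * A (x # xs @ y # ys)"
    using multilinear_on_scale[OF A ** *(3,4)] by simp
qed

lemma multilinear_on_pullback:
  assumes B: "multilinear_on k s' S' B"
    and T: "\<And>x. x \<in> S \<Longrightarrow> T x \<in> S'" "\<And>x y. x \<in> S \<Longrightarrow> y \<in> S \<Longrightarrow> T (x + y) = T x + T y"
      "\<And>c x. x \<in> S \<Longrightarrow> T (s c x) = s' c (T x)"
  shows "multilinear_on k s S (\<lambda>xs. B (map T xs))"
  unfolding multilinear_on_def
proof (intro allI impI conjI ballI)
  fix xs ys x y c
  assume *: "length xs + length ys + 1 = k" "set xs \<subseteq> S" "set ys \<subseteq> S" "x \<in> S"
  then have **: "length (map T xs) + length (map T ys) + 1 = k" "set (map T xs) \<subseteq> S'" "set (map T ys) \<subseteq> S'"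
    using T(1) by auto
  show "y \<in> S \<Longrightarrow> B (map T (xs @ (x + y) # ys)) = B (map T (xs @ x # ys)) + B (map T (xs @ y # ys))"
    using multilinear_on_add[OF B **] T * by simp
  show "B (map T (xs @ s c x # ys)) = c * B (map T (xs @ x # ys))"
    using multilinear_on_scale[OF B **] T * by simp
qed

lemma multilinear_on_sum:
  assumes vs: "vector_space s" and S: "module.subspace s S" and A: "multilinear_on k s S A"
    and l: "length us + length vs + 1 = k" and uv: "set us \<subseteq> S" "set vs \<subseteq> S"
    and x: "\<And>i. i \<in> I \<Longrightarrow> x i \<in> S"
  shows "A (us @ (\<Sum>i\<in>I. x i) # vs) = (\<Sum>i\<in>I. A (us @ x i # vs))"
proof -
  interpret vector_space s by (rule vs)
  have "A (us @ s 0 0 # vs) = 0 * A (us @ 0 # vs)"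
    by (rule multilinear_on_scale[OF A l uv subspace_0[OF S]])
  then have z: "A (us @ 0 # vs) = 0" by simp
  show ?thesis using x
  proof (induction I rule: infinite_finite_induct)
    case (insert i I)
    have "A (us @ (x i + sum x I) # vs) = A (us @ x i # vs) + A (us @ sum x I # vs)"
      by (intro multilinear_on_add[OF A l uv] subspace_sum[OF S]) (use insert in auto)
    then show ?case using insert by simp
  qed (simp_all add: z)
qed

lemma multilinear_on_scale_all:
  assumes A: "multilinear_on (length us + length xs) s S A" and "set us \<subseteq> S"
    and "\<And>x. x \<in> set xs \<Longrightarrow> h x \<in> S" "\<And>c x. x \<in> S \<Longrightarrow> s c x \<in> S"
  shows "A (us @ map (\<lambda>x. s (t x) (h x)) xs) = prod_list (map t xs) * A (us @ map h xs)"
  using assms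
proof (induction xs arbitrary: us)
  case (Cons x xs)
  have "A (us @ s (t x) (h x) # map (\<lambda>x. s (t x) (h x)) xs)
      = t x * A (us @ h x # map (\<lambda>x. s (t x) (h x)) xs)"
    by (rule multilinear_on_scale[OF Cons.prems(1)]) (use Cons.prems in auto)
  also have "A (us @ h x # map (\<lambda>x. s (t x) (h x)) xs)
      = prod_list (map t xs) * A (us @ h x # map h xs)"
    using Cons.IH[of "us @ [h x]"] Cons.prems by auto
  finally show ?case by (simp add: mult.assoc)
qed simp

lemma multilinear_on_expand:
  assumes vs: "vector_space s" and S: "module.subspace s S" and D: "finite D"
    and x: "\<And>i. i \<in> D \<Longrightarrow> x i \<in> S"
    and "multilinear_on (length us + r) s S A" "set us \<subseteq> S"
  shows "A (us @ replicate r (\<Sum>i\<in>D. x i)) = (\<Sum>js | set js \<subseteq> D \<and> length js = r. A (us @ map x js))"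
  using assms(5,6)
proof (induction r arbitrary: us)
  case 0
  have "{js. set js \<subseteq> D \<and> length js = 0} = {[]}" by auto
  then show ?case by simp
next
  case (Suc r)
  interpret vector_space s by (rule vs)
  have xS: "(\<Sum>i\<in>D. x i) \<in> S" using x by (rule subspace_sum[OF S])
  have "A (us @ replicate (Suc r) (\<Sum>i\<in>D. x i)) = A (us @ (\<Sum>i\<in>D. x i) # replicate r (\<Sum>i\<in>D. x i))"
    by simp
  also have "\<dots> = (\<Sum>i\<in>D. A (us @ x i # replicate r (\<Sum>i\<in>D. x i)))"
    by (rule multilinear_on_sum[OF vs S Suc.prems(1) _ Suc.prems(2) _ x]) (use xS in auto)
  also have "\<dots> = (\<Sum>i\<in>D. \<Sum>js | set js \<subseteq> D \<and> length js = r. A (us @ x i # map x js))"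
  proof (rule sum.cong)
    fix i assume "i \<in> D"
    then show "A (us @ x i # replicate r (\<Sum>i\<in>D. x i))
        = (\<Sum>js | set js \<subseteq> D \<and> length js = r. A (us @ x i # map x js))"
      using Suc.IH[of "us @ [x i]"] Suc.prems x by simp
  qed simp
  also have "\<dots> = (\<Sum>js | set js \<subseteq> D \<and> length js = Suc r. A (us @ map x js))"
  proof -
    have inj: "inj_on (\<lambda>(js, i). i # js) ({js. set js \<subseteq> D \<and> length js = r} \<times> D)"
      by (auto simp: inj_on_def)
    show ?thesis
      unfolding lists_length_Suc_eq
      by (subst sum.reindex[OF inj], subst sum.swap)
        (simp add: sum.cartesian_product case_prod_unfold)
  qed
  finally show ?case .
qed

text \<open>
  Adding or removing a fixed element of \<open>I - T\<close> changes the sign.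
\<close>

lemma sum_supersets_alternating:
  assumes I: "finite I" and T: "T \<subseteq> I" "T \<noteq> I"
  shows "(\<Sum>D | T \<subseteq> D \<and> D \<subseteq> I. (-1) ^ card D :: 'a::real_normed_field) = 0"
proof -
  obtain i where i: "i \<in> I" "i \<notin> T" using T by blast
  define g where "g D = (if i \<in> D then D - {i} else insert i D)" for D
  have fin: "finite D" if "D \<subseteq> I" for D using that I finite_subset by blast
  have "(\<Sum>D | T \<subseteq> D \<and> D \<subseteq> I. (-1) ^ card D :: 'a) = (\<Sum>D | T \<subseteq> D \<and> D \<subseteq> I. - ((-1) ^ card D))"
  proof (rule sum.reindex_bij_witness[of _ g g])
    fix D assume D: "D \<in> {D. T \<subseteq> D \<and> D \<subseteq> I}"
    then show "g (g D) = D" "g (g D) = D" by (auto simp: g_def)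
    show "g D \<in> {D. T \<subseteq> D \<and> D \<subseteq> I}" "g D \<in> {D. T \<subseteq> D \<and> D \<subseteq> I}" using D i by (auto simp: g_def)
    have "finite D" using D fin by auto
    then show "- ((-1) ^ card (g D)) = ((-1) ^ card D :: 'a)"
    proof (cases "i \<in> D")
      case True
      then have "card D = Suc (card (g D))" using card_Suc_Diff1[OF \<open>finite D\<close> True] by (simp only: g_def if_True)
      then show ?thesis by simp
    next
      case False
      then have "card (g D) = Suc (card D)" using \<open>finite D\<close> by (simp add: g_def)
      then show ?thesis by simp
    qed
  qed
  then show ?thesis by (simp add: sum_negf)
qed

definition list_perms :: "nat \<Rightarrow> nat list set" where
  "list_perms k = {js. set js = {..<k} \<and> length js = k}"

lemma card_list_perms: "card (list_perms k) > 0"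
proof -
  have "list_perms k \<subseteq> {js. set js \<subseteq> {..<k} \<and> length js = k}" by (auto simp: list_perms_def)
  then have "finite (list_perms k)" using finite_lists_length_eq finite_subset by blast
  moreover have "[0..<k] \<in> list_perms k" by (auto simp: list_perms_def)
  ultimately show ?thesis by (auto simp: card_gt_0_iff)
qed

text \<open>
  Expanding each diagonal value multilinearly and exchanging the sums, a list of indices that misses
  some index is cancelled by inclusion and exclusion; the remaining ones are permutations.
\<close>

lemma polarization:
  assumes X: "normed_space X" and A: "sym_form_of k X p A" and xs: "length xs = k" "set xs \<subseteq> car X"
  shows "of_nat (card (list_perms k)) * A xs =
    (\<Sum>D\<in>Pow {..<k}. (-1) ^ (k + card D) * p (\<Sum>i\<in>D. xs ! i))"
proof -
  have ml: "multilinear_on k (smul X) (car X) A" and p: "\<And>x. x \<in> car X \<Longrightarrow> p x = A (replicate k x)"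
    and sym: "\<And>us vs. length us = k \<Longrightarrow> set us \<subseteq> car X \<Longrightarrow> mset us = mset vs \<Longrightarrow> A us = A vs"
    using A by (auto simp: sym_form_of_def)
  let ?L = "{js. set js \<subseteq> {..<k} \<and> length js = k}"
  have finL: "finite ?L" by (rule finite_lists_length_eq) simp
  let ?F = "\<lambda>js. A (map ((!) xs) js)"
  have nth: "xs ! i \<in> car X" if "i < k" for i using xs that nth_mem by blast
  have pD: "p (\<Sum>i\<in>D. xs ! i) = (\<Sum>js\<in>?L. if set js \<subseteq> D then ?F js else 0)" if D: "D \<subseteq> {..<k}" for D
  proof -
    have fD: "finite D" using D finite_subset by blast
    have "(\<Sum>i\<in>D. xs ! i) \<in> car X" using nth D by (intro ns_sum[OF X]) auto
    then have "p (\<Sum>i\<in>D. xs ! i) = A ([] @ replicate k (\<Sum>i\<in>D. xs ! i))" using p by simp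
    also have "\<dots> = (\<Sum>js | set js \<subseteq> D \<and> length js = k. A ([] @ map ((!) xs) js))"
      using ml nth D
      by (intro multilinear_on_expand[OF ns_vector_space[OF X] ns_subspace[OF X] fD]) auto
    also have "\<dots> = (\<Sum>js\<in>{js \<in> ?L. set js \<subseteq> D}. ?F js)"
      using D by (intro sum.cong) auto
    also have "\<dots> = (\<Sum>js\<in>?L. if set js \<subseteq> D then ?F js else 0)"
      by (rule sum.inter_filter[OF finL])
    finally show ?thesis .
  qed
  have "(\<Sum>D\<in>Pow {..<k}. (-1) ^ (k + card D) * p (\<Sum>i\<in>D. xs ! i)) =
      (\<Sum>D\<in>Pow {..<k}. \<Sum>js\<in>?L. if set js \<subseteq> D then (-1) ^ (k + card D) * ?F js else 0)"
    by (rule sum.cong) (auto simp: pD sum_distrib_left intro!: sum.cong)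
  also have "\<dots> = (\<Sum>js\<in>?L. \<Sum>D\<in>Pow {..<k}. if set js \<subseteq> D then (-1) ^ (k + card D) * ?F js else 0)"
    by (rule sum.swap)
  also have "\<dots> = (\<Sum>js\<in>?L. if set js = {..<k} then A xs else 0)"
  proof (rule sum.cong[OF refl])
    fix js assume js: "js \<in> ?L"
    have "(\<Sum>D\<in>Pow {..<k}. if set js \<subseteq> D then (-1) ^ (k + card D) * ?F js else 0)
        = (\<Sum>D\<in>{D \<in> Pow {..<k}. set js \<subseteq> D}. (-1) ^ (k + card D) * ?F js)"
      by (rule sum.inter_filter[symmetric]) simp
    also have "{D \<in> Pow {..<k}. set js \<subseteq> D} = {D. set js \<subseteq> D \<and> D \<subseteq> {..<k}}" by auto
    also have "(\<Sum>D | set js \<subseteq> D \<and> D \<subseteq> {..<k}. (-1) ^ (k + card D) * ?F js)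
        = (-1) ^ k * ?F js * (\<Sum>D | set js \<subseteq> D \<and> D \<subseteq> {..<k}. (-1) ^ card D)"
      by (simp add: sum_distrib_left power_add mult_ac)
    also have "\<dots> = (if set js = {..<k} then A xs else 0)"
    proof (cases "set js = {..<k}")
      case True
      have "{D. {..<k} \<subseteq> D \<and> D \<subseteq> {..<k}} = {{..<k}}" by auto
      moreover have "distinct js" using js True by (intro card_distinct) auto
      then have "mset js = mset [0..<k]" using True set_eq_iff_mset_eq_distinct[of js "[0..<k]"] by (simp add: atLeast0LessThan)
      then have "mset (map ((!) xs) js) = mset (map ((!) xs) [0..<length xs])"
        unfolding mset_map using xs by simp
      then have "mset xs = mset (map ((!) xs) js)" by (simp only: map_nth)
      then have "?F js = A xs" using sym[OF xs, of "map ((!) xs) js"] by argo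
      ultimately show ?thesis using True by (simp add: power_mult_distrib[symmetric])
    next
      case False
      then show ?thesis using js sum_supersets_alternating[of "{..<k}" "set js"] by auto
    qed
    finally show "(\<Sum>D\<in>Pow {..<k}. if set js \<subseteq> D then (-1) ^ (k + card D) * ?F js else 0)
        = (if set js = {..<k} then A xs else 0)" .
  qed
  also have "\<dots> = (\<Sum>js\<in>{js \<in> ?L. set js = {..<k}}. A xs)"
    by (rule sum.inter_filter[OF finL, symmetric])
  also have "{js \<in> ?L. set js = {..<k}} = list_perms k" by (auto simp: list_perms_def)
  finally show ?thesis by simp
qed

lemma sym_form_unique:
  assumes X: "normed_space X" and "sym_form_of k X p A" "sym_form_of k X p B"
    and "length xs = k" "set xs \<subseteq> car X"
  shows "A xs = B xs"
  using polarization[OF X assms(2,4,5)] polarization[OF X assms(3,4,5)] card_list_perms[of k]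
  by (metis mult_left_cancel of_nat_eq_0_iff neq0_conv)

definition bounded_form :: "nat \<Rightarrow> ('k::real_or_complex, 'v::ab_group_add) nspace \<Rightarrow> real \<Rightarrow> ('v list \<Rightarrow> 'k) \<Rightarrow> bool" where
  "bounded_form k X C A \<longleftrightarrow> multilinear_on k (smul X) (car X) A \<and> 0 \<le> C \<and>
     (\<forall>xs. length xs = k \<longrightarrow> set xs \<subseteq> car X \<longrightarrow> norm (A xs) \<le> C * prod_list (map (nrm X) xs))"

text \<open>
  The bound that the polarization identity gives for the symmetric form of a polynomial of norm one, on
  vectors of norm one.
\<close>

definition polarization_constant :: "nat \<Rightarrow> real" where
  "polarization_constant k = (\<Sum>D\<in>Pow {..<k}. real (card D) ^ k) / card (list_perms k)"

lemma polarization_constant_nonneg: "0 \<le> polarization_constant k"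
  by (auto simp: polarization_constant_def intro!: divide_nonneg_nonneg sum_nonneg)

lemma sym_form_bound_unit:
  assumes X: "normed_space X" and A: "sym_form_of k X p A" and C: "0 \<le> C"
    and p: "\<And>x. x \<in> car X \<Longrightarrow> norm (p x) \<le> C * nrm X x ^ k"
    and xs: "length xs = k" "set xs \<subseteq> car X" "\<And>x. x \<in> set xs \<Longrightarrow> nrm X x \<le> 1"
  shows "norm (A xs) \<le> C * polarization_constant k"
proof -
  have nth: "xs ! i \<in> car X" "nrm X (xs ! i) \<le> 1" if "i < k" for i
    using xs that nth_mem by blast+
  have "norm (of_nat (card (list_perms k)) * A xs)
      \<le> (\<Sum>D\<in>Pow {..<k}. C * real (card D) ^ k)"
    unfolding polarization[OF X A xs(1,2)]
  proof (rule sum_norm_le)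
    fix D assume D: "D \<in> Pow {..<k}"
    have s: "(\<Sum>i\<in>D. xs ! i) \<in> car X" using D nth by (intro ns_sum[OF X]) auto
    have "nrm X (\<Sum>i\<in>D. xs ! i) \<le> (\<Sum>i\<in>D. nrm X (xs ! i))"
      using D nth by (intro nrm_sum_le[OF X]) auto
    also have "\<dots> \<le> (\<Sum>i\<in>D. 1)" using D nth by (intro sum_mono) auto
    finally have "nrm X (\<Sum>i\<in>D. xs ! i) ^ k \<le> real (card D) ^ k"
      using nrm_nonneg[OF X s] by (intro power_mono) auto
    then have "C * nrm X (\<Sum>i\<in>D. xs ! i) ^ k \<le> C * real (card D) ^ k" by (rule mult_left_mono[OF _ C])
    then show "norm ((-1) ^ (k + card D) * p (\<Sum>i\<in>D. xs ! i)) \<le> C * real (card D) ^ k"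
      using p[OF s] by (simp add: norm_mult norm_power)
  qed
  then show ?thesis using card_list_perms[of k]
    by (simp add: norm_mult polarization_constant_def sum_distrib_left[symmetric] field_simps)
qed

lemma sym_form_bounded:
  assumes X: "normed_space X" and A: "sym_form_of k X p A" and C: "0 \<le> C"
    and p: "\<And>x. x \<in> car X \<Longrightarrow> norm (p x) \<le> C * nrm X x ^ k"
  shows "bounded_form k X (C * polarization_constant k) A"
  unfolding bounded_form_def
proof (intro conjI allI impI)
  interpret vector_space "smul X" by (rule ns_vector_space[OF X])
  show ml: "multilinear_on k (smul X) (car X) A" using A by (simp add: sym_form_of_def)
  show "0 \<le> C * polarization_constant k" using C polarization_constant_nonneg by simp
  fix xs assume xs: "length xs = k" "set xs \<subseteq> car X"
  define h where "h x = smul X (of_real (1 / nrm X x)) x" for x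
  have h: "h x \<in> car X" "nrm X (h x) \<le> 1" "smul X (of_real (nrm X x)) (h x) = x" if "x \<in> car X" for x
    using that nrm_nonneg[OF X that] nrm_eq_0[OF X that]
    by (auto simp: h_def ns_smul[OF X] nrm_smul[OF X] norm_divide)
  have "map (\<lambda>x. smul X (of_real (nrm X x)) (h x)) xs = xs"
    using h(3) xs(2) by (intro map_idI) auto
  then have "A xs = A ([] @ map (\<lambda>x. smul X (of_real (nrm X x)) (h x)) xs)" by simp
  also have "\<dots> = prod_list (map (\<lambda>x. of_real (nrm X x)) xs) * A ([] @ map h xs)"
    using ml xs h(1) by (intro multilinear_on_scale_all) (auto simp: ns_smul[OF X])
  finally have e: "norm (A xs) = norm (prod_list (map (\<lambda>x. of_real (nrm X x)) xs) :: 'a) * norm (A (map h xs))"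
    by (simp add: norm_mult)
  have n: "norm (prod_list (map (\<lambda>x. of_real (nrm X x)) xs) :: 'a) = prod_list (map (nrm X) xs)"
    using xs(2) by (induction xs) (auto simp: norm_mult nrm_nonneg[OF X])
  have "norm (A (map h xs)) \<le> C * polarization_constant k"
    using xs h by (intro sym_form_bound_unit[OF X A C p]) auto
  then have "prod_list (map (nrm X) xs) * norm (A (map h xs))
      \<le> prod_list (map (nrm X) xs) * (C * polarization_constant k)"
    using xs(2) nrm_nonneg[OF X] by (intro mult_left_mono prod_list_nonneg) auto
  then show "norm (A xs) \<le> C * polarization_constant k * prod_list (map (nrm X) xs)"
    unfolding e n by (simp add: mult.commute)
qed

section \<open>Symmetric tensors\<close>

text \<open>
  Tensors are functionals on the forms on the ambient space; a fixed projection onto the carrier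
  extends the forms on the carrier to such forms.
\<close>

definition car_proj :: "('k::real_or_complex, 'v::ab_group_add) nspace \<Rightarrow> 'v \<Rightarrow> 'v" where
  "car_proj X = (SOME pr. (\<forall>x y. pr (x + y) = pr x + pr y) \<and> (\<forall>c x. pr (smul X c x) = smul X c (pr x)) \<and>
     (\<forall>x. pr x \<in> car X) \<and> (\<forall>x\<in>car X. pr x = x))"

lemma
  assumes X: "normed_space X"
  shows car_proj_add: "car_proj X (x + y) = car_proj X x + car_proj X y"
    and car_proj_smul: "car_proj X (smul X c x) = smul X c (car_proj X x)"
    and car_proj_in: "car_proj X x \<in> car X"
    and car_proj_id: "x \<in> car X \<Longrightarrow> car_proj X x = x"
proof -
  have "\<exists>pr. (\<forall>x y. pr (x + y) = pr x + pr y) \<and> (\<forall>c x. pr (smul X c x) = smul X c (pr x)) \<and>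
     (\<forall>x. pr x \<in> car X) \<and> (\<forall>x\<in>car X. pr x = x)"
    by (rule linear_projection_onto[OF ns_vector_space[OF X] ns_subspace[OF X]]) blast
  from someI_ex[OF this] show "car_proj X (x + y) = car_proj X x + car_proj X y"
    "car_proj X (smul X c x) = smul X c (car_proj X x)" "car_proj X x \<in> car X"
    "x \<in> car X \<Longrightarrow> car_proj X x = x"
    unfolding car_proj_def[symmetric] by auto
qed

text \<open>The linear functional on tensors that corresponds to a multilinear form on the carrier of \<^term>\<open>X\<close>.\<close>

definition tform :: "('k::real_or_complex, 'v::ab_group_add) nspace \<Rightarrow> ('v list \<Rightarrow> 'k) \<Rightarrow>
    ('k, 'v) tensor \<Rightarrow> 'k" where
  "tform X A v = v (\<lambda>xs. A (map (car_proj X) xs))"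

lemma tform_add: "tform X A (v + w) = tform X A v + tform X A w"
  and tform_scale: "tform X A (fscale c v) = c * tform X A v"
  by (simp_all add: tform_def)

lemma tpow_apply: "tpow k s x B = (if multilinear_on k s UNIV B then B (replicate k x) else 0)"
  by (simp add: tpow_def tens_def)

lemma tsum_Nil [simp]: "tsum k s [] = 0"
  and tsum_Cons [simp]: "tsum k s ((c, x) # cs) = fscale c (tpow k s x) + tsum k s cs"
  by (simp_all add: tsum_def)

lemma tsum_append: "tsum k s (cs @ ds) = tsum k s cs + tsum k s ds"
  by (simp add: tsum_def)

lemma tsum_scale: "fscale a (tsum k s cs) = tsum k s (map (\<lambda>(c, x). (a * c, x)) cs)"
  by (induction cs) (auto simp: fun_eq_iff distrib_left mult.assoc)

lemma tsum_apply: "multilinear_on k s UNIV B \<Longrightarrow> tsum k s cs B = (\<Sum>(c, x)\<leftarrow>cs. c * B (replicate k x))"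
  "\<not> multilinear_on k s UNIV B \<Longrightarrow> tsum k s cs B = 0"
  by (induction cs) (auto simp: tpow_apply)

lemma tform_multilinear:
  assumes X: "normed_space X" and A: "multilinear_on k (smul X) (car X) A"
  shows "multilinear_on k (smul X) UNIV (\<lambda>xs. A (map (car_proj X) xs))"
  by (rule multilinear_on_pullback[OF A]) (simp_all add: car_proj_add[OF X] car_proj_smul[OF X] car_proj_in[OF X])

lemma tform_tsum:
  assumes X: "normed_space X" and A: "multilinear_on k (smul X) (car X) A" and cs: "represents k X cs v"
  shows "tform X A v = (\<Sum>(c, x)\<leftarrow>cs. c * A (replicate k x))"
proof -
  have v: "v = tsum k (smul X) cs" and "snd ` set cs \<subseteq> car X" using cs by (auto simp: represents_def)
  then have "map (\<lambda>(c, x). c * A (replicate k (car_proj X x))) cs = map (\<lambda>(c, x). c * A (replicate k x)) cs"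
    using car_proj_id[OF X] by (auto simp: image_subset_iff)
  then show ?thesis unfolding v tform_def tsum_apply(1)[OF tform_multilinear[OF X A]] map_replicate
    by metis
qed

lemma mem_sym_tensors_iff:
  fixes X :: "('k::real_or_complex, 'v::ab_group_add) nspace"
  shows "v \<in> sym_tensors k X \<longleftrightarrow> (\<exists>cs. represents k X cs v)"
proof -
  interpret vector_space "fscale :: 'k \<Rightarrow> ('k, 'v) tensor \<Rightarrow> ('k, 'v) tensor"
    by (rule vector_space_fscale)
  show ?thesis
  proof
    have "subspace {v. \<exists>cs. represents k X cs v}"
    proof (rule subspaceI; clarsimp)
      show "\<exists>cs. represents k X cs 0" by (rule exI[of _ "[]"]) (simp add: represents_def)
      show "\<exists>cs. represents k X cs (v + w)" if "represents k X cs v" "represents k X ds w" for v w cs ds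
        using that by (intro exI[of _ "cs @ ds"]) (auto simp: represents_def tsum_append)
      show "\<exists>ds. represents k X ds (fscale a v)" if "represents k X cs v" for v cs a
      proof -
        show ?thesis using that tsum_scale
          by (intro exI[of _ "map (\<lambda>(c, x). (a * c, x)) cs"]) (auto simp: represents_def)
      qed
    qed
    moreover have "tpow k (smul X) ` car X \<subseteq> {v. \<exists>cs. represents k X cs v}"
    proof clarify
      fix x assume "x \<in> car X"
      then show "\<exists>cs. represents k X cs (tpow k (smul X) x)"
        by (intro exI[of _ "[(1, x)]"]) (auto simp: represents_def)
    qed
    ultimately show "v \<in> sym_tensors k X \<Longrightarrow> \<exists>cs. represents k X cs v"
      unfolding sym_tensors_def using span_minimal by blast
  next
    have b: "tpow k (smul X) x \<in> span (tpow k (smul X) ` car X)" if "x \<in> car X" for x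
      using that by (intro span_base imageI)
    have "tsum k (smul X) cs \<in> span (tpow k (smul X) ` car X)" if "snd ` set cs \<subseteq> car X" for cs
      using that
      by (induction cs) (auto intro!: span_zero span_add span_scale b)
    then show "\<exists>cs. represents k X cs v \<Longrightarrow> v \<in> sym_tensors k X"
      by (auto simp: represents_def sym_tensors_def)
  qed
qed

lemma tpow_sym_tensors: "x \<in> car X \<Longrightarrow> tpow k (smul X) x \<in> sym_tensors k X"
  unfolding mem_sym_tensors_iff represents_def by (intro exI[of _ "[(1, x)]"]) auto

lemma subspace_sym_tensors: "module.subspace fscale (sym_tensors k X)"
proof -
  interpret vector_space "fscale :: 'a \<Rightarrow> ('a, 'b) tensor \<Rightarrow> ('a, 'b) tensor"
    by (rule vector_space_fscale)
  show ?thesis unfolding sym_tensors_def by (rule subspace_span)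
qed

lemma represents_restr: "M \<subseteq> car X \<Longrightarrow> represents k (restr X M) cs v \<Longrightarrow> represents k X cs v"
  by (auto simp: represents_def)

lemma represents_map:
  assumes "lin_op X Y T" "represents k X cs v"
  shows "represents k Y (map (\<lambda>(c, x). (c, T x)) cs) (tsum k (smul Y) (map (\<lambda>(c, x). (c, T x)) cs))"
  using assms lin_op_in[OF assms(1)] by (fastforce simp: represents_def)

text \<open>
  The value of the right hand side at a form \<open>B\<close> is the value of \<open>v\<close> at the pullback of \<open>B\<close> along \<open>T\<close>, and does
  not depend on the representation \<open>cs\<close> of \<open>v\<close>.
\<close>

lemma sym_tensor_map_eq:
  assumes X: "normed_space X" and Y: "normed_space Y" and T: "lin_op X Y T" and cs: "represents k X cs v"
  shows "sym_tensor_map k X Y T v = tsum k (smul Y) (map (\<lambda>(c, x). (c, T x)) cs)"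
  unfolding sym_tensor_map_def
proof (rule the_equality)
  show "\<exists>ds. represents k X ds v \<and> tsum k (smul Y) (map (\<lambda>(c, x). (c, T x)) cs)
      = tsum k (smul Y) (map (\<lambda>(c, x). (c, T x)) ds)" using cs by blast
  fix w assume "\<exists>ds. represents k X ds v \<and> w = tsum k (smul Y) (map (\<lambda>(c, x). (c, T x)) ds)"
  then obtain ds where ds: "represents k X ds v" "w = tsum k (smul Y) (map (\<lambda>(c, x). (c, T x)) ds)" by blast
  show "w = tsum k (smul Y) (map (\<lambda>(c, x). (c, T x)) cs)"
  proof
    fix B
    show "w B = tsum k (smul Y) (map (\<lambda>(c, x). (c, T x)) cs) B"
    proof (cases "multilinear_on k (smul Y) UNIV B")
      case True
      have ml: "multilinear_on k (smul X) (car X) (\<lambda>xs. B (map T xs))"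
        by (rule multilinear_on_pullback[OF True]) (use T in \<open>auto simp: lin_op_add lin_op_smul\<close>)
      have "tsum k (smul Y) (map (\<lambda>(c, x). (c, T x)) es) B = tform X (\<lambda>xs. B (map T xs)) v"
        if "represents k X es v" for es
        unfolding tform_tsum[OF X ml that] tsum_apply(1)[OF True]
        by (simp add: o_def case_prod_unfold)
      then show ?thesis using ds cs by simp
    next
      case False
      then show ?thesis by (simp add: ds tsum_apply(2))
    qed
  qed
qed

lemma sym_tensor_map_in:
  assumes X: "normed_space X" and Y: "normed_space Y" and T: "lin_op X Y T" and v: "v \<in> sym_tensors k X"
  shows "sym_tensor_map k X Y T v \<in> sym_tensors k Y"
proof -
  obtain cs where cs: "represents k X cs v" using v mem_sym_tensors_iff by blast
  show ?thesis
    unfolding sym_tensor_map_eq[OF X Y T cs] mem_sym_tensors_iff using represents_map[OF T cs] by blast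
qed

lemma sym_tensor_map_linear:
  assumes X: "normed_space X" and Y: "normed_space Y" and T: "lin_op X Y T" and v: "v \<in> sym_tensors k X"
  shows "w \<in> sym_tensors k X \<Longrightarrow>
      sym_tensor_map k X Y T (v + w) = sym_tensor_map k X Y T v + sym_tensor_map k X Y T w"
    and "sym_tensor_map k X Y T (fscale a v) = fscale a (sym_tensor_map k X Y T v)"
proof -
  obtain cs where cs: "represents k X cs v" using v mem_sym_tensors_iff[of v k X] by auto
  note eq = sym_tensor_map_eq[OF X Y T]
  show "sym_tensor_map k X Y T (v + w) = sym_tensor_map k X Y T v + sym_tensor_map k X Y T w"
    if w: "w \<in> sym_tensors k X"
  proof -
    obtain ds where ds: "represents k X ds w" using w mem_sym_tensors_iff[of w k X] by auto
    have "represents k X (cs @ ds) (v + w)" using cs ds by (auto simp: represents_def tsum_append)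
    then show ?thesis by (simp only: eq eq[OF cs] eq[OF ds] map_append tsum_append)
  qed
  have "represents k X (map (\<lambda>(c, x). (a * c, x)) cs) (fscale a v)"
    using cs by (auto simp: represents_def tsum_scale)
  from eq[OF this]
  show "sym_tensor_map k X Y T (fscale a v) = fscale a (sym_tensor_map k X Y T v)"
    unfolding eq[OF cs] tsum_scale by (simp add: o_def case_prod_unfold)
qed

lemma tens_add:
  "tens s (xs @ (x + y) # ys) = tens s (xs @ x # ys) + tens s (xs @ y # ys)"
  and tens_scale: "tens s (xs @ s c x # ys) = fscale c (tens s (xs @ x # ys))"
  by (auto simp: tens_def fun_eq_iff multilinear_on_add[OF _ refl] multilinear_on_scale[OF _ refl]
      intro: multilinear_on_add multilinear_on_scale)

text \<open>
  The average over all permutations of the arguments. Each permuted list contains a given argument in exactly one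
  slot, which makes the average multilinear.
\<close>

lemma symmetrization:
  fixes A :: "'v::ab_group_add list \<Rightarrow> 'k::real_or_complex"
  assumes A: "multilinear_on k s S A"
  shows "\<exists>B. multilinear_on k s S B \<and>
     (\<forall>xs ys. length xs = k \<longrightarrow> mset xs = mset ys \<longrightarrow> B xs = B ys) \<and>
     (\<forall>x. B (replicate k x) = A (replicate k x))"
proof -
  define P where "P = {\<pi>. \<pi> permutes {..<k}}"
  have finP: "finite P" "card P > 0" by (auto simp: P_def card_permutations finite_permutations)
  define B where "B xs = (\<Sum>\<pi>\<in>P. A (permute_list \<pi> xs)) / of_nat (card P)" for xs
  have key: "\<exists>us vs. length us + length vs + 1 = k \<and> set us \<subseteq> set (xs @ ys) \<and> set vs \<subseteq> set (xs @ ys) \<and>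
      (\<forall>z. permute_list \<pi> (xs @ z # ys) = us @ z # vs)"
    if \<pi>: "\<pi> \<in> P" and l: "length xs + length ys + 1 = k" for \<pi> and xs ys :: "'v list"
  proof -
    have perm: "\<pi> permutes {..<k}" using \<pi> by (simp add: P_def)
    define n where "n = length xs"
    define i where "i = inv \<pi> n"
    have n: "n < k" using l by (simp add: n_def)
    have i: "i < k" "\<pi> i = n"
      using permutes_in_image[OF permutes_inv[OF perm], of n] n permutes_inverses[OF perm]
      by (auto simp: i_def)
    have ne: "\<pi> m \<noteq> n" if "m \<noteq> i" for m using that i permutes_inj[OF perm] by (auto dest: injD)
    have lt: "\<pi> m < k" if "m < k" for m using permutes_in_image[OF perm, of m] that by auto
    let ?g = "\<lambda>m. (xs @ ys) ! (if m < n then m else m - 1)"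
    have g: "(xs @ z # ys) ! m = ?g m" if "m < k" "m \<noteq> n" for m z
      using that l by (auto simp: nth_append n_def nth_Cons' Suc_diff_Suc)
    have gin: "?g m \<in> set (xs @ ys)" if "m < k" "m \<noteq> n" for m
      by (rule nth_mem) (use that l in \<open>auto simp: n_def\<close>)
    have split: "[0..<k] = [0..<i] @ i # [Suc i..<k]"
      using i(1) upt_add_eq_append[of 0 i "k - i"] by (simp add: upt_conv_Cons)
    show ?thesis
    proof (intro exI conjI allI)
      show "length (map (\<lambda>m. ?g (\<pi> m)) [0..<i]) + length (map (\<lambda>m. ?g (\<pi> m)) [Suc i..<k]) + 1 = k"
        using i by simp
      show "set (map (\<lambda>m. ?g (\<pi> m)) [0..<i]) \<subseteq> set (xs @ ys)"
        "set (map (\<lambda>m. ?g (\<pi> m)) [Suc i..<k]) \<subseteq> set (xs @ ys)"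
        using gin ne lt i(1) by (auto simp del: set_append)
      fix z
      have "permute_list \<pi> (xs @ z # ys) = map (\<lambda>m. (xs @ z # ys) ! \<pi> m) [0..<k]"
        using l by (simp add: permute_list_def)
      also have "\<dots> = map (\<lambda>m. (xs @ z # ys) ! \<pi> m) [0..<i] @ (xs @ z # ys) ! \<pi> i
          # map (\<lambda>m. (xs @ z # ys) ! \<pi> m) [Suc i..<k]" by (simp add: split)
      also have "(xs @ z # ys) ! \<pi> i = z" using i by (simp add: n_def nth_append)
      also have "map (\<lambda>m. (xs @ z # ys) ! \<pi> m) [0..<i] = map (\<lambda>m. ?g (\<pi> m)) [0..<i]"
        using g ne lt i(1) by (intro map_cong) auto
      also have "map (\<lambda>m. (xs @ z # ys) ! \<pi> m) [Suc i..<k] = map (\<lambda>m. ?g (\<pi> m)) [Suc i..<k]"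
        using g ne lt i(1) by (intro map_cong) auto
      finally show "permute_list \<pi> (xs @ z # ys) =
          map (\<lambda>m. ?g (\<pi> m)) [0..<i] @ z # map (\<lambda>m. ?g (\<pi> m)) [Suc i..<k]" .
    qed
  qed
  have ml: "multilinear_on k s S B"
    unfolding multilinear_on_def
  proof (intro allI impI conjI ballI)
    fix xs ys x y c
    assume l: "length xs + length ys + 1 = k" and S: "set xs \<subseteq> S" "set ys \<subseteq> S" and x: "x \<in> S"
    show "B (xs @ (x + y) # ys) = B (xs @ x # ys) + B (xs @ y # ys)" if y: "y \<in> S"
    proof -
      have "A (permute_list \<pi> (xs @ (x + y) # ys)) =
          A (permute_list \<pi> (xs @ x # ys)) + A (permute_list \<pi> (xs @ y # ys))" if \<pi>: "\<pi> \<in> P" for \<pi>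
      proof -
        obtain us vs where u: "length us + length vs + 1 = k" "set us \<subseteq> S" "set vs \<subseteq> S"
          "\<And>z. permute_list \<pi> (xs @ z # ys) = us @ z # vs" using key[OF \<pi> l] S by force
        show ?thesis unfolding u(4) by (rule multilinear_on_add[OF A u(1-3) x y])
      qed
      then show ?thesis by (simp add: B_def sum.distrib add_divide_distrib)
    qed
    have "A (permute_list \<pi> (xs @ s c x # ys)) = c * A (permute_list \<pi> (xs @ x # ys))" if \<pi>: "\<pi> \<in> P" for \<pi>
    proof -
      obtain us vs where u: "length us + length vs + 1 = k" "set us \<subseteq> S" "set vs \<subseteq> S"
        "\<And>z. permute_list \<pi> (xs @ z # ys) = us @ z # vs" using key[OF \<pi> l] S by force
      show ?thesis unfolding u(4) by (rule multilinear_on_scale[OF A u(1-3) x])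
    qed
    then show "B (xs @ s c x # ys) = c * B (xs @ x # ys)"
      by (simp add: B_def sum_distrib_left)
  qed
  moreover have "B xs = B ys" if l: "length xs = k" and m: "mset xs = mset ys" for xs ys
  proof -
    have ly: "length ys = k" using l m mset_eq_length by metis
    obtain \<sigma> where \<sigma>: "\<sigma> permutes {..<length ys}" "permute_list \<sigma> ys = xs"
      using mset_eq_permutation[OF m] by blast
    have \<sigma>k: "\<sigma> permutes {..<k}" using \<sigma> ly by simp
    have "(\<Sum>\<pi>\<in>P. A (permute_list \<pi> xs)) = (\<Sum>\<pi>\<in>P. A (permute_list (\<sigma> \<circ> \<pi>) ys))"
      using permute_list_compose[of _ ys \<sigma>] ly \<sigma>(2) by (intro sum.cong) (auto simp: P_def)
    also have "\<dots> = (\<Sum>\<pi>\<in>P. A (permute_list \<pi> ys))"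
      unfolding P_def by (rule setum_permutations_compose_left[OF \<sigma>k, symmetric])
    finally show ?thesis by (simp add: B_def)
  qed
  moreover have "B (replicate k x) = A (replicate k x)" for x
  proof -
    have "permute_list \<pi> (replicate k x) = replicate k x" if "\<pi> \<in> P" for \<pi>
    proof (rule replicate_eqI)
      show "length (permute_list \<pi> (replicate k x)) = k" by simp
      show "y = x" if "y \<in> set (permute_list \<pi> (replicate k x))" for y
        using that \<open>\<pi> \<in> P\<close> by (simp add: set_permute_list P_def split: if_splits)
    qed
    then show ?thesis using finP by (cases "P = {}") (simp_all add: B_def)
  qed
  ultimately show ?thesis by blast
qed

text \<open>
  A functional on the symmetric tensors extends to all tensors by a projection. The extension, evaluated at
  elementary tensors, is a multilinear form with the right diagonal, which symmetrization preserves.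
\<close>

lemma sym_form_exists:
  fixes X :: "('k::real_or_complex, 'v::ab_group_add) nspace"
  assumes f: "\<And>v w. v \<in> sym_tensors k X \<Longrightarrow> w \<in> sym_tensors k X \<Longrightarrow> f (v + w) = f v + f w"
    "\<And>c v. v \<in> sym_tensors k X \<Longrightarrow> f (fscale c v) = c * f v"
  shows "\<exists>A. sym_form_of k X (\<lambda>x. f (tpow k (smul X) x)) A"
proof -
  obtain pr :: "('k, 'v) tensor \<Rightarrow> ('k, 'v) tensor" where pr: "\<And>x y. pr (x + y) = pr x + pr y"
    "\<And>c x. pr (fscale c x) = fscale c (pr x)" "\<And>x. pr x \<in> sym_tensors k X"
    "\<And>x. x \<in> sym_tensors k X \<Longrightarrow> pr x = x"
    using linear_projection_onto[OF vector_space_fscale subspace_sym_tensors[of k X]] by blast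
  define A where "A xs = f (pr (tens (smul X) xs))" for xs
  have "multilinear_on k (smul X) (car X) A"
    unfolding multilinear_on_def A_def by (simp add: tens_add tens_scale pr f)
  from symmetrization[OF this] obtain B where B: "multilinear_on k (smul X) (car X) B"
    "\<forall>xs ys. length xs = k \<longrightarrow> mset xs = mset ys \<longrightarrow> B xs = B ys"
    "\<forall>x. B (replicate k x) = A (replicate k x)" by blast
  have "A (replicate k x) = f (tpow k (smul X) x)" if "x \<in> car X" for x
    using pr(4)[OF tpow_sym_tensors[OF that]] by (simp add: A_def tpow_def)
  then show ?thesis using B by (intro exI[of _ B]) (auto simp: sym_form_of_def)
qed

section \<open>The Aron-Berner extension\<close>

lemma lin_op_zero_op: "normed_space Y \<Longrightarrow> lin_op X Y (\<lambda>x. 0)"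
  using module.scale_zero_right[OF ns_module] by (fastforce simp: lin_op_def ns_zero)

lemma canon_zero: "normed_space X \<Longrightarrow> canon X 0 = 0"
  using lin_op_zero[OF _ lin_op_canon] by blast

lemma finite_frame_scalars: "finite_frame scalars 1 (\<lambda>_. 1) (\<lambda>_ x. (x :: 'k::real_or_complex))"
  by (auto simp: finite_frame_def mem_dual_iff bdd_op_def lin_op_def intro!: exI[of _ 1])

text \<open>
  Local reflexivity for the operators from the scalars into \<open>X\<close>.
\<close>

lemma weak_star_density:
  fixes X :: "('k::real_or_complex, 'v::ab_group_add) nspace"
  assumes X: "normed_space X" and z: "z \<in> car (bidual X)"
    and \<Phi>: "finite \<Phi>" "\<Phi> \<subseteq> car (dual X)" and \<delta>: "\<delta> > 0"
  shows "\<exists>x\<in>car X. \<forall>\<phi>\<in>\<Phi>. norm (\<phi> x - z \<phi>) < \<delta>"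
proof -
  let ?S = "scalars :: ('k, 'k) nspace"
  have "\<exists>x. (\<forall>j<(1::nat). x j \<in> car X) \<and>
    (\<forall>m\<in>car ?S. nrm X (0 + (\<Sum>j<(1::nat). smul X m (x j))) \<le> (nrm (bidual X) z + 1) * nrm ?S m) \<and>
    (\<forall>j<(1::nat). \<forall>\<phi>\<in>\<Phi>. norm (\<phi> (x j) - z \<phi>) < \<delta>)"
  proof (rule local_reflexivity[OF normed_space_scalars finite_frame_scalars X
        lin_op_zero_op[OF X] _ _ _ _ _ \<Phi> \<delta>, where K = "nrm (bidual X) z"])
    show "0 \<le> nrm (bidual X) z" by (rule nrm_nonneg[OF normed_space_bidual[OF X] z])
    show "(\<lambda>x. x) \<in> car (dual ?S)" using finite_frame_scalars by (simp add: finite_frame_def)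
    show "nrm (bidual X) (canon X 0 + (\<Sum>j<(1::nat). fscale m z)) \<le> nrm (bidual X) z * nrm ?S m" for m
      using nrm_smul[OF normed_space_bidual[OF X] z, of m] by (simp add: canon_zero[OF X] mult.commute)
  qed (use z in auto)
  then show ?thesis by auto
qed

text \<open>
  Convergence holds by the definition of the filter; weak* density makes the filter proper and the limit unique.
\<close>

lemma wstar_nhds_lim:
  assumes X: "normed_space X" and z: "z \<in> car (bidual X)" and \<phi>: "\<phi> \<in> car (dual X)"
    and g: "\<And>x. x \<in> car X \<Longrightarrow> g x = \<phi> x"
  shows "Lim (wstar_nhds X z) g = z \<phi>"
proof (rule tendsto_Lim)
  show "wstar_nhds X z \<noteq> bot"
    unfolding wstar_nhds_def
  proof (rule INF_filter_not_bot)
    fix Q assume Q: "Q \<subseteq> car (dual X) \<times> {0::real<..}" "finite Q"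
    define \<delta> where "\<delta> = Min (insert 1 (snd ` Q))"
    have \<delta>: "\<delta> > 0" "\<And>q. q \<in> Q \<Longrightarrow> \<delta> \<le> snd q" using Q by (auto simp: \<delta>_def)
    have "fst q \<in> car (dual X)" if "q \<in> Q" for q
      using subsetD[OF Q(1) that] by (simp add: mem_Times_iff)
    then have "finite (fst ` Q)" "fst ` Q \<subseteq> car (dual X)"
      using finite_imageI[OF Q(2), of fst] by (simp_all add: image_subset_iff)
    from weak_star_density[OF X z this \<delta>(1)]
    obtain x where x: "x \<in> car X" "\<forall>\<psi>\<in>fst ` Q. norm (\<psi> x - z \<psi>) < \<delta>" by blast
    have "norm (fst q x - z (fst q)) < snd q" if "q \<in> Q" for q
      using x(2) \<delta>(2)[OF that] that by fastforce
    then have ne: "(\<Inter>q\<in>Q. {x \<in> car X. norm (fst q x - z (fst q)) < snd q}) \<noteq> {}"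
      using x(1) by blast
    have "(INF q\<in>Q. case q of (\<psi>, e) \<Rightarrow> principal {x \<in> car X. norm (\<psi> x - z \<psi>) < e})
        = principal (\<Inter>q\<in>Q. {x \<in> car X. norm (fst q x - z (fst q)) < snd q})"
      unfolding INF_principal_finite[OF Q(2), symmetric] by (simp only: case_prod_unfold)
    then show "(INF q\<in>Q. case q of (\<psi>, e) \<Rightarrow> principal {x \<in> car X. norm (\<psi> x - z \<psi>) < e}) \<noteq> bot"
      using ne by (simp only: principal_eq_bot_iff not_False_eq_True)
  qed
  show "(g \<longlongrightarrow> z \<phi>) (wstar_nhds X z)"
  proof (rule tendstoI)
    fix e :: real assume e: "e > 0"
    show "\<forall>\<^sub>F x in wstar_nhds X z. dist (g x) (z \<phi>) < e"
      unfolding wstar_nhds_def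
      by (rule eventually_INF1[of "(\<phi>, e)"]) (use e \<phi> g in \<open>auto simp: eventually_principal dist_norm\<close>)
  qed
qed

lemma bounded_formD:
  assumes "bounded_form k X C A"
  shows "multilinear_on k (smul X) (car X) A" "0 \<le> C"
    "length xs = k \<Longrightarrow> set xs \<subseteq> car X \<Longrightarrow> norm (A xs) \<le> C * prod_list (map (nrm X) xs)"
  using assms by (auto simp: bounded_form_def)

lemma bounded_form_Cons:
  assumes X: "normed_space X" and A: "bounded_form (Suc k) X C A" and x: "x \<in> car X"
  shows "bounded_form k X (C * nrm X x) (\<lambda>xs. A (x # xs))"
  unfolding bounded_form_def
  using multilinear_on_Cons[OF bounded_formD(1)[OF A] x] bounded_formD(2)[OF A]
    bounded_formD(3)[OF A, of "x # _"] x nrm_nonneg[OF X x]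
  by (auto simp: mult.assoc)

text \<open>
  The iterated limit over the remaining slots as a function of the first argument. It is a bounded functional,
  whence the outermost limit along a net that tends weak* to \<open>z\<close> is the value of \<open>z\<close> at it.
\<close>

definition first_slot :: "('k::real_or_complex, 'v::ab_group_add) nspace \<Rightarrow> (('v \<Rightarrow> 'k) \<Rightarrow> 'k) list \<Rightarrow>
    ('v list \<Rightarrow> 'k) \<Rightarrow> 'v \<Rightarrow> 'k" where
  "first_slot X zs A = zero_off (car X) (\<lambda>x. iter_lim X zs (\<lambda>xs. A (x # xs)))"

lemma iter_lim_Cons:
  assumes "normed_space X" "z \<in> car (bidual X)" "first_slot X zs A \<in> car (dual X)"
  shows "iter_lim X (z # zs) A = z (first_slot X zs A)"
  using wstar_nhds_lim[OF assms, of "\<lambda>x. iter_lim X zs (\<lambda>xs. A (x # xs))"]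
  by (simp add: first_slot_def)

text \<open>
  One induction proves all parts: the bound and the linearity in the form make \<open>first_slot X zs A\<close> a bounded
  functional, so that the next limit is a value of an element of the bidual, hence again bounded and linear.
\<close>

lemma iter_lim_bounded_linear:
  assumes X: "normed_space X"
  shows "set zs \<subseteq> car (bidual X) \<Longrightarrow> bounded_form (length zs) X C A \<Longrightarrow>
      norm (iter_lim X zs A) \<le> C * prod_list (map (nrm (bidual X)) zs)"
    and "set zs \<subseteq> car (bidual X) \<Longrightarrow> bounded_form (length zs) X C A \<Longrightarrow>
      bounded_form (length zs) X C1 A1 \<Longrightarrow> bounded_form (length zs) X C2 A2 \<Longrightarrow>
      (\<And>xs. length xs = length zs \<Longrightarrow> set xs \<subseteq> car X \<Longrightarrow> A xs = A1 xs + c * A2 xs) \<Longrightarrow>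
      iter_lim X zs A = iter_lim X zs A1 + c * iter_lim X zs A2"
    and "set zs \<subseteq> car (bidual X) \<Longrightarrow> bounded_form (Suc (length zs)) X C A \<Longrightarrow>
      first_slot X zs A \<in> car (dual X) \<and>
      op_norm X scalars (first_slot X zs A) \<le> C * prod_list (map (nrm (bidual X)) zs)"
proof -
  let ?B = "\<lambda>zs. \<forall>C A. bounded_form (length zs) X C A \<longrightarrow>
    norm (iter_lim X zs A) \<le> C * prod_list (map (nrm (bidual X)) zs)"
  let ?L = "\<lambda>zs. \<forall>C A C1 A1 C2 A2 c. bounded_form (length zs) X C A \<longrightarrow> bounded_form (length zs) X C1 A1 \<longrightarrow>
        bounded_form (length zs) X C2 A2 \<longrightarrow>
        (\<forall>xs. length xs = length zs \<longrightarrow> set xs \<subseteq> car X \<longrightarrow> A xs = A1 xs + c * A2 xs) \<longrightarrow>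
        iter_lim X zs A = iter_lim X zs A1 + c * iter_lim X zs A2"
  let ?F = "\<lambda>zs. \<forall>C A. bounded_form (Suc (length zs)) X C A \<longrightarrow> first_slot X zs A \<in> car (dual X) \<and>
        op_norm X scalars (first_slot X zs A) \<le> C * prod_list (map (nrm (bidual X)) zs)"
  have nn: "0 \<le> prod_list (map (nrm (bidual X)) zs)" if "set zs \<subseteq> car (bidual X)" for zs
    using that nrm_nonneg[OF normed_space_bidual[OF X]] by (intro prod_list_nonneg) auto
  have F: "?F zs" if zs: "set zs \<subseteq> car (bidual X)" and B: "?B zs" and L: "?L zs" for zs
  proof (intro allI impI)
    fix C and A :: "'b list \<Rightarrow> 'a" assume A: "bounded_form (Suc (length zs)) X C A"
    let ?f = "\<lambda>x. iter_lim X zs (\<lambda>xs. A (x # xs))"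
    note ml = bounded_formD(1)[OF A] and bf = bounded_form_Cons[OF X A]
    show "first_slot X zs A \<in> car (dual X) \<and>
        op_norm X scalars (first_slot X zs A) \<le> C * prod_list (map (nrm (bidual X)) zs)"
      unfolding first_slot_def
    proof (intro conjI zero_off_dual[OF X])
      show "0 \<le> C * prod_list (map (nrm (bidual X)) zs)"
        using bounded_formD(2)[OF A] nn[OF zs] by simp
      then show "0 \<le> C * prod_list (map (nrm (bidual X)) zs)" .
      show b: "norm (?f x) \<le> C * prod_list (map (nrm (bidual X)) zs) * nrm X x" if "x \<in> car X" for x
        using B[rule_format, OF bf[OF that]] by (simp add: mult_ac)
      then show "norm (?f x) \<le> C * prod_list (map (nrm (bidual X)) zs) * nrm X x" if "x \<in> car X" for x
        using that .
      show a: "?f (x + y) = ?f x + ?f y" if x: "x \<in> car X" and y: "y \<in> car X" for x y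
      proof -
        have "A ((x + y) # xs) = A (x # xs) + 1 * A (y # xs)" if "length xs = length zs" "set xs \<subseteq> car X" for xs
          using multilinear_on_add[OF ml, of "[]" xs x y] that x y by simp
        from L[rule_format, OF bf[OF ns_add[OF X x y]] bf[OF x] bf[OF y] this]
        show ?thesis by simp
      qed
      then show "?f (x + y) = ?f x + ?f y" if x: "x \<in> car X" and y: "y \<in> car X" for x y
        using that .
      show s: "?f (smul X c x) = c * ?f x" if x: "x \<in> car X" for c x
      proof -
        \<comment> \<open>Homogeneity is the linearity in the form for the coefficients \<open>1\<close> and \<open>c - 1\<close> of one and the same form.\<close>
        have "A (smul X c x # xs) = A (x # xs) + (c - 1) * A (x # xs)"
          if "length xs = length zs" "set xs \<subseteq> car X" for xs
          using multilinear_on_scale[OF ml, of "[]" xs x c] that x by (simp add: algebra_simps)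
        from L[rule_format, OF bf[OF ns_smul[OF X x]] bf[OF x] bf[OF x] this]
        show ?thesis by (simp add: algebra_simps)
      qed
      then show "?f (smul X c x) = c * ?f x" if x: "x \<in> car X" for c x
        using that .
    qed
  qed
  have main: "set zs \<subseteq> car (bidual X) \<Longrightarrow> ?B zs \<and> ?L zs" for zs
  proof (induction zs)
    case Nil
    show ?case using bounded_formD(3)[of 0 X _ _ "[]"] by simp
  next
    case (Cons z zs)
    then have z: "z \<in> car (bidual X)" and zs: "set zs \<subseteq> car (bidual X)" and IH: "?B zs" "?L zs" by auto
    note F = F[OF zs IH, rule_format]
    have step: "iter_lim X (z # zs) A = z (first_slot X zs A)"
      if "bounded_form (length (z # zs)) X C A" for C A
      using iter_lim_Cons[OF X z] F that by simp
    have "?B (z # zs)"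
    proof (intro allI impI)
      fix C and A :: "'b list \<Rightarrow> 'a" assume A: "bounded_form (length (z # zs)) X C A"
      then have f: "first_slot X zs A \<in> car (dual X)"
        "op_norm X scalars (first_slot X zs A) \<le> C * prod_list (map (nrm (bidual X)) zs)"
        using F[of C A] by auto
      have "norm (z (first_slot X zs A)) \<le> nrm (bidual X) z * op_norm X scalars (first_slot X zs A)"
        using dual_bound[OF normed_space_dual[OF X] z f(1)] by simp
      also have "\<dots> \<le> nrm (bidual X) z * (C * prod_list (map (nrm (bidual X)) zs))"
        by (intro mult_left_mono f nrm_nonneg[OF normed_space_bidual[OF X] z])
      finally show "norm (iter_lim X (z # zs) A) \<le> C * prod_list (map (nrm (bidual X)) (z # zs))"
        unfolding step[OF A] by (simp add: mult_ac)
    qed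
    moreover have "?L (z # zs)"
    proof (intro allI impI)
      fix C C1 C2 c and A A1 A2 :: "'b list \<Rightarrow> 'a"
      assume A: "bounded_form (length (z # zs)) X C A" "bounded_form (length (z # zs)) X C1 A1"
        "bounded_form (length (z # zs)) X C2 A2"
        and eq: "\<forall>xs. length xs = length (z # zs) \<longrightarrow> set xs \<subseteq> car X \<longrightarrow> A xs = A1 xs + c * A2 xs"
      have f: "first_slot X zs A \<in> car (dual X)" "first_slot X zs A1 \<in> car (dual X)"
        "first_slot X zs A2 \<in> car (dual X)" using A F by auto
      have "first_slot X zs A = first_slot X zs A1 + fscale c (first_slot X zs A2)"
      proof (rule dual_eqI[OF f(1)])
        show "first_slot X zs A1 + fscale c (first_slot X zs A2) \<in> car (dual X)"
          using f ns_add[OF normed_space_dual[OF X]] ns_smul[OF normed_space_dual[OF X]] by simp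
        fix x assume x: "x \<in> car X"
        have bf: "bounded_form (length zs) X (C * nrm X x) (\<lambda>xs. A (x # xs))"
          "bounded_form (length zs) X (C1 * nrm X x) (\<lambda>xs. A1 (x # xs))"
          "bounded_form (length zs) X (C2 * nrm X x) (\<lambda>xs. A2 (x # xs))"
          using A bounded_form_Cons[OF X _ x] by auto
        have "A (x # xs) = A1 (x # xs) + c * A2 (x # xs)" if "length xs = length zs" "set xs \<subseteq> car X" for xs
          using eq x that by simp
        from IH(2)[rule_format, OF bf this]
        show "first_slot X zs A x = (first_slot X zs A1 + fscale c (first_slot X zs A2)) x"
          using x by (simp add: first_slot_def)
      qed
      then show "iter_lim X (z # zs) A = iter_lim X (z # zs) A1 + c * iter_lim X (z # zs) A2"
        unfolding step[OF A(1)] step[OF A(2)] step[OF A(3)]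
        using dual_add[OF z f(2), of "fscale c (first_slot X zs A2)"] dual_smul[OF z f(3), of c]
          ns_smul[OF normed_space_dual[OF X] f(3), of c] by simp
    qed
    ultimately show ?case ..
  qed
  show "set zs \<subseteq> car (bidual X) \<Longrightarrow> bounded_form (length zs) X C A \<Longrightarrow>
      norm (iter_lim X zs A) \<le> C * prod_list (map (nrm (bidual X)) zs)"
    using main[of zs] by blast
  show "iter_lim X zs A = iter_lim X zs A1 + c * iter_lim X zs A2"
    if "set zs \<subseteq> car (bidual X)" "bounded_form (length zs) X C A"
      "bounded_form (length zs) X C1 A1" "bounded_form (length zs) X C2 A2"
      "\<And>xs. length xs = length zs \<Longrightarrow> set xs \<subseteq> car X \<Longrightarrow> A xs = A1 xs + c * A2 xs"
    using main[OF that(1), THEN conjunct2, rule_format, OF that(2-5)] .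
  show "first_slot X zs A \<in> car (dual X) \<and>
      op_norm X scalars (first_slot X zs A) \<le> C * prod_list (map (nrm (bidual X)) zs)"
    if zs: "set zs \<subseteq> car (bidual X)" and A: "bounded_form (Suc (length zs)) X C A"
    using F[OF zs main[OF zs, THEN conjunct1] main[OF zs, THEN conjunct2], rule_format, OF A] .
qed

lemma iter_lim_Cons_bounded:
  assumes X: "normed_space X" and "set (z # zs) \<subseteq> car (bidual X)" "bounded_form (length (z # zs)) X C A"
  shows "iter_lim X (z # zs) A = z (first_slot X zs A)" "first_slot X zs A \<in> car (dual X)"
proof -
  show "first_slot X zs A \<in> car (dual X)"
    using iter_lim_bounded_linear(3)[OF X, of zs C A] assms by simp
  then show "iter_lim X (z # zs) A = z (first_slot X zs A)"
    using iter_lim_Cons[OF X] assms by simp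
qed

lemma iter_lim_multilinear:
  assumes X: "normed_space X" and A: "bounded_form (length us + 1 + length vs) X C A"
    and us: "set us \<subseteq> car (bidual X)" and vs: "set vs \<subseteq> car (bidual X)" and z: "z \<in> car (bidual X)"
  shows "w \<in> car (bidual X) \<Longrightarrow>
      iter_lim X (us @ (z + w) # vs) A = iter_lim X (us @ z # vs) A + iter_lim X (us @ w # vs) A"
    and "iter_lim X (us @ fscale c z # vs) A = c * iter_lim X (us @ z # vs) A"
proof -
  note B = normed_space_bidual[OF X]
  note D = normed_space_dual[OF X]
  have "(w \<in> car (bidual X) \<longrightarrow>
      iter_lim X (us @ (z + w) # vs) A = iter_lim X (us @ z # vs) A + iter_lim X (us @ w # vs) A) \<and>
    iter_lim X (us @ fscale c z # vs) A = c * iter_lim X (us @ z # vs) A" for c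
    using A us
  proof (induction us arbitrary: A C)
    case Nil
    have "iter_lim X (y # vs) A = y (first_slot X vs A)" if "y \<in> car (bidual X)" for y
      using iter_lim_Cons_bounded(1)[OF X, of y vs C A] Nil that vs by simp
    note e = this
    have zc: "fscale c z \<in> car (bidual X)" using ns_smul[OF B z, of c] by simp
    show ?case
      unfolding append_Nil
      by (intro conjI impI)
        (simp_all only: e[OF z] e[OF zc] e[OF ns_add[OF B z]] e plus_fun_apply fscale_apply)
  next
    case (Cons u us)
    have u: "u \<in> car (bidual X)" and us: "set us \<subseteq> car (bidual X)" using Cons.prems by auto
    have st: "iter_lim X (u # us @ y # vs) A = u (first_slot X (us @ y # vs) A)"
      "first_slot X (us @ y # vs) A \<in> car (dual X)" if "y \<in> car (bidual X)" for y
      using iter_lim_Cons_bounded[OF X, of u "us @ y # vs" C A] Cons.prems that vs by auto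
    have bf: "bounded_form (length us + 1 + length vs) X (C * nrm X x) (\<lambda>xs. A (x # xs))"
      if "x \<in> car X" for x
      using bounded_form_Cons[OF X _ that, of "length us + 1 + length vs" C A] Cons.prems by simp
    note IH = Cons.IH[OF bf us]
    have zc: "fscale c z \<in> car (bidual X)" using ns_smul[OF B z, of c] by simp
    have "first_slot X (us @ (z + w) # vs) A = first_slot X (us @ z # vs) A + first_slot X (us @ w # vs) A"
      if w: "w \<in> car (bidual X)"
    proof (rule dual_eqI[OF st(2)[OF ns_add[OF B z w]] ns_add[OF D st(2)[OF z] st(2)[OF w]]])
      fix x assume x: "x \<in> car X"
      show "first_slot X (us @ (z + w) # vs) A x
          = (first_slot X (us @ z # vs) A + first_slot X (us @ w # vs) A) x"
        by (rule trans[OF _ plus_fun_apply[symmetric]], unfold first_slot_def zero_off_in[OF x],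
            rule IH[OF x, THEN conjunct1, rule_format, OF w])
    qed
    moreover have "first_slot X (us @ fscale c z # vs) A = fscale c (first_slot X (us @ z # vs) A)"
    proof (rule dual_eqI[OF st(2)[OF zc]])
      show "fscale c (first_slot X (us @ z # vs) A) \<in> car (dual X)"
        using ns_smul[OF D st(2)[OF z], of c] by simp
      fix x assume x: "x \<in> car X"
      show "first_slot X (us @ fscale c z # vs) A x = fscale c (first_slot X (us @ z # vs) A) x"
        by (rule trans[OF _ fscale_apply[symmetric]], unfold first_slot_def zero_off_in[OF x],
            rule IH[OF x, THEN conjunct2])
    qed
    ultimately show ?case
      unfolding append_Cons
      by (intro conjI impI)
        (simp_all only: st(1)[OF z] st(1)[OF zc] st(1)[OF ns_add[OF B z]] st(1)
          dual_add[OF u st(2)[OF z] st(2)] dual_smul[OF u st(2)[OF z], unfolded dual_simps])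
  qed
  then show "w \<in> car (bidual X) \<Longrightarrow>
      iter_lim X (us @ (z + w) # vs) A = iter_lim X (us @ z # vs) A + iter_lim X (us @ w # vs) A"
    and "iter_lim X (us @ fscale c z # vs) A = c * iter_lim X (us @ z # vs) A" by blast+
qed

lemma bounded_form_iter_lim:
  assumes X: "normed_space X" and A: "bounded_form k X C A"
  shows "bounded_form k (bidual X) C (\<lambda>zs. iter_lim X zs A)"
  unfolding bounded_form_def multilinear_on_def
proof (intro conjI allI impI ballI)
  show "0 \<le> C" by (rule bounded_formD(2)[OF A])
  show "norm (iter_lim X zs A) \<le> C * prod_list (map (nrm (bidual X)) zs)"
    if "length zs = k" "set zs \<subseteq> car (bidual X)" for zs
    using iter_lim_bounded_linear(1)[OF X, of zs C A] that A by simp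
  fix us vs z w c
  assume "length us + length vs + 1 = k" "set us \<subseteq> car (bidual X)" "set vs \<subseteq> car (bidual X)"
    "z \<in> car (bidual X)"
  then show "w \<in> car (bidual X) \<Longrightarrow>
      iter_lim X (us @ (z + w) # vs) A = iter_lim X (us @ z # vs) A + iter_lim X (us @ w # vs) A"
    "iter_lim X (us @ smul (bidual X) c z # vs) A = c * iter_lim X (us @ z # vs) A"
    using iter_lim_multilinear[OF X, of us vs C A z] A by auto
qed

text \<open>
  The limit in the first slot is \<open>z\<close> at the functional \<open>x \<mapsto> (\<Sum>j. \<phi> j x * B (e j # \<dots>))\<close>, a combination of
  the \<open>\<phi> j\<close>; this replaces \<open>\<phi> j x\<close> by \<open>z (\<phi> j)\<close>.
\<close>

lemma iter_lim_finite_rank: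
  fixes n :: nat
  assumes X: "normed_space X" and Y: "normed_space Y"
    and \<phi>: "\<And>j. j < n \<Longrightarrow> \<phi> j \<in> car (dual X)" and e: "\<And>j. j < n \<Longrightarrow> e j \<in> car Y"
  shows "set zs \<subseteq> car (bidual X) \<Longrightarrow> multilinear_on (length zs) (smul Y) (car Y) B \<Longrightarrow>
    iter_lim X zs (\<lambda>xs. B (map (\<lambda>x. \<Sum>j<n. smul Y (\<phi> j x) (e j)) xs))
      = B (map (\<lambda>z. \<Sum>j<n. smul Y (z (\<phi> j)) (e j)) zs)"
proof (induction zs arbitrary: B)
  case (Cons z zs)
  note D = normed_space_dual[OF X]
  let ?R = "\<lambda>x. \<Sum>j<n. smul Y (\<phi> j x) (e j)" and ?S = "\<lambda>z. \<Sum>j<n. smul Y (z (\<phi> j)) (e j)"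
  have z: "z \<in> car (bidual X)" and zs: "set zs \<subseteq> car (bidual X)" using Cons.prems by auto
  have R: "?R x \<in> car Y" and S: "?S z \<in> car Y" for x z using e by (auto intro!: ns_sum[OF Y] ns_smul[OF Y])
  let ?zs = "map ?S zs"
  have lin: "B ((\<Sum>j<n. smul Y (a j) (e j)) # ?zs) = (\<Sum>j<n. a j * B (e j # ?zs))" for a
  proof -
    have l: "length [] + length ?zs + 1 = length (z # zs)" "set [] \<subseteq> car Y" "set ?zs \<subseteq> car Y" using S by auto
    have "B ([] @ (\<Sum>j<n. smul Y (a j) (e j)) # ?zs) = (\<Sum>j<n. B ([] @ smul Y (a j) (e j) # ?zs))"
      using e by (intro multilinear_on_sum[OF ns_vector_space[OF Y] ns_subspace[OF Y] Cons.prems(2) l])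
        (auto intro: ns_smul[OF Y])
    also have "\<dots> = (\<Sum>j<n. a j * B ([] @ e j # ?zs))"
      using e by (intro sum.cong multilinear_on_scale[OF Cons.prems(2) l]) auto
    finally show ?thesis by simp
  qed
  let ?\<psi> = "\<Sum>j<n. fscale (B (e j # ?zs)) (\<phi> j)"
  have \<psi>: "?\<psi> \<in> car (dual X)" using \<phi> ns_smul[OF D] by (intro ns_sum[OF D]) auto
  have "iter_lim X zs (\<lambda>xs. B (map ?R (x # xs))) = ?\<psi> x" if x: "x \<in> car X" for x
  proof -
    have "multilinear_on (length zs) (smul Y) (car Y) (\<lambda>ys. B (?R x # ys))"
      using multilinear_on_Cons[of "length zs" "smul Y" "car Y" B "?R x"] Cons.prems R by simp
    from Cons.IH[OF zs this]
    have "iter_lim X zs (\<lambda>xs. B (map ?R (x # xs))) = B (?R x # ?zs)" by simp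
    also have "\<dots> = ?\<psi> x" unfolding lin by (simp add: sum_fun_apply mult.commute)
    finally show ?thesis .
  qed
  from wstar_nhds_lim[OF X z \<psi> this]
  have "iter_lim X (z # zs) (\<lambda>xs. B (map ?R xs)) = z ?\<psi>" by simp
  also have "\<dots> = (\<Sum>j<n. B (e j # ?zs) * z (\<phi> j))"
    using lin_op_lincomb[OF D dual_lin_op[OF z], of "{..<n}" \<phi> "\<lambda>j. B (e j # ?zs)"] \<phi> by simp
  also have "\<dots> = B (map ?S (z # zs))" using lin[of "\<lambda>j. z (\<phi> j)"] by (simp add: mult.commute)
  finally show ?case .
qed simp

text \<open>
  The operators are chosen one after the other, as the limits are taken: local reflexivity gives the first one,
  \<open>T\<close>, with \<open>first_slot\<close> at \<open>T z\<close> close to its weak* limit, and then the induction hypothesis applies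
  to the forms \<open>A z (T z # _)\<close>. These depend on \<open>z\<close>, which is why the forms do.
\<close>

lemma iter_lim_approx:
  fixes A :: "(('v \<Rightarrow> 'k) \<Rightarrow> 'k) \<Rightarrow> 'v::ab_group_add list \<Rightarrow> 'k::real_or_complex"
  assumes X: "normed_space X" and M: "fin_dim_subspace (bidual X) M" and G: "finite G" "G \<subseteq> M"
  shows "(\<forall>z\<in>G. \<exists>C. bounded_form k X C (A z)) \<Longrightarrow> \<delta> > 0 \<Longrightarrow>
    \<exists>Ts. length Ts = k \<and>
      (\<forall>T\<in>set Ts. lin_op (restr (bidual X) M) X T \<and> (\<forall>m\<in>M. nrm X (T m) \<le> 2 * nrm (bidual X) m)) \<and>
      (\<forall>z\<in>G. norm (A z (map (\<lambda>T. T z) Ts) - iter_lim X (replicate k z) (A z)) < \<delta>)"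
proof (induction k arbitrary: A \<delta>)
  case 0
  then show ?case by (intro exI[of _ "[]"]) auto
next
  case (Suc k)
  note B = normed_space_bidual[OF X]
  define M' where "M' = restr (bidual X) M"
  have M': "normed_space M'" "car M' = M" and Msub: "M \<subseteq> car (bidual X)"
    using fin_dim_subspaceD[OF B M] by (auto simp: M'_def)
  obtain n e c where fr: "finite_frame M' n e c"
    using finite_frame_exists[OF B M] by (auto simp: M'_def)
  have e: "e j \<in> car (bidual X)" and c: "c j \<in> car (dual M')" if "j < n" for j
    using fr that Msub M' by (auto simp: finite_frame_def)
  have ec: "m = (\<Sum>j<n. fscale (c j m) (e j))" if "m \<in> M" for m
    using fr that M' by (auto simp: finite_frame_def M'_def)
  define \<phi> where "\<phi> z = first_slot X (replicate k z) (A z)" for z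
  have \<phi>: "\<phi> z \<in> car (dual X)" "iter_lim X (replicate (Suc k) z) (A z) = z (\<phi> z)" if z: "z \<in> G" for z
  proof -
    obtain C where C: "bounded_form (Suc k) X C (A z)" using Suc.prems z by blast
    have "set (z # replicate k z) \<subseteq> car (bidual X)" using z G Msub by auto
    from iter_lim_Cons_bounded[OF X this, of C "A z"] C
    show "\<phi> z \<in> car (dual X)" "iter_lim X (replicate (Suc k) z) (A z) = z (\<phi> z)"
      by (simp_all add: \<phi>_def del: iter_lim.simps)
  qed
  define E where "E = 1 + (\<Sum>z\<in>G. \<Sum>j<n. norm (c j z))"
  have E: "E > 0" by (auto simp: E_def intro!: add_pos_nonneg sum_nonneg)
  define \<delta>' where "\<delta>' = \<delta> / 2 / E"
  have \<delta>': "\<delta>' > 0" using Suc.prems E by (simp add: \<delta>'_def)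
  have fin\<Phi>: "finite (\<phi> ` G)" "\<phi> ` G \<subseteq> car (dual X)" using G \<phi> by auto
  have "\<exists>x. (\<forall>j<n. x j \<in> car X) \<and>
    (\<forall>m\<in>car M'. nrm X (0 + (\<Sum>j<n. smul X (c j m) (x j))) \<le> 2 * nrm M' m) \<and>
    (\<forall>j<n. \<forall>\<psi>\<in>\<phi> ` G. norm (\<psi> (x j) - e j \<psi>) < \<delta>')"
  proof (rule local_reflexivity[OF M'(1) fr X lin_op_zero_op[OF X] c e _ _ _ fin\<Phi> \<delta>', where K = 1])
    show "nrm (bidual X) (canon X 0 + (\<Sum>j<n. fscale (c j m) (e j))) \<le> 1 * nrm M' m"
      if "m \<in> car M'" for m
      using ec[of m] that M' by (simp add: canon_zero[OF X] M'_def)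
  qed auto
  then obtain x where x: "\<forall>j<n. x j \<in> car X"
    "\<forall>m\<in>M. nrm X (\<Sum>j<n. smul X (c j m) (x j)) \<le> 2 * nrm M' m"
    "\<forall>j<n. \<forall>z\<in>G. norm (\<phi> z (x j) - e j (\<phi> z)) < \<delta>'"
    using M' by auto
  define T where "T = (\<lambda>m. \<Sum>j<n. smul X (c j m) (x j))"
  have T: "lin_op M' X T"
    using bdd_op_finite_rank[OF M'(1) X, of n c x] c x(1) by (auto simp: T_def bdd_op_def)
  have Tin: "T z \<in> car X" if "z \<in> M" for z using lin_op_in[OF T] M' that by simp
  have approx: "norm (\<phi> z (T z) - z (\<phi> z)) < \<delta> / 2" if z: "z \<in> G" for z
  proof -
    have zM: "z \<in> M" using z G by blast
    have "\<phi> z (T z) = (\<Sum>j<n. c j z * \<phi> z (x j))"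
      unfolding T_def using lin_op_lincomb[OF X dual_lin_op[OF \<phi>(1)[OF z]], of "{..<n}" x "\<lambda>j. c j z"] x(1) by simp
    moreover have "z (\<phi> z) = (\<Sum>j<n. c j z * e j (\<phi> z))"
      using fun_cong[OF ec[OF zM], of "\<phi> z"] by (simp add: sum_fun_apply)
    ultimately have "\<phi> z (T z) - z (\<phi> z) = (\<Sum>j<n. c j z * (\<phi> z (x j) - e j (\<phi> z)))"
      by (simp add: sum_subtractf right_diff_distrib)
    also have "norm \<dots> \<le> (\<Sum>j<n. norm (c j z) * \<delta>')"
      using x(3) z by (intro sum_norm_le) (auto simp: norm_mult less_imp_le intro!: mult_left_mono)
    also have "\<dots> = (\<Sum>j<n. norm (c j z)) * \<delta>'" by (simp add: sum_distrib_right)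
    also have "\<dots> \<le> (E - 1) * \<delta>'"
    proof (rule mult_right_mono)
      show "(\<Sum>j<n. norm (c j z)) \<le> E - 1"
        unfolding E_def using member_le_sum[OF z, of "\<lambda>z. \<Sum>j<n. norm (c j z)"] G by (simp add: sum_nonneg)
    qed (use \<delta>' in simp)
    also have "\<dots> < E * \<delta>'" using \<delta>' by simp
    also have "\<dots> = \<delta> / 2" using E by (simp add: \<delta>'_def)
    finally show ?thesis .
  qed
  have bf: "\<forall>z\<in>G. \<exists>C. bounded_form k X C (\<lambda>xs. A z (T z # xs))"
    using Suc.prems(1) bounded_form_Cons[OF X] Tin G by blast
  have "\<delta> / 2 > 0" using Suc.prems by simp
  from Suc.IH[OF bf this] obtain Ts where Ts: "length Ts = k"
    "\<forall>T\<in>set Ts. lin_op (restr (bidual X) M) X T \<and> (\<forall>m\<in>M. nrm X (T m) \<le> 2 * nrm (bidual X) m)"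
    "\<forall>z\<in>G. norm (A z (T z # map (\<lambda>T. T z) Ts)
      - iter_lim X (replicate k z) (\<lambda>xs. A z (T z # xs))) < \<delta> / 2" by blast
  show ?case
  proof (intro exI[of _ "T # Ts"] conjI ballI)
    show "length (T # Ts) = Suc k" using Ts by simp
    show "norm (A z (map (\<lambda>T. T z) (T # Ts)) - iter_lim X (replicate (Suc k) z) (A z)) < \<delta>"
      if z: "z \<in> G" for z
    proof -
      have "\<phi> z (T z) = iter_lim X (replicate k z) (\<lambda>xs. A z (T z # xs))"
        using Tin z G by (auto simp: \<phi>_def first_slot_def)
      then have "norm (A z (T z # map (\<lambda>T. T z) Ts) - \<phi> z (T z)) < \<delta> / 2" using Ts(3) z by simp
      then show ?thesis
        using norm_diff_triangle_less[OF _ approx[OF z]] unfolding \<phi>(2)[OF z] by fastforce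
    qed
    show "lin_op (restr (bidual X) M) X S" if "S \<in> set (T # Ts)" for S
      using that Ts T by (auto simp: M'_def)
    show "nrm X (S m) \<le> 2 * nrm (bidual X) m" if "S \<in> set (T # Ts)" "m \<in> M" for S m
      using that Ts x(2) by (auto simp: T_def M'_def)
  qed
qed

lemma s_tensor_normD:
  assumes "s_tensor_norm k \<beta> \<beta>'"
  shows "normed_space X \<Longrightarrow> normed_space (sym_tensor_space k \<beta> X)"
    and "normed_space Z \<Longrightarrow> normed_space (sym_tensor_space k \<beta>' Z)"
    and "metric_mapping_property k \<beta> \<beta>'" "metric_mapping_property k \<beta>' \<beta>"
    and "finitely_generated k \<beta>'"
    and "normed_space X \<Longrightarrow> v \<in> sym_tensors k X \<Longrightarrow> \<beta> X v \<le> pi_norm k X v"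
    and "normed_space Z \<Longrightarrow> w \<in> sym_tensors k Z \<Longrightarrow> \<beta>' Z w \<le> pi_norm k Z w"
  using assms by (auto simp: s_tensor_norm_def s_tensor_norm_on_def)

lemma sym_tensor_space_simps [simp]:
  "car (sym_tensor_space k \<beta> X) = sym_tensors k X" "smul (sym_tensor_space k \<beta> X) = fscale"
  "nrm (sym_tensor_space k \<beta> X) = \<beta> X"
  by (simp_all add: sym_tensor_space_def)

lemma pi_norm_tpow_le:
  assumes X: "normed_space X" and x: "x \<in> car X"
  shows "pi_norm k X (tpow k (smul X) x) \<le> nrm X x ^ k"
  unfolding pi_norm_def
proof (rule cInf_lower)
  show "nrm X x ^ k \<in> {\<Sum>(c, x)\<leftarrow>cs. norm c * nrm X x ^ k |cs. represents k X cs (tpow k (smul X) x)}"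
    by (rule CollectI, rule exI[of _ "[(1, x)]"]) (use x in \<open>auto simp: represents_def\<close>)
  show "bdd_below {\<Sum>(c, x)\<leftarrow>cs. norm c * nrm X x ^ k |cs. represents k X cs (tpow k (smul X) x)}"
  proof (rule bdd_belowI[of _ 0], clarify)
    fix cs assume "represents k X cs (tpow k (smul X) x)"
    then show "0 \<le> (\<Sum>(c, x)\<leftarrow>cs. norm c * nrm X x ^ k)"
      by (intro sum_list_nonneg) (auto simp: represents_def nrm_nonneg[OF X])
  qed
qed

lemma functional_tsum:
  assumes S: "normed_space (sym_tensor_space k \<beta> X)" and f: "f \<in> car (dual (sym_tensor_space k \<beta> X))"
    and cs: "represents k X cs v"
  shows "f v = (\<Sum>(c, x)\<leftarrow>cs. c * f (tpow k (smul X) x))"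
proof -
  have "snd ` set cs \<subseteq> car X \<Longrightarrow> f (tsum k (smul X) cs) = (\<Sum>(c, x)\<leftarrow>cs. c * f (tpow k (smul X) x))"
  proof (induction cs)
    case Nil
    show ?case using lin_op_zero[OF S dual_lin_op[OF f]] by (simp add: zero_fun_def)
  next
    case (Cons q cs)
    obtain c x where q: "q = (c, x)" by (cases q)
    have x: "tpow k (smul X) x \<in> sym_tensors k X" using Cons.prems q by (auto intro: tpow_sym_tensors)
    have t: "tsum k (smul X) cs \<in> sym_tensors k X"
      unfolding mem_sym_tensors_iff using Cons.prems by (auto simp: represents_def)
    have s: "fscale c (tpow k (smul X) x) \<in> sym_tensors k X" using ns_smul[OF S] x by simp
    have "f (tsum k (smul X) (q # cs)) = c * f (tpow k (smul X) x) + f (tsum k (smul X) cs)"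
      unfolding q tsum_Cons
      by (rule trans[OF dual_add[OF f]]) (use s t x dual_smul[OF f, of "tpow k (smul X) x" c] in simp_all)
    then show ?case using Cons by (simp add: q del: tsum_Cons)
  qed
  then show ?thesis using cs by (simp add: represents_def)
qed

lemma functional_poly_bound:
  assumes X: "normed_space X" and S: "normed_space (sym_tensor_space k \<beta> X)"
    and le: "\<And>v. v \<in> sym_tensors k X \<Longrightarrow> \<beta> X v \<le> pi_norm k X v"
    and f: "f \<in> car (dual (sym_tensor_space k \<beta> X))" and x: "x \<in> car X"
  shows "norm (f (tpow k (smul X) x)) \<le> op_norm (sym_tensor_space k \<beta> X) scalars f * nrm X x ^ k"
proof -
  note t = tpow_sym_tensors[OF x]
  have "\<beta> X (tpow k (smul X) x) \<le> nrm X x ^ k"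
    using le[OF t] pi_norm_tpow_le[OF X x] by (rule order_trans)
  then show ?thesis
    using dual_bound[OF S f, of "tpow k (smul X) x"] t nrm_nonneg[OF normed_space_dual[OF S] f]
      mult_left_mono order_trans by fastforce
qed

lemma finitely_generatedE:
  assumes fg: "finitely_generated k \<beta>'" and Z: "normed_space Z" and v: "v \<in> sym_tensors k Z" and \<epsilon>: "\<epsilon> > 0"
  obtains M where "fin_dim_subspace Z M" "v \<in> sym_tensors k (restr Z M)" "\<beta>' (restr Z M) v < \<beta>' Z v + \<epsilon>"
proof -
  let ?R = "{\<beta>' (restr Z M) v | M. fin_dim_subspace Z M \<and> v \<in> sym_tensors k (restr Z M)}"
  interpret vector_space "smul Z" by (rule ns_vector_space[OF Z])
  have "\<beta>' Z v = Inf ?R" using fg Z v by (simp add: finitely_generated_def)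
  moreover obtain cs where cs: "represents k Z cs v" using v mem_sym_tensors_iff by blast
  let ?M = "span (snd ` set cs)"
  have "?M \<subseteq> car Z" using cs ns_subspace[OF Z] by (intro span_minimal) (auto simp: represents_def)
  then have "fin_dim_subspace Z ?M" unfolding fin_dim_subspace_def by blast
  moreover have "represents k (restr Z ?M) cs v" using cs span_superset by (auto simp: represents_def)
  ultimately have "?R \<noteq> {}" using mem_sym_tensors_iff by blast
  from cInf_lessD[OF this, of "\<beta>' Z v + \<epsilon>"] \<open>\<beta>' Z v = Inf ?R\<close> \<epsilon> show thesis using that by auto
qed

text \<open>
  On a finite dimensional subspace the extension is close to \<open>z \<mapsto> A (T_1 z, \<dots>, T_k z)\<close> with operators \<open>T_i\<close> of
  norm at most two. By polarization this is a combination of the values of the polynomial at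
  \<open>\<Sum>i\<in>D. T_i z\<close>, and the mapping property applies to each operator \<open>\<Sum>i\<in>D. T_i\<close>.
\<close>

lemma aron_berner_form_bound:
  fixes X :: "('k::real_or_complex, 'v::ab_group_add) nspace"
  assumes st: "s_tensor_norm k \<beta> \<beta>'" and X: "normed_space X"
    and f: "f \<in> car (dual (sym_tensor_space k \<beta> X))"
    and A: "sym_form_of k X (\<lambda>x. f (tpow k (smul X) x)) A"
    and v: "v \<in> sym_tensors k (bidual X)"
  shows "norm (tform (bidual X) (\<lambda>zs. iter_lim X zs A) v)
    \<le> op_norm (sym_tensor_space k \<beta> X) scalars f * 2 ^ k * polarization_constant k * \<beta>' (bidual X) v"
proof (rule field_le_epsilon)
  note B = normed_space_bidual[OF X] and S = s_tensor_normD(1)[OF st X]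
  define F where "F = op_norm (sym_tensor_space k \<beta> X) scalars f"
  have F0: "0 \<le> F" unfolding F_def by (rule op_norm_nonneg[OF S normed_space_scalars dual_bdd_op[OF f]])
  have fb: "norm (f w) \<le> F * \<beta> X w" if "w \<in> sym_tensors k X" for w
    unfolding F_def using dual_bound[OF S f] that by simp
  have p: "norm (f (tpow k (smul X) x)) \<le> F * nrm X x ^ k" if "x \<in> car X" for x
    unfolding F_def by (rule functional_poly_bound[OF X S s_tensor_normD(6)[OF st X] f that])
  have bf: "bounded_form k X (F * polarization_constant k) A"
    by (rule sym_form_bounded[OF X A F0 p])
  note bfB = bounded_form_iter_lim[OF X bf]
  let ?Ab = "\<lambda>zs. iter_lim X zs A"
  fix \<epsilon> :: real assume \<epsilon>: "\<epsilon> > 0"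
  define K where "K = F * 2 ^ k * polarization_constant k"
  have K0: "0 \<le> K" unfolding K_def using F0 polarization_constant_nonneg by simp
  \<comment> \<open>One half of \<open>\<epsilon>\<close> pays for the passage to a finite dimensional subspace, the other for the operators \<open>T_i\<close>.\<close>
  define \<eta> where "\<eta> = \<epsilon> / 2 / (K + 1)"
  have \<eta>: "\<eta> > 0" "K * \<eta> \<le> \<epsilon> / 2" using \<epsilon> K0 by (auto simp: \<eta>_def field_simps)
  obtain M where M: "fin_dim_subspace (bidual X) M" "v \<in> sym_tensors k (restr (bidual X) M)"
    "\<beta>' (restr (bidual X) M) v < \<beta>' (bidual X) v + \<eta>"
    using finitely_generatedE[OF s_tensor_normD(5)[OF st] B v \<eta>(1)] by blast
  let ?M = "restr (bidual X) M"
  note nM = fin_dim_subspaceD[OF B M(1)]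
  obtain cs where cs: "represents k ?M cs v" using M(2) mem_sym_tensors_iff by blast
  note csB = represents_restr[OF nM(2) cs]
  define G where "G = snd ` set cs"
  have G: "finite G" "G \<subseteq> M" using cs by (auto simp: G_def represents_def)
  define \<Sigma>c where "\<Sigma>c = 1 + (\<Sum>(c, x)\<leftarrow>cs. norm c)"
  have \<Sigma>c: "\<Sigma>c > 0" by (auto simp: \<Sigma>c_def intro!: add_pos_nonneg sum_list_nonneg)
  define \<delta> where "\<delta> = \<epsilon> / 2 / \<Sigma>c"
  have \<delta>: "\<delta> > 0" using \<epsilon> \<Sigma>c by (simp add: \<delta>_def)
  obtain Ts where Ts: "length Ts = k"
    "\<forall>T\<in>set Ts. lin_op ?M X T \<and> (\<forall>m\<in>M. nrm X (T m) \<le> 2 * nrm (bidual X) m)"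
    "\<forall>z\<in>G. norm (A (map (\<lambda>T. T z) Ts) - iter_lim X (replicate k z) A) < \<delta>"
    using iter_lim_approx[OF X M(1) G, of k "\<lambda>_. A" \<delta>] bf \<delta> by blast
  have Tl: "lin_op ?M X (Ts ! i)" and Tb: "m \<in> M \<Longrightarrow> nrm X ((Ts ! i) m) \<le> 2 * nrm (bidual X) m"
    if "i < k" for i m using Ts(1,2) that nth_mem by blast+
  define TD where "TD D m = (\<Sum>i\<in>D. (Ts ! i) m)" for D m
  have TDin: "TD D m \<in> car X" if "D \<subseteq> {..<k}" "m \<in> M" for D m
    unfolding TD_def using that lin_op_in[OF Tl] by (intro ns_sum[OF X]) auto
  interpret vX: vector_space "smul X" by (rule ns_vector_space[OF X])
  have TD: "lin_op ?M X (TD D)" "bdd_op ?M X (TD D)" "op_norm ?M X (TD D) \<le> 2 * real (card D)"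
    if D: "D \<subseteq> {..<k}" for D
  proof -
    show l: "lin_op ?M X (TD D)"
      unfolding lin_op_def
    proof (intro conjI ballI allI)
      show "TD D ` car ?M \<subseteq> car X" using TDin[OF D] by auto
      show "TD D (x + y) = TD D x + TD D y" if "x \<in> car ?M" "y \<in> car ?M" for x y
        unfolding TD_def sum.distrib[symmetric]
        by (rule sum.cong) (use that D lin_op_add[OF Tl] in auto)
      show "TD D (smul ?M c x) = smul X c (TD D x)" if "x \<in> car ?M" for c x
        unfolding TD_def vX.scale_sum_right
        by (rule sum.cong) (use that D lin_op_smul[OF Tl] in auto)
    qed
    have b: "nrm X (TD D m) \<le> 2 * real (card D) * nrm ?M m" if m: "m \<in> car ?M" for m
    proof -
      have "nrm X (TD D m) \<le> (\<Sum>i\<in>D. nrm X ((Ts ! i) m))"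
        unfolding TD_def using D m lin_op_in[OF Tl] by (intro nrm_sum_le[OF X]) auto
      also have "\<dots> \<le> (\<Sum>i\<in>D. 2 * nrm (bidual X) m)" using D m Tb by (intro sum_mono) auto
      finally show ?thesis by simp
    qed
    show "bdd_op ?M X (TD D)" by (rule bdd_opI[OF l b])
    show "op_norm ?M X (TD D) \<le> 2 * real (card D)"
      by (rule op_norm_le[OF nM(1) l _ b]) auto
  qed
  let ?N = "of_nat (card (list_perms k)) :: 'k"
  have N0: "real (card (list_perms k)) > 0" using card_list_perms by simp
  \<comment> \<open>The functional \<open>z \<mapsto> A (T_1 z, \<dots>, T_k z)\<close> at the tensor \<open>v\<close>.\<close>
  define s where "s = (\<Sum>(c, z)\<leftarrow>cs. c * A (map (\<lambda>T. T z) Ts))"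
  have "?N * s = (\<Sum>D\<in>Pow {..<k}. (-1) ^ (k + card D) * f (sym_tensor_map k ?M X (TD D) v))"
  proof -
    have "?N * (c * A (map (\<lambda>T. T z) Ts)) =
        (\<Sum>D\<in>Pow {..<k}. (-1) ^ (k + card D) * (c * f (tpow k (smul X) (TD D z))))"
      if "(c, z) \<in> set cs" for c z
    proof -
      have z: "z \<in> M" using that G by (force simp: G_def)
      have l: "length (map (\<lambda>T. T z) Ts) = k" "set (map (\<lambda>T. T z) Ts) \<subseteq> car X"
        using Ts lin_op_in z by fastforce+
      have "(\<Sum>i\<in>D. map (\<lambda>T. T z) Ts ! i) = TD D z" if "D \<subseteq> {..<k}" for D
        unfolding TD_def using that Ts(1) by (intro sum.cong) auto
      then have "?N * A (map (\<lambda>T. T z) Ts) =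
          (\<Sum>D\<in>Pow {..<k}. (-1) ^ (k + card D) * f (tpow k (smul X) (TD D z)))"
        unfolding polarization[OF X A l] by (intro sum.cong) auto
      then have "c * (?N * A (map (\<lambda>T. T z) Ts)) =
          (\<Sum>D\<in>Pow {..<k}. c * ((-1) ^ (k + card D) * f (tpow k (smul X) (TD D z))))"
        by (simp add: sum_distrib_left)
      then show ?thesis by (simp add: mult_ac)
    qed
    then have "?N * s = (\<Sum>(c, z)\<leftarrow>cs. \<Sum>D\<in>Pow {..<k}.
        (-1) ^ (k + card D) * (c * f (tpow k (smul X) (TD D z))))"
      unfolding s_def sum_list_const_mult[symmetric]
      by (intro arg_cong[of _ _ sum_list] map_cong) auto
    also have "\<dots> = (\<Sum>D\<in>Pow {..<k}. \<Sum>(c, z)\<leftarrow>cs.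
        (-1) ^ (k + card D) * (c * f (tpow k (smul X) (TD D z))))"
      by (induction cs) (auto simp: sum.distrib)
    also have "\<dots> = (\<Sum>D\<in>Pow {..<k}. (-1) ^ (k + card D) * f (sym_tensor_map k ?M X (TD D) v))"
    proof (rule sum.cong[OF refl])
      fix D assume "D \<in> Pow {..<k}"
      then have l: "lin_op ?M X (TD D)" using TD by blast
      have "f (sym_tensor_map k ?M X (TD D) v)
          = (\<Sum>(c, x)\<leftarrow>map (\<lambda>(c, x). (c, TD D x)) cs. c * f (tpow k (smul X) x))"
        unfolding sym_tensor_map_eq[OF nM(1) X l cs]
        by (rule functional_tsum[OF S f represents_map[OF l cs]])
      also have "\<dots> = (\<Sum>(c, z)\<leftarrow>cs. c * f (tpow k (smul X) (TD D z)))"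
        by (simp add: o_def case_prod_unfold)
      finally show "(\<Sum>(c, z)\<leftarrow>cs. (-1) ^ (k + card D) * (c * f (tpow k (smul X) (TD D z))))
          = (-1) ^ (k + card D) * f (sym_tensor_map k ?M X (TD D) v)"
        by (simp add: sum_list_const_mult case_prod_unfold)
    qed
    finally show ?thesis .
  qed
  moreover have b0: "0 \<le> \<beta>' ?M v" using nrm_nonneg[OF s_tensor_normD(2)[OF st nM(1)]] M(2) by simp
  have "norm (f (sym_tensor_map k ?M X (TD D) v)) \<le> F * (2 ^ k * real (card D) ^ k * \<beta>' ?M v)"
    if D: "D \<subseteq> {..<k}" for D
  proof -
    have "\<beta> X (sym_tensor_map k ?M X (TD D) v) \<le> op_norm ?M X (TD D) ^ k * \<beta>' ?M v"
      using s_tensor_normD(4)[OF st] nM(1) X TD(2)[OF D] M(2)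
      by (auto simp: metric_mapping_property_def)
    also have "\<dots> \<le> (2 * real (card D)) ^ k * \<beta>' ?M v"
      using TD(3)[OF D] op_norm_nonneg[OF nM(1) X TD(2)[OF D]] b0
      by (intro mult_right_mono power_mono) auto
    finally show ?thesis
      using order_trans[OF fb[OF sym_tensor_map_in[OF nM(1) X TD(1)[OF D] M(2)]] mult_left_mono[OF _ F0]]
      by (simp add: power_mult_distrib)
  qed
  ultimately have "norm (?N * s) \<le> (\<Sum>D\<in>Pow {..<k}. F * (2 ^ k * real (card D) ^ k * \<beta>' ?M v))"
    by (auto intro!: sum_norm_le simp: norm_mult norm_power)
  also have "\<dots> = (F * 2 ^ k * \<beta>' ?M v) * (\<Sum>D\<in>Pow {..<k}. real (card D) ^ k)"
    by (simp add: sum_distrib_left mult_ac)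
  finally have "norm s \<le> K * \<beta>' ?M v"
    using N0 by (simp add: norm_mult K_def polarization_constant_def field_simps)
  also have "\<dots> \<le> K * (\<beta>' (bidual X) v + \<eta>)" using M(3) K0 by (intro mult_left_mono) auto
  also have "\<dots> \<le> K * \<beta>' (bidual X) v + \<epsilon> / 2" using \<eta> by (simp add: distrib_left)
  finally have s: "norm s \<le> K * \<beta>' (bidual X) v + \<epsilon> / 2" .
  have "tform (bidual X) ?Ab v = (\<Sum>(c, z)\<leftarrow>cs. c * iter_lim X (replicate k z) A)"
    by (rule tform_tsum[OF B bounded_formD(1)[OF bfB] csB])
  moreover have "norm ((\<Sum>(c, z)\<leftarrow>cs. c * iter_lim X (replicate k z) A) - s) \<le> (\<Sum>(c, z)\<leftarrow>cs. norm c) * \<delta>"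
    unfolding s_def using Ts(3) unfolding G_def
  proof (induction cs)
    case (Cons q cs)
    obtain c z where q: "q = (c, z)" by (cases q)
    have "norm (A (map (\<lambda>T. T z) Ts) - iter_lim X (replicate k z) A) < \<delta>" using Cons.prems q by auto
    then have "norm (c * (iter_lim X (replicate k z) A - A (map (\<lambda>T. T z) Ts))) \<le> norm c * \<delta>"
      by (auto simp: norm_mult norm_minus_commute intro!: mult_left_mono)
    moreover have "norm ((\<Sum>(c, z)\<leftarrow>cs. c * iter_lim X (replicate k z) A) - (\<Sum>(c, z)\<leftarrow>cs. c * A (map (\<lambda>T. T z) Ts)))
        \<le> (\<Sum>(c, z)\<leftarrow>cs. norm c) * \<delta>" using Cons by auto
    ultimately have "norm (c * (iter_lim X (replicate k z) A - A (map (\<lambda>T. T z) Ts)) +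
        ((\<Sum>(c, z)\<leftarrow>cs. c * iter_lim X (replicate k z) A) - (\<Sum>(c, z)\<leftarrow>cs. c * A (map (\<lambda>T. T z) Ts))))
        \<le> norm c * \<delta> + (\<Sum>(c, z)\<leftarrow>cs. norm c) * \<delta>" by (rule norm_triangle_mono)
    then show ?case by (simp add: q algebra_simps)
  qed simp
  moreover have "(\<Sum>(c, z)\<leftarrow>cs. norm c) * \<delta> \<le> \<epsilon> / 2"
  proof -
    have "(\<Sum>(c, z)\<leftarrow>cs. norm c) * \<delta> \<le> \<Sigma>c * \<delta>" using \<delta> by (intro mult_right_mono) (auto simp: \<Sigma>c_def)
    also have "\<dots> = \<epsilon> / 2" using \<Sigma>c by (simp add: \<delta>_def)
    finally show ?thesis .
  qed
  ultimately have "norm (tform (bidual X) ?Ab v - s) \<le> \<epsilon> / 2" by simp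
  then have "norm (tform (bidual X) ?Ab v) \<le> K * \<beta>' (bidual X) v + \<epsilon>"
    using s norm_triangle_sub[of "tform (bidual X) ?Ab v" s] by simp
  then show "norm (tform (bidual X) ?Ab v)
    \<le> op_norm (sym_tensor_space k \<beta> X) scalars f * 2 ^ k * polarization_constant k * \<beta>' (bidual X) v + \<epsilon>"
    by (simp add: K_def F_def)
qed

section \<open>Generalized limits and the approximation property\<close>

text \<open>
  The Hahn-Banach theorem for the seminorm \<open>p x\<close>, the upper limit of \<open>norm (x i)\<close> on the bounded families, and the
  constant family one. A family that tends to \<open>c\<close> differs from the constant \<open>c\<close> by a family of seminorm zero.
\<close>

lemma generalized_limit:
  fixes F :: "'i filter"
  assumes F: "F \<noteq> bot"
  shows "\<exists>lim :: ('i \<Rightarrow> 'k::real_or_complex) \<Rightarrow> 'k.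
    (\<forall>x y. lim (\<lambda>i. x i + y i) = lim x + lim y) \<and> (\<forall>c x. lim (\<lambda>i. c * x i) = c * lim x) \<and>
    (\<forall>x C. (\<forall>\<^sub>F i in F. norm (x i) \<le> C) \<longrightarrow> norm (lim x) \<le> C) \<and>
    (\<forall>x c. (x \<longlongrightarrow> c) F \<longrightarrow> lim x = c)"
proof -
  interpret vector_space "fscale :: 'k \<Rightarrow> ('i \<Rightarrow> 'k) \<Rightarrow> 'i \<Rightarrow> 'k" by (rule vector_space_fscale)
  define V :: "('i \<Rightarrow> 'k) set" where "V = {x. \<exists>C. \<forall>\<^sub>F i in F. norm (x i) \<le> C}"
  define R where "R x = {C. \<forall>\<^sub>F i in F. norm (x i) \<le> C}" for x :: "'i \<Rightarrow> 'k"
  define p where "p x = Inf (R x)" for x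
  have R0: "0 \<le> C" if "C \<in> R x" for C x
  proof -
    have "\<exists>i. norm (x i) \<le> C" using that F eventually_happens' unfolding R_def by blast
    then show ?thesis using norm_ge_zero order_trans by blast
  qed
  have bdd: "bdd_below (R x)" for x using R0 by (rule bdd_belowI)
  have ple: "p x \<le> C" if "\<forall>\<^sub>F i in F. norm (x i) \<le> C" for x C
    unfolding p_def by (rule cInf_lower[OF _ bdd]) (use that in \<open>simp add: R_def\<close>)
  have pge: "a \<le> p x" if "x \<in> V" "\<And>C. \<forall>\<^sub>F i in F. norm (x i) \<le> C \<Longrightarrow> a \<le> C" for a x
    unfolding p_def by (rule cInf_greatest) (use that in \<open>auto simp: R_def V_def\<close>)
  have add: "\<forall>\<^sub>F i in F. norm ((x + y) i) \<le> C + D"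
    if "\<forall>\<^sub>F i in F. norm (x i) \<le> C" "\<forall>\<^sub>F i in F. norm (y i) \<le> D" for x y :: "'i \<Rightarrow> 'k" and C D
    using that by eventually_elim (auto intro: norm_triangle_le add_mono)
  have sc: "\<forall>\<^sub>F i in F. norm (fscale c x i) \<le> norm c * C"
    if "\<forall>\<^sub>F i in F. norm (x i) \<le> C" for x :: "'i \<Rightarrow> 'k" and c C
    using that by eventually_elim (auto simp: norm_mult intro!: mult_left_mono)
  have V: "subspace V"
  proof (rule subspaceI)
    show "0 \<in> V" by (auto simp: V_def intro!: exI[of _ 0])
    show "x + y \<in> V" if "x \<in> V" "y \<in> V" for x y using that add unfolding V_def by blast
    show "fscale c x \<in> V" if "x \<in> V" for c x using that sc unfolding V_def by blast
  qed
  have semi: "seminorm_on fscale V p"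
  proof (rule seminorm_onI[OF vector_space_fscale V])
    fix x y assume x: "x \<in> V" and y: "y \<in> V"
    have "p (x + y) - D \<le> p x" if "\<forall>\<^sub>F i in F. norm (y i) \<le> D" for D
    proof (rule pge[OF x])
      fix C assume "\<forall>\<^sub>F i in F. norm (x i) \<le> C"
      from ple[OF add[OF this that]] show "p (x + y) - D \<le> C" by (simp add: plus_fun_def)
    qed
    then have "p (x + y) - p x \<le> p y" by (intro pge[OF y]) (simp add: algebra_simps)
    then show "p (x + y) \<le> p x + p y" by simp
  next
    fix c x assume x: "x \<in> V"
    have *: "p (fscale c x) \<le> norm c * C" if "\<forall>\<^sub>F i in F. norm (x i) \<le> C" for C
      by (rule ple[OF sc[OF that]])
    show "p (fscale c x) \<le> norm c * p x"
    proof (cases "c = 0")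
      case True
      have "p (fscale c x) \<le> 0" by (rule ple) (simp add: True)
      then show ?thesis using True by simp
    next
      case False
      then have "p (fscale c x) / norm c \<le> p x"
        using * by (intro pge[OF x]) (simp add: field_simps)
      then show ?thesis using False by (simp add: field_simps)
    qed
  qed
  let ?one = "(\<lambda>_. 1) :: 'i \<Rightarrow> 'k"
  have one: "?one \<in> V" by (auto simp: V_def intro!: exI[of _ 1])
  have "p ?one = 1"
  proof (rule antisym)
    show "p ?one \<le> 1" by (rule ple) simp
    show "1 \<le> p ?one"
    proof (rule pge[OF one])
      fix C :: real assume "\<forall>\<^sub>F i in F. norm (?one i) \<le> C"
      then show "1 \<le> C" using F by (simp add: eventually_const)
    qed
  qed
  then obtain f where f: "\<And>x y. f (x + y) = f x + f y" "\<And>c x. f (fscale c x) = c * f x"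
    "\<And>x. x \<in> V \<Longrightarrow> norm (f x) \<le> p x" "f ?one = 1"
    using norming_functional[OF vector_space_fscale V semi one] by (metis of_real_1)
  have bound: "norm (f x) \<le> C" if "\<forall>\<^sub>F i in F. norm (x i) \<le> C" for x C
    using f(3)[of x] ple[OF that] that by (force simp: V_def)
  have "f x = c" if x: "(x \<longlongrightarrow> c) F" for x c
  proof -
    have "x = (\<lambda>i. x i - c) + fscale c ?one" by (auto simp: fun_eq_iff)
    then have "f x = f (\<lambda>i. x i - c) + f (fscale c ?one)" using f(1) by metis
    then have e: "f x = f (\<lambda>i. x i - c) + c" by (simp add: f(2,4))
    have "norm (f (\<lambda>i. x i - c)) \<le> 0"
    proof (rule field_le_epsilon)
      fix e :: real assume "e > 0"
      then have "\<forall>\<^sub>F i in F. norm (x i - c) \<le> e"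
        using tendstoD[OF x, of e] by (auto simp: dist_norm elim!: eventually_mono)
      then show "norm (f (\<lambda>i. x i - c)) \<le> 0 + e" using bound by simp
    qed
    then show ?thesis using e by simp
  qed
  moreover have "f (\<lambda>i. x i + y i) = f x + f y" for x y using f(1)[of x y] by (simp add: plus_fun_def)
  moreover have "f (\<lambda>i. c * x i) = c * f x" for c x using f(2)[of c x] by (simp add: fscale_def)
  ultimately show ?thesis using bound by (intro exI[of _ f]) blast
qed

text \<open>
  The operators \<open>T\<close> of the approximation property need not be weak* continuous. The adjoint of \<open>T\<close>, from the dual of
  its finite dimensional range into the third dual of \<open>X\<close>, is moved by local reflexivity to an operator
  into \<open>X*\<close>. The latter has the form \<open>m \<mapsto> (\<Sum>j. m (e j) \<phi> j)\<close> and is the adjoint of \<open>x \<mapsto> (\<Sum>j. \<phi> j x e j)\<close>,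
  whose bidual extension is \<open>z \<mapsto> (\<Sum>j. z (\<phi> j) e j)\<close>.
\<close>

lemma weak_star_continuous_approximation:
  fixes X :: "('k::real_or_complex, 'v::ab_group_add) nspace"
  assumes X: "normed_space X" and ap: "approximation_property l (bidual X)"
    and N: "finite N" "N \<subseteq> car (bidual X)" and \<epsilon>: "\<epsilon> > 0"
  shows "\<exists>(n::nat) \<phi> e. (\<forall>j<n. \<phi> j \<in> car (dual X) \<and> e j \<in> car (bidual X)) \<and>
    (\<forall>x\<in>car X. nrm (bidual X) (\<Sum>j<n. fscale (\<phi> j x) (e j)) \<le> (l + \<epsilon>) * nrm X x) \<and>
    (\<forall>z\<in>N. nrm (bidual X) ((\<Sum>j<n. fscale (z (\<phi> j)) (e j)) - z) < \<epsilon>)"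
proof -
  note D = normed_space_dual[OF X] and B = normed_space_bidual[OF X]
  have "\<exists>T. bdd_op (bidual X) (bidual X) T \<and> fin_dim_subspace (bidual X) (T ` car (bidual X)) \<and>
    op_norm (bidual X) (bidual X) T \<le> l \<and> (\<forall>z\<in>N. nrm (bidual X) (T z - z) < \<epsilon> / 2)"
  proof -
    obtain F :: "((('v \<Rightarrow> 'k) \<Rightarrow> 'k) \<Rightarrow> (('v \<Rightarrow> 'k) \<Rightarrow> 'k)) filter" where F: "F \<noteq> bot"
      "\<forall>\<^sub>F T in F. bdd_op (bidual X) (bidual X) T \<and> fin_dim_subspace (bidual X) (T ` car (bidual X)) \<and>
        op_norm (bidual X) (bidual X) T \<le> l"
      "\<forall>z\<in>car (bidual X). ((\<lambda>T. nrm (bidual X) (T z - z)) \<longlongrightarrow> 0) F"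
      using ap unfolding approximation_property_def by (elim exE conjE)
    have "\<forall>\<^sub>F T in F. \<forall>z\<in>N. nrm (bidual X) (T z - z) < \<epsilon> / 2"
    proof (rule eventually_ball_finite[OF N(1)], rule ballI)
      fix z assume "z \<in> N"
      then have "((\<lambda>T. nrm (bidual X) (T z - z)) \<longlongrightarrow> 0) F" using N(2) F(3) by blast
      then show "\<forall>\<^sub>F T in F. nrm (bidual X) (T z - z) < \<epsilon> / 2"
        by (rule order_tendstoD(2)) (use \<epsilon> in simp)
    qed
    from eventually_happens'[OF F(1) eventually_conj[OF F(2) this]] show ?thesis by blast
  qed
  then obtain T where T: "bdd_op (bidual X) (bidual X) T"
    and fd: "fin_dim_subspace (bidual X) (T ` car (bidual X))"
    and Tl: "op_norm (bidual X) (bidual X) T \<le> l"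
    and TN: "\<forall>z\<in>N. nrm (bidual X) (T z - z) < \<epsilon> / 2" by (elim exE conjE)
  have lT: "lin_op (bidual X) (bidual X) T" using T by (simp add: bdd_op_def)
  have l0: "0 \<le> l" using op_norm_nonneg[OF B B T] Tl by simp
  define M where "M = T ` car (bidual X)"
  define M' where "M' = restr (bidual X) M"
  have M': "normed_space M'" "car M' = M" "nrm M' = nrm (bidual X)" and Msub: "M \<subseteq> car (bidual X)"
    using fin_dim_subspaceD[OF B fd] by (auto simp: M'_def M_def)
  obtain n e c where fr: "finite_frame M' n e c"
    using finite_frame_exists[OF B fd] by (auto simp: M'_def M_def)
  have eM: "e j \<in> M" and e: "e j \<in> car (bidual X)" and c: "c j \<in> car (dual M')" if "j < n" for j
    using fr that Msub M' by (auto simp: finite_frame_def)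
  have ec: "m = (\<Sum>j<n. fscale (c j m) (e j))" if "m \<in> M" for m
    using fr that M' by (auto simp: finite_frame_def M'_def)
  have TM: "bdd_op (bidual X) M' T"
    using T by (auto simp: bdd_op_def lin_op_def M'_def M_def)
  note D' = normed_space_dual[OF M'(1)]
  have comp: "bdd_op (bidual X) scalars (\<lambda>z. m (T z))" if "m \<in> car (dual M')" for m
    by (rule bdd_op_compose[OF B M'(1) normed_space_scalars TM dual_bdd_op[OF that]])
  define \<zeta> where "\<zeta> j = zero_off (car (bidual X)) (\<lambda>z. c j (T z))" for j
  have \<zeta>: "\<zeta> j \<in> car (bidual (dual X))" if "j < n" for j
    unfolding \<zeta>_def by (rule zero_off_bdd_op[OF B comp[OF c[OF that]]])
  define E where "E = 1 + (\<Sum>j<n. nrm (bidual X) (e j))"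
  have E: "E > 0" using e nrm_nonneg[OF B] by (auto simp: E_def intro!: add_pos_nonneg sum_nonneg)
  define \<delta> where "\<delta> = \<epsilon> / 2 / E"
  have \<delta>: "\<delta> > 0" using \<epsilon> E by (simp add: \<delta>_def)
  have "\<exists>\<phi>. (\<forall>j<n. \<phi> j \<in> car (dual X)) \<and>
    (\<forall>m\<in>car (dual M'). nrm (dual X) (0 + (\<Sum>j<n. smul (dual X) (canon M' (e j) m) (\<phi> j)))
      \<le> (l + \<epsilon>) * nrm (dual M') m) \<and>
    (\<forall>j<n. \<forall>z\<in>N. norm (z (\<phi> j) - \<zeta> j z) < \<delta>)"
  proof (rule local_reflexivity[OF D' finite_frame_dual[OF M'(1) fr] D lin_op_zero_op[OF D] _ \<zeta> _ _ _ N \<delta>,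
        where K = l])
    show "canon M' (e j) \<in> car (bidual M')" if "j < n" for j
      using canon_bidual[OF M'(1)] eM[OF that] M' by simp
    show "0 \<le> l" "l < l + \<epsilon>" using l0 \<epsilon> by simp_all
    fix m assume m: "m \<in> car (dual M')"
    have lM: "lin_op M' scalars m" by (rule dual_lin_op[OF m])
    define W where "W = canon (dual X) 0 + (\<Sum>j<n. fscale (canon M' (e j) m) (\<zeta> j))"
    have in_: "W \<in> car (bidual (dual X))"
      using \<zeta> ns_smul[OF normed_space_dual[OF B]] ns_zero[OF normed_space_dual[OF B]]
      by (simp add: W_def canon_zero[OF D]) (auto intro!: ns_sum[OF normed_space_dual[OF B]])
    have "nrm (bidual (dual X)) W
        \<le> l * nrm (dual M') m"
      unfolding dual_simps
    proof (rule dual_norm_le[OF B in_])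
      show "0 \<le> l * op_norm M' scalars m"
        using l0 op_norm_nonneg[OF M'(1) normed_space_scalars dual_bdd_op[OF m]] by simp
      fix z assume z: "z \<in> car (bidual X)"
      have TzM: "T z \<in> M" using z by (simp add: M_def)
      have "W z = (\<Sum>j<n. c j (T z) * m (e j))"
        using z m by (simp add: W_def canon_zero[OF D] sum_fun_apply \<zeta>_def mult.commute)
      also have "\<dots> = m (\<Sum>j<n. smul M' (c j (T z)) (e j))"
        using lin_op_lincomb[OF M'(1) lM, of "{..<n}" e "\<lambda>j. c j (T z)"] eM M' by simp
      also have "(\<Sum>j<n. smul M' (c j (T z)) (e j)) = T z" using ec[OF TzM] by (simp add: M'_def)
      finally have "norm (W z) = norm (m (T z))" by (rule arg_cong)
      also have "\<dots> \<le> op_norm M' scalars m * nrm (bidual X) (T z)"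
        using dual_bound[OF M'(1) m, of "T z"] TzM M' by simp
      also have "\<dots> \<le> op_norm M' scalars m * (l * nrm (bidual X) z)"
      proof (rule mult_left_mono)
        show "nrm (bidual X) (T z) \<le> l * nrm (bidual X) z"
          using op_norm_bound[OF B B T z] mult_right_mono[OF Tl nrm_nonneg[OF B z]] by simp
      qed (rule op_norm_nonneg[OF M'(1) normed_space_scalars dual_bdd_op[OF m]])
      finally show "norm (W z)
          \<le> l * op_norm M' scalars m * nrm (bidual X) z" by (simp add: mult_ac)
    qed
    then show "nrm (bidual (dual X)) (canon (dual X) 0 + (\<Sum>j<n. fscale (canon M' (e j) m) (\<zeta> j)))
        \<le> l * nrm (dual M') m" by (simp only: W_def)
  qed
  then obtain \<phi> where \<phi>: "\<forall>j<n. \<phi> j \<in> car (dual X)"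
    "\<forall>m\<in>car (dual M'). nrm (dual X) (\<Sum>j<n. fscale (canon M' (e j) m) (\<phi> j)) \<le> (l + \<epsilon>) * nrm (dual M') m"
    "\<forall>j<n. \<forall>z\<in>N. norm (z (\<phi> j) - \<zeta> j z) < \<delta>" by auto
  have "nrm (bidual X) (\<Sum>j<n. fscale (\<phi> j x) (e j)) \<le> (l + \<epsilon>) * nrm X x" if x: "x \<in> car X" for x
  proof -
    have R: "(\<Sum>j<n. fscale (\<phi> j x) (e j)) \<in> car (bidual X)"
      using e ns_smul[OF B] by (intro ns_sum[OF B]) simp
    show ?thesis unfolding dual_simps
    proof (rule dual_norm_le[OF D R])
      show "0 \<le> (l + \<epsilon>) * nrm X x" using l0 \<epsilon> nrm_nonneg[OF X x] by simp
      fix \<psi> assume \<psi>: "\<psi> \<in> car (dual X)"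
      define m where "m = zero_off M (canon (dual X) \<psi>)"
      have m: "m \<in> car (dual M')" "op_norm M' scalars m \<le> nrm (dual X) \<psi>"
        using zero_off_restr_dual[OF B M'(1)[unfolded M'_def] Msub canon_bidual(1)[OF D \<psi>]]
          canon_bidual(2)[OF D \<psi>] by (auto simp: m_def M'_def)
      have me: "canon M' (e j) m = e j \<psi>" if "j < n" for j
        using m(1) eM[OF that] e[OF that] by (simp add: m_def)
      have s: "(\<Sum>j<n. fscale (canon M' (e j) m) (\<phi> j)) \<in> car (dual X)"
        using \<phi>(1) ns_smul[OF D] by (intro ns_sum[OF D]) simp
      have "(\<Sum>j<n. fscale (\<phi> j x) (e j)) \<psi> = (\<Sum>j<n. fscale (canon M' (e j) m) (\<phi> j)) x"
        using me by (simp add: sum_fun_apply mult.commute)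
      also have "norm \<dots> \<le> op_norm X scalars (\<Sum>j<n. fscale (canon M' (e j) m) (\<phi> j)) * nrm X x"
        by (rule dual_bound[OF X s x])
      also have "\<dots> \<le> ((l + \<epsilon>) * op_norm X scalars \<psi>) * nrm X x"
      proof (rule mult_right_mono[OF _ nrm_nonneg[OF X x]])
        have "op_norm X scalars (\<Sum>j<n. fscale (canon M' (e j) m) (\<phi> j)) \<le> (l + \<epsilon>) * op_norm M' scalars m"
          using \<phi>(2) m(1) by simp
        also have "\<dots> \<le> (l + \<epsilon>) * op_norm X scalars \<psi>" using m(2) l0 \<epsilon> by (intro mult_left_mono) auto
        finally show "op_norm X scalars (\<Sum>j<n. fscale (canon M' (e j) m) (\<phi> j)) \<le> (l + \<epsilon>) * op_norm X scalars \<psi>" .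
      qed
      finally show "norm ((\<Sum>j<n. fscale (\<phi> j x) (e j)) \<psi>) \<le> (l + \<epsilon>) * nrm X x * nrm (dual X) \<psi>"
        by (simp add: mult_ac)
    qed
  qed
  moreover have "nrm (bidual X) ((\<Sum>j<n. fscale (z (\<phi> j)) (e j)) - z) < \<epsilon>" if z: "z \<in> N" for z
  proof -
    have zB: "z \<in> car (bidual X)" using z N by blast
    then have TzM: "T z \<in> M" by (simp add: M_def)
    have "(\<Sum>j<n. fscale (z (\<phi> j)) (e j)) - T z = (\<Sum>j<n. fscale (z (\<phi> j) - \<zeta> j z) (e j))" (is "?d = ?s")
      using zB by (subst ec[OF TzM])
        (auto simp: \<zeta>_def fun_eq_iff sum_fun_apply sum_subtractf left_diff_distrib)
    have s: "?s \<in> car (bidual X)" using e ns_smul[OF B] by (intro ns_sum[OF B]) simp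
    have "nrm (bidual X) ?s \<le> (\<Sum>j<n. nrm (bidual X) (fscale (z (\<phi> j) - \<zeta> j z) (e j)))"
      using e ns_smul[OF B] by (intro nrm_sum_le[OF B]) simp
    also have "\<dots> \<le> (\<Sum>j<n. \<delta> * nrm (bidual X) (e j))"
    proof (rule sum_mono)
      fix j assume "j \<in> {..<n}"
      then show "nrm (bidual X) (fscale (z (\<phi> j) - \<zeta> j z) (e j)) \<le> \<delta> * nrm (bidual X) (e j)"
        using nrm_smul[OF B e, of j "z (\<phi> j) - \<zeta> j z"] \<phi>(3) z nrm_nonneg[OF B e, of j]
        by (auto simp: less_imp_le intro!: mult_right_mono)
    qed
    also have "\<dots> = \<delta> * (E - 1)" by (simp add: E_def sum_distrib_left)
    also have "\<dots> < \<delta> * E" using \<delta> by simp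
    also have "\<dots> = \<epsilon> / 2" using E by (simp add: \<delta>_def)
    finally have s2: "nrm (bidual X) ?s < \<epsilon> / 2" .
    have TzB: "T z \<in> car (bidual X)" using TzM Msub by blast
    have e: "(\<Sum>j<n. fscale (z (\<phi> j)) (e j)) - z = ?s + (T z - z)"
      using \<open>?d = ?s\<close> by (simp add: algebra_simps)
    have "nrm (bidual X) ((\<Sum>j<n. fscale (z (\<phi> j)) (e j)) - z)
        \<le> nrm (bidual X) ?s + nrm (bidual X) (T z - z)"
      unfolding e by (rule nrm_add_le[OF B s ns_diff[OF B TzB zB]])
    then show ?thesis using s2 TN z by fastforce
  qed
  ultimately show ?thesis using \<phi>(1) e by (intro exI[of _ n] exI[of _ \<phi>] exI[of _ e]) simp
qed

section \<open>Completions and their functionals\<close>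

lemma le_if_le_mult_add: "(\<And>e. e > 0 \<Longrightarrow> a \<le> K * e) \<Longrightarrow> a \<le> (0::real)" for K :: real
proof (rule field_le_epsilon)
  fix e :: real assume *: "\<And>e. e > 0 \<Longrightarrow> a \<le> K * e" and e: "e > 0"
  have "a \<le> K * (e / (\<bar>K\<bar> + 1))" using e by (intro *) auto
  also have "\<dots> \<le> (\<bar>K\<bar> + 1) * (e / (\<bar>K\<bar> + 1))" using e by (intro mult_right_mono) auto
  finally show "a \<le> 0 + e" by simp
qed

lemma completion_subset: "car (completion S) \<subseteq> car (bidual S)"
  by (auto simp: completion_def)

lemma completion_simps [simp]:
  "smul (completion S) = fscale" "nrm (completion S) = op_norm (dual S) scalars"
  by (simp_all add: completion_def)

lemma completionE:
  assumes "z \<in> car (completion S)" "e > 0"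
  obtains v where "v \<in> car S" "nrm (bidual S) (z - canon S v) < e"
  using assms by (auto simp: completion_def)

lemma canon_completion:
  assumes S: "normed_space S" and v: "v \<in> car S"
  shows "canon S v \<in> car (completion S)"
proof -
  have "nrm (bidual S) (canon S v - canon S v) = 0"
    using nrm_zero[OF normed_space_bidual[OF S]] by simp
  then show ?thesis using canon_bidual[OF S v] v by (force simp: completion_def)
qed

lemma normed_space_completion:
  assumes S: "normed_space S"
  shows "normed_space (completion S)"
  unfolding completion_def
proof (rule normed_space_restr[OF normed_space_bidual[OF S]])
  note B = normed_space_bidual[OF S]
  let ?C = "{z \<in> car (bidual S). \<forall>e>0. \<exists>x\<in>car S. nrm (bidual S) (z - canon S x) < e}"
  interpret vector_space "smul (bidual S)" by (rule ns_vector_space[OF B])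
  note cB = canon_bidual(1)[OF S]
  show "?C \<subseteq> car (bidual S)" by auto
  show "subspace ?C"
  proof (rule subspaceI)
    show "0 \<in> ?C"
      using ns_zero[OF B] ns_zero[OF S] canon_zero[OF S] nrm_zero[OF B] by (auto intro!: bexI[of _ 0])
  next
    fix x y assume x: "x \<in> ?C" and y: "y \<in> ?C"
    show "x + y \<in> ?C"
    proof (intro CollectI conjI allI impI)
      show "x + y \<in> car (bidual S)" using x y by (intro ns_add[OF B]) auto
      fix e :: real assume "e > 0"
      then have "e / 2 > 0" by simp
      then obtain v w where v: "v \<in> car S" "nrm (bidual S) (x - canon S v) < e / 2"
        and w: "w \<in> car S" "nrm (bidual S) (y - canon S w) < e / 2" using x y by blast
      have e: "(x + y) - canon S (v + w) = (x - canon S v) + (y - canon S w)"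
        by (simp add: canon_add[OF S v(1) w(1)])
      have "nrm (bidual S) ((x + y) - canon S (v + w))
          \<le> nrm (bidual S) (x - canon S v) + nrm (bidual S) (y - canon S w)"
        unfolding e using x y by (intro nrm_add_le[OF B] ns_diff[OF B] cB v(1) w(1)) auto
      then show "\<exists>u\<in>car S. nrm (bidual S) ((x + y) - canon S u) < e"
        using v w ns_add[OF S v(1) w(1)] by (intro bexI[of _ "v + w"]) auto
    qed
  next
    fix c x assume x: "x \<in> ?C"
    show "smul (bidual S) c x \<in> ?C"
    proof (intro CollectI conjI allI impI)
      show "smul (bidual S) c x \<in> car (bidual S)" using x by (intro ns_smul[OF B]) auto
      fix e :: real assume "e > 0"
      then have "e / (norm c + 1) > 0" by (simp add: add_nonneg_pos)
      then obtain v where v: "v \<in> car S" "nrm (bidual S) (x - canon S v) < e / (norm c + 1)"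
        using x by blast
      have d: "x - canon S v \<in> car (bidual S)" using x cB[OF v(1)] by (intro ns_diff[OF B]) auto
      have "smul (bidual S) c x - canon S (smul S c v) = smul (bidual S) c (x - canon S v)"
        by (simp add: canon_smul[OF S v(1)] scale_right_diff_distrib[simplified])
      then have "nrm (bidual S) (smul (bidual S) c x - canon S (smul S c v))
          = norm c * nrm (bidual S) (x - canon S v)" using nrm_smul[OF B d] by simp
      also have "\<dots> \<le> (norm c + 1) * nrm (bidual S) (x - canon S v)"
        by (intro mult_right_mono nrm_nonneg[OF B d]) simp
      also have "\<dots> < e"
      proof -
        have "norm c + 1 > 0" by (simp add: add_nonneg_pos)
        then show ?thesis using v(2) by (simp only: pos_less_divide_eq mult.commute)
      qed
      finally show "\<exists>u\<in>car S. nrm (bidual S) (smul (bidual S) c x - canon S u) < e"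
        using ns_smul[OF S v(1)] by blast
    qed
  qed
qed

text \<open>
  Functionals on a space and on its completion correspond isometrically; this map and the next are
  inverse to each other.
\<close>

definition fnl_ext :: "('k::real_or_complex, 'v::ab_group_add) nspace \<Rightarrow> ('v \<Rightarrow> 'k) \<Rightarrow> (('v \<Rightarrow> 'k) \<Rightarrow> 'k) \<Rightarrow> 'k" where
  "fnl_ext S f = zero_off (car (completion S)) (\<lambda>z. z f)"

definition fnl_restrict :: "('k::real_or_complex, 'v::ab_group_add) nspace \<Rightarrow> ((('v \<Rightarrow> 'k) \<Rightarrow> 'k) \<Rightarrow> 'k) \<Rightarrow> 'v \<Rightarrow> 'k" where
  "fnl_restrict S P = zero_off (car S) (\<lambda>v. P (canon S v))"

lemma fnl_ext_dual:
  assumes S: "normed_space S" and f: "f \<in> car (dual S)"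
  shows "fnl_ext S f \<in> car (dual (completion S))"
    "op_norm (completion S) scalars (fnl_ext S f) \<le> op_norm S scalars f"
proof -
  have "norm (z f) \<le> op_norm S scalars f * nrm (completion S) z" if z: "z \<in> car (completion S)" for z
  proof -
    have "z \<in> car (bidual S)" using z completion_subset by blast
    from dual_bound[OF normed_space_dual[OF S] this f] show ?thesis by (simp add: mult.commute)
  qed
  moreover have "0 \<le> op_norm S scalars f" using nrm_nonneg[OF normed_space_dual[OF S] f] by simp
  ultimately show "fnl_ext S f \<in> car (dual (completion S))"
    "op_norm (completion S) scalars (fnl_ext S f) \<le> op_norm S scalars f"
    unfolding fnl_ext_def
    by (intro zero_off_dual[OF normed_space_completion[OF S], where K = "op_norm S scalars f"]; simp)+
qed

lemma fnl_restrict_dual: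
  assumes S: "normed_space S" and P: "P \<in> car (dual (completion S))"
  shows "fnl_restrict S P \<in> car (dual S)"
    "op_norm S scalars (fnl_restrict S P) \<le> op_norm (completion S) scalars P"
proof -
  note C = normed_space_completion[OF S] and cc = canon_completion[OF S]
  have P0: "0 \<le> op_norm (completion S) scalars P" using nrm_nonneg[OF normed_space_dual[OF C] P] by simp
  have b: "norm (P (canon S v)) \<le> op_norm (completion S) scalars P * nrm S v" if v: "v \<in> car S" for v
    using dual_bound[OF C P cc[OF v]] mult_left_mono[OF canon_bidual(2)[OF S v] P0] by simp
  have a: "P (canon S (v + w)) = P (canon S v) + P (canon S w)" if "v \<in> car S" "w \<in> car S" for v w
    using dual_add[OF P cc[OF that(1)] cc[OF that(2)]] by (simp add: canon_add[OF S that])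
  have s: "P (canon S (smul S c v)) = c * P (canon S v)" if "v \<in> car S" for c v
    using dual_smul[OF P cc[OF that], of c] by (simp add: canon_smul[OF S that])
  show "fnl_restrict S P \<in> car (dual S)"
    "op_norm S scalars (fnl_restrict S P) \<le> op_norm (completion S) scalars P"
    unfolding fnl_restrict_def
    by (intro zero_off_dual[OF S, where K = "op_norm (completion S) scalars P"]; simp add: a b s P0)+
qed

lemma fnl_restrict_ext:
  assumes S: "normed_space S" and f: "f \<in> car (dual S)"
  shows "fnl_restrict S (fnl_ext S f) = f"
  by (rule dual_eqI[OF fnl_restrict_dual(1)[OF S fnl_ext_dual(1)[OF S f]] f])
    (simp add: fnl_restrict_def fnl_ext_def canon_completion[OF S] f)

text \<open>
  Both sides are continuous in \<open>z\<close> and agree on the canonical image of the space, which is dense.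
\<close>

lemma completion_apply:
  assumes S: "normed_space S" and P: "P \<in> car (dual (completion S))" and z: "z \<in> car (completion S)"
  shows "P z = z (fnl_restrict S P)"
proof -
  note C = normed_space_completion[OF S]
  let ?f = "fnl_restrict S P"
  note f = fnl_restrict_dual(1)[OF S P]
  have zB: "z \<in> car (bidual S)" using z completion_subset by blast
  let ?K = "op_norm (completion S) scalars P + op_norm S scalars ?f"
  have P0: "0 \<le> op_norm (completion S) scalars P" using nrm_nonneg[OF normed_space_dual[OF C] P] by simp
  have f0: "0 \<le> op_norm S scalars ?f" using nrm_nonneg[OF normed_space_dual[OF S] f] by simp
  have "norm (P z - z ?f) \<le> ?K * e" if e: "e > 0" for e
  proof -
    obtain v where v: "v \<in> car S" "nrm (bidual S) (z - canon S v) < e" using completionE[OF z e] by blast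
    note cv = canon_completion[OF S v(1)]
    have zv: "z - canon S v \<in> car (completion S)" by (rule ns_diff[OF C z cv])
    then have zvB: "z - canon S v \<in> car (bidual S)" using completion_subset by blast
    have "P z = P (z - canon S v) + P (canon S v)" using dual_add[OF P zv cv] by simp
    moreover have "P (canon S v) = ?f v" using v by (simp add: fnl_restrict_def)
    moreover have "z ?f = (z - canon S v) ?f + ?f v" using f by simp
    ultimately have "norm (P z - z ?f) \<le> norm (P (z - canon S v)) + norm ((z - canon S v) ?f)"
      by (metis add_diff_cancel_right norm_triangle_ineq4)
    also have "norm (P (z - canon S v)) \<le> op_norm (completion S) scalars P * e"
      using order_trans[OF dual_bound[OF C P zv] mult_left_mono[OF _ P0]] v(2) by simp
    also have "norm ((z - canon S v) ?f) \<le> op_norm S scalars ?f * e"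
    proof -
      have "norm ((z - canon S v) ?f) \<le> nrm (bidual S) (z - canon S v) * op_norm S scalars ?f"
        using dual_bound[OF normed_space_dual[OF S] zvB f] by simp
      also have "\<dots> \<le> e * op_norm S scalars ?f" using v(2) f0 by (intro mult_right_mono) auto
      finally show ?thesis by (simp add: mult.commute)
    qed
    finally show ?thesis by (simp add: algebra_simps)
  qed
  then have "norm (P z - z ?f) \<le> 0" by (rule le_if_le_mult_add)
  then show ?thesis by simp
qed

lemma fnl_ext_restrict:
  assumes "normed_space S" "P \<in> car (dual (completion S))"
  shows "fnl_ext S (fnl_restrict S P) = P"
  by (rule dual_eqI[OF fnl_ext_dual(1)[OF assms(1) fnl_restrict_dual(1)[OF assms]] assms(2)])
    (simp add: fnl_ext_def completion_apply[OF assms])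

lemma fnl_restrict_linear:
  "fnl_restrict T (P + fscale c Q) = fnl_restrict T P + fscale c (fnl_restrict T Q)"
  by (auto simp: fnl_restrict_def zero_off_def fun_eq_iff)

lemma completion_norm_le:
  assumes S: "normed_space S" and z: "z \<in> car (completion S)" and "0 \<le> K"
    and "\<And>f. f \<in> car (dual S) \<Longrightarrow> norm (z f) \<le> K * op_norm S scalars f"
  shows "nrm (completion S) z \<le> K"
  unfolding completion_simps
  using z completion_subset assms by (intro dual_norm_le[OF normed_space_dual[OF S]]) auto

section \<open>The Aron-Berner extension as an operator\<close>

lemma functional_sym_form:
  assumes X: "normed_space X" and S: "normed_space (sym_tensor_space k \<beta> X)"
    and le: "\<And>v. v \<in> sym_tensors k X \<Longrightarrow> \<beta> X v \<le> pi_norm k X v"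
    and f: "f \<in> car (dual (sym_tensor_space k \<beta> X))"
  shows "\<exists>A. sym_form_of k X (\<lambda>x. f (tpow k (smul X) x)) A"
    and "sym_form_of k X (\<lambda>x. f (tpow k (smul X) x)) A \<Longrightarrow> \<exists>C. bounded_form k X C A"
proof -
  show "\<exists>A. sym_form_of k X (\<lambda>x. f (tpow k (smul X) x)) A"
  proof (rule sym_form_exists)
    show "f (v + w) = f v + f w" if "v \<in> sym_tensors k X" "w \<in> sym_tensors k X" for v w
      by (rule dual_add[OF f]) (use that in simp_all)
    show "f (fscale c v) = c * f v" if "v \<in> sym_tensors k X" for c v
      using dual_smul[OF f, of v c] that by (simp only: sym_tensor_space_simps)
  qed
  show "\<exists>C. bounded_form k X C A" if "sym_form_of k X (\<lambda>x. f (tpow k (smul X) x)) A"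
    using sym_form_bounded[OF X that _ functional_poly_bound[OF X S le f]]
      nrm_nonneg[OF normed_space_dual[OF S] f] by fastforce
qed

definition poly_form :: "nat \<Rightarrow> ('k::real_or_complex, 'v::ab_group_add) nspace \<Rightarrow> (('k, 'v) tensor \<Rightarrow> 'k) \<Rightarrow>
    'v list \<Rightarrow> 'k" where
  "poly_form k X f = (SOME A. sym_form_of k X (\<lambda>x. f (tpow k (smul X) x)) A)"

text \<open>
  The Aron-Berner extension on the level of functionals on the tensor products before completion,
  where its values are finite sums of iterated limits.
\<close>

definition ab_ext :: "nat \<Rightarrow> ('k::real_or_complex, 'v::ab_group_add) nspace \<Rightarrow> (('k, 'v) tensor \<Rightarrow> 'k) \<Rightarrow>
    ('k, ('v \<Rightarrow> 'k) \<Rightarrow> 'k) tensor \<Rightarrow> 'k" where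
  "ab_ext k X f = zero_off (sym_tensors k (bidual X))
     (tform (bidual X) (\<lambda>zs. iter_lim X zs (poly_form k X f)))"

lemma functional_eqI:
  assumes S: "normed_space (sym_tensor_space k \<beta> X)"
    and f: "f \<in> car (dual (sym_tensor_space k \<beta> X))" and g: "g \<in> car (dual (sym_tensor_space k \<beta> X))"
    and eq: "\<And>x. x \<in> car X \<Longrightarrow> f (tpow k (smul X) x) = g (tpow k (smul X) x)"
  shows "f = g"
proof (rule dual_eqI[OF f g])
  fix v assume "v \<in> car (sym_tensor_space k \<beta> X)"
  then obtain cs where cs: "represents k X cs v" using mem_sym_tensors_iff[of v k X] by auto
  show "f v = g v"
    unfolding functional_tsum[OF S f cs] functional_tsum[OF S g cs]
    using cs eq by (intro arg_cong[of _ _ sum_list] map_cong) (auto simp: represents_def)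
qed

text \<open>
  The two maps are the restrictions of one s-tensor norm to the types of \<open>X\<close> and of its bidual.
\<close>

locale two_tensor_norms =
  fixes k :: nat and X :: "('k::real_or_complex, 'v::ab_group_add) nspace"
    and \<beta> :: "('k, 'v) norm_assignment" and \<beta>' :: "('k, ('v \<Rightarrow> 'k) \<Rightarrow> 'k) norm_assignment"
  assumes st: "s_tensor_norm k \<beta> \<beta>'" and X: "normed_space X"
begin

abbreviation (input) "S \<equiv> sym_tensor_space k \<beta> X"
abbreviation (input) "S' \<equiv> sym_tensor_space k \<beta>' (bidual X)"

lemmas B = normed_space_bidual[OF X]
lemmas nS = s_tensor_normD(1)[OF st X]
lemmas nS' = s_tensor_normD(2)[OF st B]

lemma
  assumes "f \<in> car (dual S)"
  shows form_S: "\<exists>A. sym_form_of k X (\<lambda>x. f (tpow k (smul X) x)) A"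
    and bounded_form_S: "sym_form_of k X (\<lambda>x. f (tpow k (smul X) x)) A \<Longrightarrow> \<exists>C. bounded_form k X C A"
  using functional_sym_form[OF X nS _ assms] s_tensor_normD(6)[OF st X] by blast+

lemma
  assumes "g \<in> car (dual S')"
  shows form_S': "\<exists>A. sym_form_of k (bidual X) (\<lambda>z. g (tpow k fscale z)) A"
    and bounded_form_S': "sym_form_of k (bidual X) (\<lambda>z. g (tpow k fscale z)) A \<Longrightarrow>
      \<exists>C. bounded_form k (bidual X) C A"
  using functional_sym_form[OF B nS' _ assms] s_tensor_normD(7)[OF st B] by auto

lemma poly_form:
  "f \<in> car (dual S) \<Longrightarrow> sym_form_of k X (\<lambda>x. f (tpow k (smul X) x)) (poly_form k X f)"
  unfolding poly_form_def by (rule someI_ex[OF form_S])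

lemma ab_ext_dual:
  assumes f: "f \<in> car (dual S)"
  shows "ab_ext k X f \<in> car (dual S')"
    "op_norm S' scalars (ab_ext k X f) \<le> op_norm S scalars f * 2 ^ k * polarization_constant k"
proof -
  have "0 \<le> op_norm S scalars f * 2 ^ k * polarization_constant k"
    using nrm_nonneg[OF normed_space_dual[OF nS] f] polarization_constant_nonneg by simp
  then show "ab_ext k X f \<in> car (dual S')"
    "op_norm S' scalars (ab_ext k X f) \<le> op_norm S scalars f * 2 ^ k * polarization_constant k"
    unfolding ab_ext_def
    using zero_off_dual[OF nS', of "tform (bidual X) (\<lambda>zs. iter_lim X zs (poly_form k X f))"
        "op_norm S scalars f * 2 ^ k * polarization_constant k"]
      aron_berner_form_bound[OF st X f poly_form[OF f]]
    by (simp_all add: tform_add tform_scale)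
qed

text \<open>
  Symmetric forms are determined by their diagonals, so any form of the polynomial may be used.
\<close>

lemma ab_ext_tpow:
  assumes f: "f \<in> car (dual S)" and A: "sym_form_of k X (\<lambda>x. f (tpow k (smul X) x)) A"
    and z: "z \<in> car (bidual X)"
  shows "ab_ext k X f (tpow k fscale z) = iter_lim X (replicate k z) A"
proof -
  note pf = poly_form[OF f]
  obtain C where C: "bounded_form k X C A" using bounded_form_S[OF f A] by blast
  obtain C1 where C1: "bounded_form k X C1 (poly_form k X f)" using bounded_form_S[OF f pf] by blast
  have "represents k (bidual X) [(1, z)] (tpow k fscale z)" using z by (auto simp: represents_def)
  from tform_tsum[OF B bounded_formD(1)[OF bounded_form_iter_lim[OF X C1]] this]
  have "ab_ext k X f (tpow k fscale z) = iter_lim X (replicate k z) (poly_form k X f)"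
    using tpow_sym_tensors[OF z, of k] by (simp add: ab_ext_def)
  also have "\<dots> = iter_lim X (replicate k z) A + 0 * iter_lim X (replicate k z) A"
    using C C1 z by (intro iter_lim_bounded_linear(2)[OF X, of _ C1 _ C _ C])
      (auto simp: sym_form_unique[OF X pf A])
  finally show ?thesis by simp
qed

lemma ab_ext_linear:
  assumes f: "f \<in> car (dual S)" and g: "g \<in> car (dual S)"
  shows "ab_ext k X (f + fscale c g) = ab_ext k X f + fscale c (ab_ext k X g)"
proof -
  note D = normed_space_dual[OF nS] and D' = normed_space_dual[OF nS']
  have cg: "fscale c g \<in> car (dual S)" using ns_smul[OF D g] by simp
  note h = ns_add[OF D f cg]
  note pf = poly_form[OF f] and pg = poly_form[OF g]
  obtain C1 where C1: "bounded_form k X C1 (poly_form k X f)" using bounded_form_S[OF f pf] by blast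
  obtain C2 where C2: "bounded_form k X C2 (poly_form k X g)" using bounded_form_S[OF g pg] by blast
  let ?A = "\<lambda>xs. poly_form k X f xs + c * poly_form k X g xs"
  have A: "sym_form_of k X (\<lambda>x. (f + fscale c g) (tpow k (smul X) x)) ?A"
    using pf pg unfolding sym_form_of_def multilinear_on_def by (auto simp: algebra_simps)
  obtain C where C: "bounded_form k X C ?A" using bounded_form_S[OF h A] by blast
  have cg': "fscale c (ab_ext k X g) \<in> car (dual S')"
    using ns_smul[OF D' ab_ext_dual(1)[OF g]] by simp
  show ?thesis
  proof (rule functional_eqI[OF nS' ab_ext_dual(1)[OF h] ns_add[OF D' ab_ext_dual(1)[OF f] cg']])
    fix z assume z: "z \<in> car (bidual X)"
    have "iter_lim X (replicate k z) ?A = iter_lim X (replicate k z) (poly_form k X f)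
        + c * iter_lim X (replicate k z) (poly_form k X g)"
      using C C1 C2 z by (intro iter_lim_bounded_linear(2)[OF X, of _ C _ C1 _ C2]) auto
    then show "ab_ext k X (f + fscale c g) (tpow k (smul (bidual X)) z)
        = (ab_ext k X f + fscale c (ab_ext k X g)) (tpow k (smul (bidual X)) z)"
      unfolding dual_simps
      by (rule trans[OF trans[OF ab_ext_tpow[OF h A z]]])
        (simp add: ab_ext_tpow[OF f pf z] ab_ext_tpow[OF g pg z])
  qed
qed

text \<open>
  The powers of single vectors span a dense subspace of the completed tensor product, so that at most one functional has
  the prescribed values on them.
\<close>

lemma aron_berner_eq:
  assumes P: "P \<in> car (polys k \<beta> X)"
  shows "aron_berner k \<beta> \<beta>' X P = fnl_ext S' (ab_ext k X (fnl_restrict S P))"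
  unfolding aron_berner_def
proof (rule the_equality)
  have P': "P \<in> car (dual (completion S))" using P by (simp add: polys_def completed_tensors_def)
  let ?f = "fnl_restrict S P"
  note f = fnl_restrict_dual(1)[OF nS P']
  have form: "sym_form_of k X (\<lambda>x. P (ctpow k \<beta> X x)) = sym_form_of k X (\<lambda>x. ?f (tpow k (smul X) x))"
    by (auto simp: sym_form_of_def fun_eq_iff ctpow_def fnl_restrict_def tpow_sym_tensors)
  have val: "ab_ext k X ?f (tpow k fscale z) = aron_berner_poly k X (\<lambda>x. P (ctpow k \<beta> X x)) z"
    if "z \<in> car (bidual X)" for z
    unfolding aron_berner_poly_def form poly_form_def[symmetric] by (rule ab_ext_tpow[OF f poly_form[OF f] that])
  note F = ab_ext_dual(1)[OF f]
  have ct: "ctpow k \<beta>' (bidual X) z = canon S' (tpow k fscale z)" for z by (simp add: ctpow_def)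
  have tz: "tpow k fscale z \<in> car S'" if "z \<in> car (bidual X)" for z
    using tpow_sym_tensors[OF that, of k] by simp
  show "fnl_ext S' (ab_ext k X ?f) \<in> car (polys k \<beta>' (bidual X)) \<and>
    (\<forall>z\<in>car (bidual X). fnl_ext S' (ab_ext k X ?f) (ctpow k \<beta>' (bidual X) z) =
      aron_berner_poly k X (\<lambda>x. P (ctpow k \<beta> X x)) z)"
    using fnl_ext_dual(1)[OF nS' F] val F
    by (simp add: polys_def completed_tensors_def fnl_ext_def ct canon_completion[OF nS' tz])
  fix Q assume Q: "Q \<in> car (polys k \<beta>' (bidual X)) \<and>
    (\<forall>z\<in>car (bidual X). Q (ctpow k \<beta>' (bidual X) z) = aron_berner_poly k X (\<lambda>x. P (ctpow k \<beta> X x)) z)"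
  then have Q': "Q \<in> car (dual (completion S'))" by (simp add: polys_def completed_tensors_def)
  have "fnl_restrict S' Q = ab_ext k X ?f"
    by (rule functional_eqI[OF nS' fnl_restrict_dual(1)[OF nS' Q'] F])
      (use Q val in \<open>simp add: fnl_restrict_def ct tz[simplified]\<close>)
  then show "Q = fnl_ext S' (ab_ext k X ?f)" using fnl_ext_restrict[OF nS' Q'] by simp
qed

lemma Theta_apply:
  assumes w: "w \<in> car (completed_tensors k \<beta>' (bidual X))" and P: "P \<in> car (polys k \<beta> X)"
  shows "Theta k \<beta> \<beta>' X w P = w (ab_ext k X (fnl_restrict S P))"
  using w P by (simp add: Theta_def aron_berner_eq fnl_ext_def completed_tensors_def)

lemma Theta_bdd_op:
  "bdd_op (completed_tensors k \<beta>' (bidual X)) (bidual (completed_tensors k \<beta> X)) (Theta k \<beta> \<beta>' X)"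
proof (rule bdd_opI[where K = "2 ^ k * polarization_constant k"])
  let ?Z = "completed_tensors k \<beta>' (bidual X)" and ?P = "polys k \<beta> X"
  let ?K = "2 ^ k * polarization_constant k"
  have K0: "0 \<le> ?K" using polarization_constant_nonneg by simp
  have Zc: "?Z = completion S'" and Pd: "?P = dual (completion S)"
    by (simp_all add: completed_tensors_def polys_def)
  note nP = normed_space_dual[OF normed_space_completion[OF nS], folded Pd]
  note nZ = normed_space_completion[OF nS', folded Zc]
  define h where "h P = ab_ext k X (fnl_restrict S P)" for P
  have h: "h P \<in> car (dual S')" "op_norm S' scalars (h P) \<le> ?K * nrm ?P P" if P: "P \<in> car ?P" for P
  proof -
    have P': "P \<in> car (dual (completion S))" using P by (simp add: Pd)
    note f = fnl_restrict_dual[OF nS P']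
    show "h P \<in> car (dual S')" unfolding h_def by (rule ab_ext_dual(1)[OF f(1)])
    show "op_norm S' scalars (h P) \<le> ?K * nrm ?P P"
      using order_trans[OF ab_ext_dual(2)[OF f(1), unfolded mult.assoc] mult_right_mono[OF f(2) K0]]
      by (simp add: h_def Pd mult_ac)
  qed
  have hlin: "h (P + fscale c Q) = h P + fscale c (h Q)" if "P \<in> car ?P" "Q \<in> car ?P" for c P Q
    using that unfolding h_def Pd
    by (simp add: fnl_restrict_linear ab_ext_linear fnl_restrict_dual(1)[OF nS])
  have Th: "Theta k \<beta> \<beta>' X w = zero_off (car ?P) (\<lambda>P. w (h P))" if "w \<in> car ?Z" for w
    using Theta_apply[OF that] by (auto simp: fun_eq_iff zero_off_def Theta_def h_def)
  have W: "Theta k \<beta> \<beta>' X w \<in> car (dual ?P)" "op_norm ?P scalars (Theta k \<beta> \<beta>' X w) \<le> ?K * nrm ?Z w"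
    if w: "w \<in> car ?Z" for w
  proof -
    have wB: "w \<in> car (bidual S')" using w completion_subset by (auto simp: Zc)
    have lin: "w (h (P + fscale c Q)) = w (h P) + c * w (h Q)" if "P \<in> car ?P" "Q \<in> car ?P" for c P Q
      using dual_add[OF wB h(1)[OF that(1)], of "fscale c (h Q)"] dual_smul[OF wB h(1)[OF that(2)], of c]
        ns_smul[OF normed_space_dual[OF nS'] h(1)[OF that(2)], of c] hlin[OF that] by simp
    have b: "norm (w (h P)) \<le> (?K * nrm ?Z w) * nrm ?P P" if P: "P \<in> car ?P" for P
    proof -
      have "norm (w (h P)) \<le> nrm ?Z w * op_norm S' scalars (h P)"
        using dual_bound[OF normed_space_dual[OF nS'] wB h(1)[OF P]] by (simp add: Zc)
      also have "\<dots> \<le> nrm ?Z w * (?K * nrm ?P P)" by (rule mult_left_mono[OF h(2)[OF P] nrm_nonneg[OF nZ w]])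
      finally show ?thesis by (simp add: mult_ac)
    qed
    have one: "fscale 1 P = P" for P :: "((('k, 'v) tensor \<Rightarrow> 'k) \<Rightarrow> 'k) \<Rightarrow> 'k" by (simp add: fscale_def)
    have z: "0 \<in> car ?P" by (rule ns_zero[OF nP])
    have w0: "w (h 0) = 0" using b[OF z] nrm_zero[OF nP] by simp
    show "Theta k \<beta> \<beta>' X w \<in> car (dual ?P)" "op_norm ?P scalars (Theta k \<beta> \<beta>' X w) \<le> ?K * nrm ?Z w"
      unfolding Th[OF w]
      using lin[of _ _ 1] lin[OF z] w0 b K0 nrm_nonneg[OF nZ w]
      by (intro zero_off_dual[OF nP, where K = "?K * nrm ?Z w"]; simp add: one Pd)+
  qed
  show "lin_op ?Z (bidual (completed_tensors k \<beta> X)) (Theta k \<beta> \<beta>' X)"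
    unfolding lin_op_def
  proof (intro conjI ballI allI)
    show "Theta k \<beta> \<beta>' X ` car ?Z \<subseteq> car (bidual (completed_tensors k \<beta> X))"
      using W(1) by (auto simp: polys_def)
    show "Theta k \<beta> \<beta>' X (v + w) = Theta k \<beta> \<beta>' X v + Theta k \<beta> \<beta>' X w"
      if "v \<in> car ?Z" "w \<in> car ?Z" for v w
      unfolding Th[OF that(1)] Th[OF that(2)] Th[OF ns_add[OF nZ that]] by (auto simp: zero_off_def)
    show "Theta k \<beta> \<beta>' X (smul ?Z c w) = smul (bidual (completed_tensors k \<beta> X)) c (Theta k \<beta> \<beta>' X w)"
      if "w \<in> car ?Z" for c w
      unfolding Th[OF that] Th[OF ns_smul[OF nZ that]] by (auto simp: zero_off_def Zc)
  qed
  show "nrm (bidual (completed_tensors k \<beta> X)) (Theta k \<beta> \<beta>' X w) \<le> ?K * nrm ?Z w"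
    if "w \<in> car ?Z" for w using W(2)[OF that] by (simp add: polys_def)
qed

end

section \<open>Complementation\<close>

lemma subspace_of_fin_dim:
  assumes X: "normed_space X" and F: "fin_dim_subspace X F"
    and G: "module.subspace (smul X) G" "G \<subseteq> F"
  shows "fin_dim_subspace X G"
proof -
  interpret vector_space "smul X" by (rule ns_vector_space[OF X])
  obtain B where B: "finite B" "F = span B" and FX: "F \<subseteq> car X" using F by (auto simp: fin_dim_subspace_def)
  obtain C where C: "C \<subseteq> G" "independent C" "G \<subseteq> span C" using maximal_independent_subset by blast
  have "finite C" using independent_span_bound[OF B(1) C(2)] C(1) G(2) B(2) by blast
  moreover have "G = span C" using C G(1) span_minimal by blast
  ultimately show ?thesis using G FX unfolding fin_dim_subspace_def by blast
qed

text \<open>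
  Evaluating \<open>E\<close> at the points of \<open>F\<close> gives an operator \<open>R\<close> from \<open>F\<close> into the bidual of \<open>Z\<close>, which is the canonical map on the part
  \<open>G\<close> of \<open>F\<close> in the range of \<open>i\<close>. Let \<open>P0\<close> project \<open>F\<close> onto \<open>G\<close> and \<open>i (T0 x) = P0 x\<close>. Then \<open>H = R - T0\<close> vanishes on \<open>G\<close>,
  hence has an expansion with coordinates \<open>c1 j\<close> that vanish on \<open>G\<close>, and local reflexivity moves \<open>H\<close>
  into \<open>Z\<close> while \<open>T0\<close> is kept.
\<close>

lemma locally_complemented_if_dual_complemented:
  fixes Z :: "('k::real_or_complex, 'v::ab_group_add) nspace" and W :: "('k, 'w::ab_group_add) nspace"
  assumes Z: "normed_space Z" and W: "normed_space W" and i: "lin_op Z W i"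
    and inj: "\<And>z. z \<in> car Z \<Longrightarrow> i z = 0 \<Longrightarrow> z = 0"
    and dc: "dual_complemented l Z W i" and l: "0 \<le> l" "l < c"
  shows "locally_complemented c Z W i"
  unfolding locally_complemented_def
proof (intro allI impI)
  fix F assume F: "fin_dim_subspace W F"
  note D = normed_space_dual[OF Z] and DW = normed_space_dual[OF W] and B = normed_space_bidual[OF Z]
  interpret vZ: vector_space "smul Z" by (rule ns_vector_space[OF Z])
  interpret vW: vector_space "smul W" by (rule ns_vector_space[OF W])
  obtain E where E: "bdd_op (dual Z) (dual W) E" "op_norm (dual Z) (dual W) E \<le> l"
    "\<And>\<phi>. \<phi> \<in> car (dual Z) \<Longrightarrow> adjoint Z i (E \<phi>) = \<phi>" using dc by (auto simp: dual_complemented_def)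
  have lE: "lin_op (dual Z) (dual W) E" using E(1) by (simp add: bdd_op_def)
  define F' where "F' = restr W F"
  have F': "normed_space F'" "car F' = F" "smul F' = smul W" "nrm F' = nrm W" and FW: "F \<subseteq> car W"
    and sF: "vW.subspace F"
    using fin_dim_subspaceD[OF W F] by (auto simp: F'_def)
  define G where "G = {w \<in> F. \<exists>z\<in>car Z. w = i z}"
  have sG: "vW.subspace G"
  proof (rule vW.subspaceI)
    show "0 \<in> G" using vW.subspace_0[OF sF] ns_zero[OF Z] lin_op_zero[OF Z i]
      by (auto simp: G_def intro!: bexI[of _ 0])
    show "x + y \<in> G" if "x \<in> G" "y \<in> G" for x y
      using that vW.subspace_add[OF sF] lin_op_add[OF i] ns_add[OF Z] unfolding G_def
      by (smt (verit, best) mem_Collect_eq)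
    show "smul W c x \<in> G" if "x \<in> G" for c x
      using that vW.subspace_scale[OF sF] lin_op_smul[OF i] ns_smul[OF Z] unfolding G_def
      by (smt (verit, best) mem_Collect_eq)
  qed
  have "fin_dim_subspace F' F"
    using F by (auto simp: fin_dim_subspace_def F'_def)
  moreover have "G \<subseteq> F" by (auto simp: G_def)
  ultimately have fdG: "fin_dim_subspace F' G"
    using subspace_of_fin_dim[OF F'(1), of F G] sG by (simp only: F'(3))
  obtain n0 :: nat and e0 c0 where e0: "\<forall>j<n0. e0 j \<in> G \<and> c0 j \<in> car (dual F')"
    and ec0: "\<forall>x\<in>G. x = (\<Sum>j<n0. smul F' (c0 j x) (e0 j))"
    using dual_frame_exists[OF F'(1) fdG] by (elim exE conjE)
  have c0: "c0 j \<in> car (dual F')" if "j < n0" for j using e0 that by simp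
  have "\<exists>z. z \<in> car Z \<and> e0 j = i z" if "j < n0" for j using e0 that by (auto simp: G_def)
  then obtain z0 where z0: "\<And>j. j < n0 \<Longrightarrow> z0 j \<in> car Z" "\<And>j. j < n0 \<Longrightarrow> e0 j = i (z0 j)" by metis
  define T0 where "T0 = (\<lambda>x. \<Sum>j<n0. smul Z (c0 j x) (z0 j))"
  have T0: "bdd_op F' Z T0"
    unfolding T0_def using c0 z0 by (intro bdd_op_finite_rank[OF F'(1) Z]) auto
  then have lT0: "lin_op F' Z T0" by (simp add: bdd_op_def)
  have T0Z: "T0 x \<in> car Z" if "x \<in> F" for x using lin_op_in[OF lT0] that F' by simp
  define P0 where "P0 = (\<lambda>x. \<Sum>j<n0. smul F' (c0 j x) (e0 j))"
  have P0: "bdd_op F' F' P0"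
    unfolding P0_def using e0 F' by (intro bdd_op_finite_rank[OF F'(1,1)]) (auto simp: G_def)
  then have lP0: "lin_op F' F' P0" by (simp add: bdd_op_def)
  have P0F: "P0 x \<in> F" if "x \<in> F" for x using lin_op_in[OF lP0] that F' by simp
  have iT0: "i (T0 x) = P0 x" if "x \<in> F" for x
    unfolding T0_def P0_def using lin_op_lincomb[OF Z i, of "{..<n0}" z0 "\<lambda>j. c0 j x"] z0 F' by simp
  have P0id: "P0 x = x" if "x \<in> G" for x using ec0 that by (simp add: P0_def)
  have injD: "z = z'" if "z \<in> car Z" "z' \<in> car Z" "i z = i z'" for z z'
    using inj[of "z - z'"] lin_op_diff[OF Z i that(1,2)] that ns_diff[OF Z] by simp
  have P0G: "P0 x \<in> G" if "x \<in> F" for x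
    using P0F[OF that] iT0[OF that] T0Z[OF that] by (force simp: G_def)
  have T0P0: "T0 (P0 x) = T0 x" if "x \<in> F" for x
    using P0id[OF P0G[OF that]] iT0[OF that] iT0[OF P0F[OF that]]
    by (intro injD T0Z P0F that) simp
  have T0i: "T0 (i z) = z" if "z \<in> car Z" "i z \<in> F" for z
    using that iT0[OF that(2)] P0id[of "i z"] by (intro injD T0Z that) (auto simp: G_def)
  define R where "R w = zero_off (car (dual Z)) (\<lambda>\<phi>. E \<phi> w)" for w
  have R: "R w \<in> car (bidual Z)" "nrm (bidual Z) (R w) \<le> l * nrm W w" if w: "w \<in> car W" for w
  proof -
    have b: "norm (E \<phi> w) \<le> l * nrm W w * nrm (dual Z) \<phi>" if \<phi>: "\<phi> \<in> car (dual Z)" for \<phi>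
    proof -
      have "norm (E \<phi> w) \<le> nrm (dual W) (E \<phi>) * nrm W w"
        using dual_bound[OF W lin_op_in[OF lE \<phi>] w] by simp
      also have "nrm (dual W) (E \<phi>) \<le> l * nrm (dual Z) \<phi>"
        using op_norm_bound[OF D DW E(1) \<phi>] mult_right_mono[OF E(2) nrm_nonneg[OF D \<phi>]] by simp
      finally show ?thesis using nrm_nonneg[OF W w] by (simp add: mult_ac mult_right_mono)
    qed
    have "0 \<le> l * nrm W w" using l nrm_nonneg[OF W w] by simp
    then show "R w \<in> car (bidual Z)" "nrm (bidual Z) (R w) \<le> l * nrm W w"
      unfolding R_def dual_simps(2)[of "dual Z"]
      using b lin_op_add[OF lE] lin_op_smul[OF lE]
      by (intro zero_off_dual[OF D, where K = "l * nrm W w"]; simp)+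
  qed
  have Ri: "R (i z) = canon Z z" if z: "z \<in> car Z" for z
    using fun_cong[OF E(3), of _ z] z by (auto simp: R_def canon_def zero_off_def adjoint_def fun_eq_iff)
  have lR: "lin_op F' (bidual Z) R"
    unfolding lin_op_def
  proof (intro conjI ballI allI)
    show "R ` car F' \<subseteq> car (bidual Z)" using R FW F' by auto
    have El: "lin_op W scalars (E \<phi>)" if "\<phi> \<in> car (dual Z)" for \<phi>
      by (rule dual_lin_op[OF lin_op_in[OF lE that]])
    show "R (x + y) = R x + R y" if "x \<in> car F'" "y \<in> car F'" for x y
    proof -
      have "x \<in> car W" "y \<in> car W" using that F' FW by auto
      then show ?thesis using lin_op_add[OF El, of _ x y] by (auto simp: R_def zero_off_def fun_eq_iff)
    qed
    show "R (smul F' a x) = smul (bidual Z) a (R x)" if "x \<in> car F'" for a x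
    proof -
      have "x \<in> car W" using that F' FW by auto
      then show ?thesis
        using lin_op_smul[OF El, of _ x a] F' by (auto simp: R_def zero_off_def fun_eq_iff)
    qed
  qed
  define H where "H x = R x - canon Z (T0 x)" for x
  have lH: "lin_op F' (bidual Z) H"
    unfolding lin_op_def H_def
  proof (intro conjI ballI allI)
    interpret vB: vector_space "smul (bidual Z)" by (rule ns_vector_space[OF B])
    show "(\<lambda>x. R x - canon Z (T0 x)) ` car F' \<subseteq> car (bidual Z)"
      using lin_op_in[OF lR] canon_bidual(1)[OF Z lin_op_in[OF lT0]] ns_diff[OF B] by blast
    show "R (x + y) - canon Z (T0 (x + y)) = R x - canon Z (T0 x) + (R y - canon Z (T0 y))"
      if "x \<in> car F'" "y \<in> car F'" for x y
      using lin_op_add[OF lR that] lin_op_add[OF lT0 that]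
        canon_add[OF Z lin_op_in[OF lT0 that(1)] lin_op_in[OF lT0 that(2)]] by simp
    show "R (smul F' a x) - canon Z (T0 (smul F' a x)) = smul (bidual Z) a (R x - canon Z (T0 x))"
      if "x \<in> car F'" for a x
      using lin_op_smul[OF lR that] lin_op_smul[OF lT0 that] canon_smul[OF Z lin_op_in[OF lT0 that]]
      by (simp only: vB.scale_right_diff_distrib[unfolded dual_simps] dual_simps)
  qed
  obtain n e ce where fr: "finite_frame F' n e ce"
    using finite_frame_exists[OF W F] by (auto simp: F'_def)
  have e: "e j \<in> F" and ce: "ce j \<in> car (dual F')" if "j < n" for j
    using fr that F' by (auto simp: finite_frame_def)
  define c1 where "c1 j = zero_off F (\<lambda>x. ce j (x - P0 x))" for j
  have c1: "c1 j \<in> car (dual F')" if "j < n" for j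
    unfolding c1_def F'(2)[symmetric]
    by (rule zero_off_bdd_op[OF F'(1) bdd_op_compose[OF F'(1,1) normed_space_scalars
          bdd_op_diff_proj[OF F'(1) P0] dual_bdd_op[OF ce[OF that]]]])
  have Hsum: "H x = (\<Sum>j<n. fscale (c1 j x) (H (e j)))" if x: "x \<in> F" for x
  proof -
    have xP: "x - P0 x \<in> car F'" using ns_diff[OF F'(1)] x P0F F' by simp
    have "H (P0 x) = 0"
      using Ri[OF T0Z[OF x]] iT0[OF x] T0P0[OF x] by (simp add: H_def)
    then have "H x = H (x - P0 x)" using lin_op_diff[OF F'(1) lH, of x "P0 x"] x P0F F' by simp
    also have "x - P0 x = (\<Sum>j<n. smul F' (ce j (x - P0 x)) (e j))"
      using fr xP by (auto simp: finite_frame_def)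
    also have "H \<dots> = (\<Sum>j<n. smul (bidual Z) (ce j (x - P0 x)) (H (e j)))"
      using e F' by (intro lin_op_lincomb[OF F'(1) lH]) auto
    finally show ?thesis using x by (simp add: c1_def)
  qed
  have "\<exists>x. (\<forall>j<n. x j \<in> car Z) \<and>
    (\<forall>m\<in>car F'. nrm Z (T0 m + (\<Sum>j<n. smul Z (c1 j m) (x j))) \<le> c * nrm F' m) \<and>
    (\<forall>j<n. \<forall>\<phi>\<in>{}. norm (\<phi> (x j) - H (e j) \<phi>) < (1::real))"
  proof (rule local_reflexivity[OF F'(1) fr Z lT0 c1 _ l])
    show "H (e j) \<in> car (bidual Z)" if "j < n" for j using lin_op_in[OF lH] e[OF that] F' by simp
    show "nrm (bidual Z) (canon Z (T0 m) + (\<Sum>j<n. fscale (c1 j m) (H (e j)))) \<le> l * nrm F' m"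
      if m: "m \<in> car F'" for m
    proof -
      have "canon Z (T0 m) + (\<Sum>j<n. fscale (c1 j m) (H (e j))) = R m"
      proof -
        have "m \<in> F" using m F' by simp
        then show ?thesis unfolding Hsum[OF \<open>m \<in> F\<close>, symmetric] by (simp add: H_def)
      qed
      then show ?thesis using R(2)[of m] m F' FW by auto
    qed
  qed auto
  then obtain x where x: "\<forall>j<n. x j \<in> car Z"
    "\<forall>m\<in>F. nrm Z (T0 m + (\<Sum>j<n. smul Z (c1 j m) (x j))) \<le> c * nrm F' m" using F' by auto
  define r where "r m = T0 m + (\<Sum>j<n. smul Z (c1 j m) (x j))" for m
  have r: "bdd_op F' Z r"
    unfolding r_def using c1 x by (intro bdd_op_add[OF F'(1) Z T0] bdd_op_finite_rank[OF F'(1) Z]) auto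
  moreover have "op_norm F' Z r \<le> c"
    using r x(2) l F' by (intro op_norm_le[OF F'(1)]) (auto simp: bdd_op_def r_def)
  moreover have "r (i z) = z" if z: "z \<in> car Z" "i z \<in> F" for z
  proof -
    have "i z \<in> G" using z by (auto simp: G_def)
    then have "c1 j (i z) = 0" if "j < n" for j
      using lin_op_zero[OF F'(1) dual_lin_op[OF ce[OF that]]] P0id z by (simp add: c1_def)
    then show ?thesis using T0i[OF z] by (simp add: r_def)
  qed
  ultimately show "\<exists>r. bdd_op (restr W F) Z r \<and> op_norm (restr W F) Z r \<le> c \<and>
      (\<forall>z\<in>car Z. i z \<in> F \<longrightarrow> r (i z) = z)" by (auto simp: F'_def)
qed

text \<open>
  \<open>G (y, \<dots>, y) - G (z, \<dots>, z)\<close> is the sum of \<open>G (y - z, y, \<dots>, y)\<close> and a difference for the form \<open>G (z, _)\<close>.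
\<close>

lemma bounded_form_tendsto_diagonal:
  assumes Y: "normed_space Y" and z: "z \<in> car Y" and y: "\<And>i. y i \<in> car Y"
    and lim: "((\<lambda>i. nrm Y (y i - z)) \<longlongrightarrow> 0) F"
  shows "bounded_form k Y C G \<Longrightarrow> ((\<lambda>i. G (replicate k (y i))) \<longlongrightarrow> G (replicate k z)) F"
proof (induction k arbitrary: G C)
  case 0
  show ?case by simp
next
  case (Suc k)
  have "bounded_form k Y (C * nrm Y z) (\<lambda>xs. G (z # xs))" by (rule bounded_form_Cons[OF Y Suc.prems z])
  from Suc.IH[OF this] have 1: "((\<lambda>i. G (z # replicate k (y i))) \<longlongrightarrow> G (z # replicate k z)) F" .
  have yz: "y i - z \<in> car Y" for i by (rule ns_diff[OF Y y z])
  have "((\<lambda>i. G ((y i - z) # replicate k (y i))) \<longlongrightarrow> 0) F"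
  proof (rule Lim_null_comparison)
    show "((\<lambda>i. C * (nrm Y (y i - z) * (nrm Y (y i - z) + nrm Y z) ^ k)) \<longlongrightarrow> 0) F"
      by (rule tendsto_eq_intros lim refl)+ simp
    show "\<forall>\<^sub>F i in F. norm (G ((y i - z) # replicate k (y i)))
        \<le> C * (nrm Y (y i - z) * (nrm Y (y i - z) + nrm Y z) ^ k)"
    proof (rule always_eventually, rule allI)
      fix i
      have "nrm Y (y i) \<le> nrm Y (y i - z) + nrm Y z" using nrm_add_le[OF Y yz z] by simp
      then have p: "nrm Y (y i) ^ k \<le> (nrm Y (y i - z) + nrm Y z) ^ k"
        by (intro power_mono nrm_nonneg[OF Y y])
      have "set (replicate k (y i)) \<subseteq> car Y" using y by (simp add: set_replicate_conv_if)
      then have "norm (G ((y i - z) # replicate k (y i))) \<le> C * (nrm Y (y i - z) * nrm Y (y i) ^ k)"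
        using bounded_formD(3)[OF Suc.prems, of "(y i - z) # replicate k (y i)"] yz y
        by (auto simp: prod_list_replicate)
      also have "\<dots> \<le> C * (nrm Y (y i - z) * (nrm Y (y i - z) + nrm Y z) ^ k)"
        by (intro mult_left_mono p nrm_nonneg[OF Y yz] bounded_formD(2)[OF Suc.prems])
      finally show "norm (G ((y i - z) # replicate k (y i)))
          \<le> C * (nrm Y (y i - z) * (nrm Y (y i - z) + nrm Y z) ^ k)" .
    qed
  qed
  from tendsto_add[OF this 1]
  have "((\<lambda>i. G ((y i - z) # replicate k (y i)) + G (z # replicate k (y i))) \<longlongrightarrow> G (z # replicate k z)) F"
    by simp
  moreover have "G ((y i - z) # replicate k (y i)) + G (z # replicate k (y i)) = G (y i # replicate k (y i))" for i
    using multilinear_on_add[OF bounded_formD(1)[OF Suc.prems], of "[]" "replicate k (y i)" "y i - z" z] yz z y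
    by (simp add: set_replicate_conv_if)
  ultimately show ?case by simp
qed

context two_tensor_norms
begin

text \<open>
  Composition of a polynomial on the bidual with an operator \<open>R\<close> from \<open>X\<close> into the bidual, on the level of functionals.
\<close>

definition pull :: "('v \<Rightarrow> ('v \<Rightarrow> 'k) \<Rightarrow> 'k) \<Rightarrow> (('k, ('v \<Rightarrow> 'k) \<Rightarrow> 'k) tensor \<Rightarrow> 'k) \<Rightarrow> ('k, 'v) tensor \<Rightarrow> 'k" where
  "pull R g = zero_off (sym_tensors k X) (\<lambda>v. g (sym_tensor_map k X (bidual X) R v))"

lemma pull_dual:
  assumes R: "bdd_op X (bidual X) R" and g: "g \<in> car (dual S')"
  shows "pull R g \<in> car (dual S)"
    "op_norm S scalars (pull R g) \<le> op_norm S' scalars g * op_norm X (bidual X) R ^ k"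
proof -
  have lR: "lin_op X (bidual X) R" using R by (simp add: bdd_op_def)
  note m = sym_tensor_map_in[OF X B lR] and lin = sym_tensor_map_linear[OF X B lR]
  have g0: "0 \<le> op_norm S' scalars g" using nrm_nonneg[OF normed_space_dual[OF nS'] g] by simp
  have b: "norm (g (sym_tensor_map k X (bidual X) R v))
      \<le> op_norm S' scalars g * op_norm X (bidual X) R ^ k * \<beta> X v" if v: "v \<in> sym_tensors k X" for v
  proof -
    have "norm (g (sym_tensor_map k X (bidual X) R v))
        \<le> op_norm S' scalars g * \<beta>' (bidual X) (sym_tensor_map k X (bidual X) R v)"
      using dual_bound[OF nS' g] m[OF v] by simp
    also have "\<beta>' (bidual X) (sym_tensor_map k X (bidual X) R v) \<le> op_norm X (bidual X) R ^ k * \<beta> X v"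
      using s_tensor_normD(3)[OF st] X B R v by (simp add: metric_mapping_property_def)
    finally show ?thesis using g0 by (simp add: mult_left_mono mult.assoc)
  qed
  have a: "g (sym_tensor_map k X (bidual X) R (v + w)) =
      g (sym_tensor_map k X (bidual X) R v) + g (sym_tensor_map k X (bidual X) R w)"
    if "v \<in> sym_tensors k X" "w \<in> sym_tensors k X" for v w
    unfolding lin(1)[OF that] by (rule dual_add[OF g]) (simp_all add: m that)
  have s: "g (sym_tensor_map k X (bidual X) R (fscale c v)) = c * g (sym_tensor_map k X (bidual X) R v)"
    if "v \<in> sym_tensors k X" for c v
    unfolding lin(2)[OF that]
    using dual_smul[OF g, of "sym_tensor_map k X (bidual X) R v" c] m[OF that]
    by (simp only: sym_tensor_space_simps)
  have K: "0 \<le> op_norm S' scalars g * op_norm X (bidual X) R ^ k"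
    using g0 op_norm_nonneg[OF X B R] by simp
  from zero_off_dual[OF nS, of "\<lambda>v. g (sym_tensor_map k X (bidual X) R v)", unfolded sym_tensor_space_simps,
      OF a s K b]
  show "pull R g \<in> car (dual S)"
    "op_norm S scalars (pull R g) \<le> op_norm S' scalars g * op_norm X (bidual X) R ^ k"
    by (simp_all add: pull_def)
qed

lemma pull_tpow:
  assumes R: "bdd_op X (bidual X) R" and x: "x \<in> car X"
  shows "pull R g (tpow k (smul X) x) = g (tpow k fscale (R x))"
proof -
  have lR: "lin_op X (bidual X) R" using R by (simp add: bdd_op_def)
  have one: "represents k X [(1, x)] (tpow k (smul X) x)" using x by (auto simp: represents_def)
  have "sym_tensor_map k X (bidual X) R (tpow k (smul X) x) = tpow k fscale (R x)"
    unfolding sym_tensor_map_eq[OF X B lR one] by (simp add: fscale_def)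
  then show ?thesis using tpow_sym_tensors[OF x] by (simp add: pull_def)
qed

text \<open>
  The form of the composed polynomial is the pullback of the form \<open>G\<close> of \<open>g\<close>, and finite rank pullbacks extend
  to finite rank pullbacks.
\<close>

lemma ab_ext_pull_tpow:
  fixes n :: nat
  assumes \<phi>: "\<And>j. j < n \<Longrightarrow> \<phi> j \<in> car (dual X)" and e: "\<And>j. j < n \<Longrightarrow> e j \<in> car (bidual X)"
    and g: "g \<in> car (dual S')" and G: "sym_form_of k (bidual X) (\<lambda>z. g (tpow k fscale z)) G"
    and z: "z \<in> car (bidual X)"
  shows "ab_ext k X (pull (\<lambda>x. \<Sum>j<n. fscale (\<phi> j x) (e j)) g) (tpow k fscale z)
    = G (replicate k (\<Sum>j<n. fscale (z (\<phi> j)) (e j)))"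
proof -
  let ?R = "\<lambda>x. \<Sum>j<n. fscale (\<phi> j x) (e j)"
  have R: "bdd_op X (bidual X) ?R" using bdd_op_finite_rank[OF X B \<phi> e] by simp
  then have lR: "lin_op X (bidual X) ?R" by (simp add: bdd_op_def)
  note Rin = lin_op_in[OF lR]
  have mlG: "multilinear_on k (smul (bidual X)) (car (bidual X)) G" using G by (simp add: sym_form_of_def)
  have A: "sym_form_of k X (\<lambda>x. pull ?R g (tpow k (smul X) x)) (\<lambda>xs. G (map ?R xs))"
    unfolding sym_form_of_def
  proof (intro conjI allI impI ballI)
    show "multilinear_on k (smul X) (car X) (\<lambda>xs. G (map ?R xs))"
      by (rule multilinear_on_pullback[OF mlG Rin lin_op_add[OF lR] lin_op_smul[OF lR]])
    show "G (map ?R xs) = G (map ?R ys)" if "length xs = k" "set xs \<subseteq> car X" "mset xs = mset ys" for xs ys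
    proof -
      have "mset (map ?R xs) = mset (map ?R ys)" using that(3) by simp
      moreover have "set (map ?R xs) \<subseteq> car (bidual X)" using that(2) Rin by auto
      moreover have "\<forall>us vs. length us = k \<longrightarrow> set us \<subseteq> car (bidual X) \<longrightarrow> mset us = mset vs \<longrightarrow> G us = G vs"
        using G unfolding sym_form_of_def by (elim conjE)
      ultimately show ?thesis using that(1) by (simp del: mset_map set_map)
    qed
    show "pull ?R g (tpow k (smul X) x) = G (map ?R (replicate k x))" if x: "x \<in> car X" for x
      unfolding pull_tpow[OF R x] using G Rin[OF x] by (simp add: sym_form_of_def)
  qed
  have "ab_ext k X (pull ?R g) (tpow k fscale z) = iter_lim X (replicate k z) (\<lambda>xs. G (map ?R xs))"
    by (rule ab_ext_tpow[OF pull_dual(1)[OF R g] A z])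
  also have "\<dots> = G (map (\<lambda>z. \<Sum>j<n. fscale (z (\<phi> j)) (e j)) (replicate k z))"
    using iter_lim_finite_rank[where zs = "replicate k z" and B = G and Y = "bidual X" and X = X and n = n
        and \<phi> = \<phi> and e = e] X B \<phi> e mlG z by (simp add: set_replicate_conv_if)
  finally show ?thesis by simp
qed

text \<open>
  With the operators \<open>R i\<close> from \<open>X\<close> into the bidual and their extensions \<open>T i\<close>, which tend to the identity, \<open>p i Q\<close> is the
  composition of \<open>Q\<close> with \<open>R i\<close> and has the extension \<open>Q \<circ> T i\<close>, which tends to \<open>Q\<close>. So the operator \<open>E\<close>,
  with \<open>E Q\<close> the generalized limit of the evaluations at \<open>p i Q\<close>, is a right inverse of the adjoint of \<open>\<Theta>\<close>.
\<close>

lemma dual_complemented_Theta: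
  assumes ap: "approximation_property l (bidual X)"
  shows "0 \<le> l \<and> dual_complemented (l ^ k) (completed_tensors k \<beta>' (bidual X))
    (bidual (completed_tensors k \<beta> X)) (Theta k \<beta> \<beta>' X)"
proof
  note D = normed_space_dual[OF X] and D' = normed_space_dual[OF nS'] and DS = normed_space_dual[OF nS]
  let ?Z = "completed_tensors k \<beta>' (bidual X)" and ?P = "polys k \<beta> X"
  let ?W = "bidual (completed_tensors k \<beta> X)"
  have Zc: "?Z = completion S'" and Pd: "?P = dual (completion S)" and Wd: "?W = dual ?P"
    by (simp_all add: completed_tensors_def polys_def)
  note nP = normed_space_dual[OF normed_space_completion[OF nS], folded Pd]
  note nZ = normed_space_completion[OF nS', folded Zc]
  note nW = normed_space_dual[OF nP, folded Wd]
  obtain F :: "((('v \<Rightarrow> 'k) \<Rightarrow> 'k) \<Rightarrow> (('v \<Rightarrow> 'k) \<Rightarrow> 'k)) filter" where "F \<noteq> bot"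
      "\<forall>\<^sub>F T in F. bdd_op (bidual X) (bidual X) T \<and> fin_dim_subspace (bidual X) (T ` car (bidual X)) \<and>
        op_norm (bidual X) (bidual X) T \<le> l"
      using ap unfolding approximation_property_def by (elim exE conjE)
  from eventually_happens'[OF this] obtain T where "bdd_op (bidual X) (bidual X) T"
    "op_norm (bidual X) (bidual X) T \<le> l" by blast
  then show l0: "0 \<le> l" using op_norm_nonneg[OF B B] order_trans by blast
  define \<epsilon> where "\<epsilon> m = inverse (real (Suc m))" for m
  have \<epsilon>: "\<epsilon> m > 0" "m0 \<le> m \<Longrightarrow> \<epsilon> m \<le> \<epsilon> m0" for m m0
    by (auto simp: \<epsilon>_def intro!: le_imp_inverse_le)
  have \<epsilon>_lim: "\<epsilon> \<longlonglongrightarrow> 0" unfolding \<epsilon>_def by (rule LIMSEQ_inverse_real_of_nat)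
  \<comment> \<open>An index \<open>(N, m)\<close> prescribes finitely many points and an accuracy. The accuracy is a component of its own since
    the number of points need not tend to infinity: the bidual may be zero.\<close>
  define good where "good = (\<lambda>(N, m) (n::nat, \<phi>, e).
    (\<forall>j<n. \<phi> j \<in> car (dual X) \<and> e j \<in> car (bidual X)) \<and>
    (\<forall>x\<in>car X. nrm (bidual X) (\<Sum>j<n. fscale (\<phi> j x) (e j)) \<le> (l + \<epsilon> m) * nrm X x) \<and>
    (finite N \<and> N \<subseteq> car (bidual X) \<longrightarrow>
      (\<forall>z\<in>N. nrm (bidual X) ((\<Sum>j<n. fscale (z (\<phi> j)) (e j)) - z) < \<epsilon> m)))"
  have "\<exists>d. good i d" for i
  proof -
    obtain N m where i: "i = (N, m)" by (cases i)
    define N' where "N' = (if finite N \<and> N \<subseteq> car (bidual X) then N else {})"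
    have "finite N'" "N' \<subseteq> car (bidual X)" by (auto simp: N'_def)
    from weak_star_continuous_approximation[OF X ap this \<epsilon>(1)[of m]]
    obtain n :: nat and \<phi> e where "(\<forall>j<n. \<phi> j \<in> car (dual X) \<and> e j \<in> car (bidual X)) \<and>
      (\<forall>x\<in>car X. nrm (bidual X) (\<Sum>j<n. fscale (\<phi> j x) (e j)) \<le> (l + \<epsilon> m) * nrm X x) \<and>
      (\<forall>z\<in>N'. nrm (bidual X) ((\<Sum>j<n. fscale (z (\<phi> j)) (e j)) - z) < \<epsilon> m)" by (elim exE)
    then have "good (N, m) (n, \<phi>, e)" by (auto simp: good_def N'_def split: if_splits)
    then show ?thesis using i by blast
  qed
  then have "\<exists>d. \<forall>i. good i (d i)" by (intro choice) blast
  then obtain d where d: "\<forall>i. good i (d i)" by blast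
  define n where "n i = fst (d i)" for i
  define \<phi> where "\<phi> i = fst (snd (d i))" for i
  define e where "e i = snd (snd (d i))" for i
  have dd: "good i (n i, \<phi> i, e i)" for i using spec[OF d, of i] by (simp add: n_def \<phi>_def e_def)
  have \<phi>: "\<phi> i j \<in> car (dual X)" and e: "e i j \<in> car (bidual X)" if "j < n i" for i j
    using dd[of i] that by (auto simp: good_def split: prod.splits)
  define R where "R i = (\<lambda>x. \<Sum>j<n i. fscale (\<phi> i j x) (e i j))" for i
  define T where "T i = (\<lambda>z. \<Sum>j<n i. fscale (z (\<phi> i j)) (e i j))" for i
  have Tin: "T i z \<in> car (bidual X)" for i z
    unfolding T_def using e ns_smul[OF B] by (intro ns_sum[OF B]) simp
  have R: "bdd_op X (bidual X) (R i)" for i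
    unfolding R_def using bdd_op_finite_rank[OF X B, of "n i" "\<phi> i" "e i"] \<phi> e by simp
  have Rn: "op_norm X (bidual X) (R i) \<le> l + \<epsilon> (snd i)" for i
  proof (rule op_norm_le[OF X])
    show "lin_op X (bidual X) (R i)" using R[of i] by (simp add: bdd_op_def)
    show "0 \<le> l + \<epsilon> (snd i)" using l0 \<epsilon>(1)[of "snd i"] by simp
    show "nrm (bidual X) (R i x) \<le> (l + \<epsilon> (snd i)) * nrm X x" if "x \<in> car X" for x
      using dd[of i] that by (auto simp: good_def R_def split: prod.splits)
  qed
  define FF where "FF = finite_subsets_at_top (car (bidual X)) \<times>\<^sub>F (sequentially :: nat filter)"
  have FF: "FF \<noteq> bot" by (simp add: FF_def prod_filter_eq_bot)
  have ev_snd: "\<forall>\<^sub>F i in FF. m0 \<le> snd i" for m0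
    using eventually_prodI[OF always_eventually eventually_ge_at_top[of m0],
        where P = "\<lambda>_. True" and F = "finite_subsets_at_top (car (bidual X))"]
    by (simp add: FF_def)
  have T_lim: "((\<lambda>i. nrm (bidual X) (T i z - z)) \<longlongrightarrow> 0) FF" if z: "z \<in> car (bidual X)" for z
  proof (rule tendstoI)
    fix r :: real assume r: "r > 0"
    have em: "\<forall>\<^sub>F m in sequentially. \<epsilon> m < r" by (rule order_tendstoD(2)[OF \<epsilon>_lim r])
    have "\<forall>\<^sub>F N in finite_subsets_at_top (car (bidual X)). finite N \<and> N \<subseteq> car (bidual X) \<and> z \<in> N"
      unfolding eventually_finite_subsets_at_top using z by (intro exI[of _ "{z}"]) auto
    from eventually_prodI[OF this em]
    have "\<forall>\<^sub>F i in FF. (finite (fst i) \<and> fst i \<subseteq> car (bidual X) \<and> z \<in> fst i) \<and> \<epsilon> (snd i) < r"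
      by (simp only: FF_def)
    then show "\<forall>\<^sub>F i in FF. dist (nrm (bidual X) (T i z - z)) 0 < r"
    proof eventually_elim
      case (elim i)
      have "nrm (bidual X) (T i z - z) < \<epsilon> (snd i)"
        using dd[of i] elim by (auto simp: good_def T_def split: prod.splits)
      then show ?case using elim nrm_nonneg[OF B ns_diff[OF B Tin z], of i] by simp
    qed
  qed
  \<comment> \<open>The extension of the composition of the polynomial \<open>g\<close> with \<open>R i\<close>. Convergence to \<open>g\<close> is shown at powers of single
    vectors first, then at tensors, and then on the completion by the uniform bound.\<close>
  define h where "h i g = ab_ext k X (pull (R i) g)" for i g
  have h: "h i g \<in> car (dual S')"
    "op_norm S' scalars (h i g) \<le> op_norm S' scalars g * (l + 1) ^ k * (2 ^ k * polarization_constant k)"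
    if g: "g \<in> car (dual S')" for i g
  proof -
    note pd = pull_dual[OF R g, of i]
    show "h i g \<in> car (dual S')" unfolding h_def by (rule ab_ext_dual(1)[OF pd(1)])
    have "op_norm S' scalars (h i g) \<le> op_norm S scalars (pull (R i) g) * (2 ^ k * polarization_constant k)"
      unfolding h_def using ab_ext_dual(2)[OF pd(1)] by (simp add: mult.assoc)
    also have "op_norm S scalars (pull (R i) g) \<le> op_norm S' scalars g * (l + 1) ^ k"
    proof (rule order_trans[OF pd(2)], rule mult_left_mono)
      have "\<epsilon> (snd i) \<le> 1" by (simp add: \<epsilon>_def field_simps)
      then show "op_norm X (bidual X) (R i) ^ k \<le> (l + 1) ^ k"
        using Rn[of i] op_norm_nonneg[OF X B R, of i] by (intro power_mono) auto
      show "0 \<le> op_norm S' scalars g" using nrm_nonneg[OF D' g] by simp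
    qed
    finally show "op_norm S' scalars (h i g)
        \<le> op_norm S' scalars g * (l + 1) ^ k * (2 ^ k * polarization_constant k)"
      using polarization_constant_nonneg by (simp add: mult_right_mono)
  qed
  have h_tensor: "((\<lambda>i. h i g v) \<longlongrightarrow> g v) FF" if g: "g \<in> car (dual S')" and v: "v \<in> sym_tensors k (bidual X)" for g v
  proof -
    obtain G where G: "sym_form_of k (bidual X) (\<lambda>z. g (tpow k fscale z)) G" using form_S'[OF g] by blast
    obtain C where C: "bounded_form k (bidual X) C G" using bounded_form_S'[OF g G] by blast
    have t: "((\<lambda>i. h i g (tpow k fscale z)) \<longlongrightarrow> g (tpow k fscale z)) FF" if z: "z \<in> car (bidual X)" for z
    proof -
      have "h i g (tpow k fscale z) = G (replicate k (T i z))" for i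
        unfolding h_def R_def T_def by (rule ab_ext_pull_tpow[OF \<phi> e g G z])
      moreover have "g (tpow k fscale z) = G (replicate k z)" using G z by (simp add: sym_form_of_def)
      ultimately show ?thesis
        using bounded_form_tendsto_diagonal[OF B z Tin T_lim[OF z] C] by simp
    qed
    obtain cs where cs: "represents k (bidual X) cs v" using v mem_sym_tensors_iff[of v k] by auto
    have "snd ` set cs \<subseteq> car (bidual X) \<Longrightarrow>
      ((\<lambda>i. \<Sum>(c, x)\<leftarrow>cs. c * h i g (tpow k fscale x)) \<longlongrightarrow> (\<Sum>(c, x)\<leftarrow>cs. c * g (tpow k fscale x))) FF"
    proof (induction cs)
      case (Cons q cs)
      obtain c x where q: "q = (c, x)" by (cases q)
      have "x \<in> car (bidual X)" "snd ` set cs \<subseteq> car (bidual X)" using Cons.prems q by auto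
      from tendsto_add[OF tendsto_mult_left[OF t[OF this(1)]] Cons.IH[OF this(2)]]
      show ?case unfolding q list.map sum_list.Cons prod.case .
    qed simp
    moreover have "snd ` set cs \<subseteq> car (bidual X)" using cs by (simp add: represents_def)
    moreover have "h i g v = (\<Sum>(c, x)\<leftarrow>cs. c * h i g (tpow k fscale x))" for i
      using functional_tsum[OF nS' h(1)[OF g] cs] by simp
    moreover have "g v = (\<Sum>(c, x)\<leftarrow>cs. c * g (tpow k fscale x))" using functional_tsum[OF nS' g cs] by simp
    ultimately show ?thesis by simp
  qed
  have h_lim: "((\<lambda>i. w (h i g)) \<longlongrightarrow> w g) FF" if g: "g \<in> car (dual S')" and w: "w \<in> car (completion S')" for g w
  proof (rule tendstoI)
    fix r :: real assume r: "r > 0"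
    define K where "K = op_norm S' scalars g * (l + 1) ^ k * (2 ^ k * polarization_constant k)
      + op_norm S' scalars g + 1"
    have g0: "0 \<le> op_norm S' scalars g" using nrm_nonneg[OF D' g] by simp
    have K: "K > 0" unfolding K_def using g0 l0 polarization_constant_nonneg
      by (intro add_nonneg_pos add_nonneg_nonneg mult_nonneg_nonneg) auto
    then have rK: "r / 2 / K > 0" using r by simp
    obtain v where v: "v \<in> car S'" "nrm (bidual S') (w - canon S' v) < r / 2 / K"
      using completionE[OF w rK] by blast
    have wv: "w - canon S' v \<in> car (bidual S')"
      using w completion_subset canon_bidual(1)[OF nS' v(1)] by (intro ns_diff[OF normed_space_bidual[OF nS']]) auto
    have est: "norm ((w - canon S' v) f) \<le> r / 2 / K * op_norm S' scalars f" if f: "f \<in> car (dual S')" for f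
    proof -
      have "norm ((w - canon S' v) f) \<le> nrm (bidual S') (w - canon S' v) * op_norm S' scalars f"
        using dual_bound[OF D' wv f] by simp
      also have "\<dots> \<le> r / 2 / K * op_norm S' scalars f"
        using v(2) nrm_nonneg[OF D' f] by (intro mult_right_mono) auto
      finally show ?thesis .
    qed
    have "v \<in> sym_tensors k (bidual X)" using v by simp
    have "r / 2 > 0" using r by simp
    then have "\<forall>\<^sub>F i in FF. dist (h i g v) (g v) < r / 2"
      by (rule tendstoD[OF h_tensor[OF g \<open>v \<in> sym_tensors k (bidual X)\<close>]])
    then show "\<forall>\<^sub>F i in FF. dist (w (h i g)) (w g) < r"
    proof eventually_elim
      case (elim i)
      have "w (h i g) - w g = (w - canon S' v) (h i g) + (h i g v - g v) - (w - canon S' v) g"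
        using h(1)[OF g] g by simp
      then have "norm (w (h i g) - w g) \<le> norm ((w - canon S' v) (h i g)) + norm (h i g v - g v)
          + norm ((w - canon S' v) g)"
        using norm_triangle_ineq4 norm_triangle_ineq by (smt (verit))
      also have "\<dots> < r / 2 / K * op_norm S' scalars (h i g) + r / 2 + r / 2 / K * op_norm S' scalars g"
        using est[OF h(1)[OF g, of i]] est[OF g] elim by (simp add: dist_norm)
      also have "\<dots> = r / 2 / K * (op_norm S' scalars (h i g) + op_norm S' scalars g) + r / 2"
        by (simp add: distrib_left)
      also have "\<dots> \<le> r / 2 / K * K + r / 2"
        using h(2)[OF g, of i] rK by (intro add_right_mono mult_left_mono) (auto simp: K_def)
      also have "\<dots> = r" using K by simp
      finally show ?case by (simp add: dist_norm)
    qed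
  qed
  \<comment> \<open>The same compositions as polynomials, that is, as functionals on the completed tensor products.\<close>
  define p where "p i Q = fnl_ext S (pull (R i) (fnl_restrict S' Q))" for i Q
  have p: "p i Q \<in> car ?P" "nrm ?P (p i Q) \<le> nrm (dual ?Z) Q * (l + \<epsilon> (snd i)) ^ k"
    if Q: "Q \<in> car (dual ?Z)" for i Q
  proof -
    have Q': "Q \<in> car (dual (completion S'))" using Q by (simp add: Zc)
    note g = fnl_restrict_dual[OF nS' Q'] and pd = pull_dual[OF R fnl_restrict_dual(1)[OF nS' Q'], of i]
    note x = fnl_ext_dual[OF nS pd(1)]
    show "p i Q \<in> car ?P" using x(1) by (simp add: p_def Pd)
    have "nrm ?P (p i Q) \<le> op_norm S' scalars (fnl_restrict S' Q) * op_norm X (bidual X) (R i) ^ k"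
      using order_trans[OF x(2) pd(2)] by (simp add: p_def Pd)
    also have "\<dots> \<le> nrm (dual ?Z) Q * (l + \<epsilon> (snd i)) ^ k"
      using g(2) Rn[of i] op_norm_nonneg[OF X B R, of i] nrm_nonneg[OF D' g(1)]
        nrm_nonneg[OF normed_space_dual[OF nZ] Q]
      by (intro mult_mono power_mono) (auto simp: Zc)
    finally show "nrm ?P (p i Q) \<le> nrm (dual ?Z) Q * (l + \<epsilon> (snd i)) ^ k" .
  qed
  have p_lin: "p i (Q + fscale c Q') = p i Q + fscale c (p i Q')"
    if Q: "Q \<in> car (dual ?Z)" "Q' \<in> car (dual ?Z)" for i Q Q' c
  proof -
    have Qc: "Q \<in> car (dual (completion S'))" "Q' \<in> car (dual (completion S'))" using Q by (simp_all add: Zc)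
    have pull_lin: "pull (R i) (f + fscale c f') = pull (R i) f + fscale c (pull (R i) f')" for f f'
      by (auto simp: pull_def zero_off_def fun_eq_iff)
    have ext_lin: "fnl_ext S (f + fscale c f') = fnl_ext S f + fscale c (fnl_ext S f')"
      if f: "f \<in> car (dual S)" "f' \<in> car (dual S)" for f f'
    proof
      fix z
      show "fnl_ext S (f + fscale c f') z = (fnl_ext S f + fscale c (fnl_ext S f')) z"
      proof (cases "z \<in> car (completion S)")
        case True
        then have zB: "z \<in> car (bidual S)" using completion_subset by blast
        have "z (f + fscale c f') = z f + c * z f'"
          using dual_add[OF zB f(1), of "fscale c f'"] dual_smul[OF zB f(2), of c]
            ns_smul[OF DS f(2), of c] by simp
        then show ?thesis using True by (simp add: fnl_ext_def)
      qed (simp add: fnl_ext_def zero_off_def)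
    qed
    show ?thesis
      unfolding p_def fnl_restrict_linear[of S' Q c Q'] pull_lin
      by (intro ext_lin pull_dual(1)[OF R] fnl_restrict_dual(1)[OF nS'] Qc)
  qed
  obtain LIM' :: "(((('v \<Rightarrow> 'k) \<Rightarrow> 'k) set \<times> nat) \<Rightarrow> 'k) \<Rightarrow> 'k" where
    L: "\<forall>x y. LIM' (\<lambda>i. x i + y i) = LIM' x + LIM' y" "\<forall>c x. LIM' (\<lambda>i. c * x i) = c * LIM' x"
    "\<forall>x C. (\<forall>\<^sub>F i in FF. norm (x i) \<le> C) \<longrightarrow> norm (LIM' x) \<le> C" "\<forall>x c. (x \<longlongrightarrow> c) FF \<longrightarrow> LIM' x = c"
    using generalized_limit[OF FF, where ?'k = 'k] by (elim exE conjE)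
  define E where "E Q = zero_off (car ?W) (\<lambda>\<xi>. LIM' (\<lambda>i. \<xi> (p i Q)))" for Q
  have Eb: "norm (LIM' (\<lambda>i. \<xi> (p i Q))) \<le> l ^ k * nrm (dual ?Z) Q * nrm ?W \<xi>"
    if \<xi>: "\<xi> \<in> car ?W" and Q: "Q \<in> car (dual ?Z)" for \<xi> Q
  proof (rule LIMSEQ_le_const)
    show "(\<lambda>m. (l + \<epsilon> m) ^ k * nrm (dual ?Z) Q * nrm ?W \<xi>) \<longlonglongrightarrow> l ^ k * nrm (dual ?Z) Q * nrm ?W \<xi>"
      by (rule tendsto_eq_intros \<epsilon>_lim refl)+ simp
    have \<xi>': "\<xi> \<in> car (dual ?P)" using \<xi> by (simp add: Wd)
    have "norm (LIM' (\<lambda>i. \<xi> (p i Q))) \<le> (l + \<epsilon> m) ^ k * nrm (dual ?Z) Q * nrm ?W \<xi>" for m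
    proof (rule L(3)[rule_format])
      show "\<forall>\<^sub>F i in FF. norm (\<xi> (p i Q)) \<le> (l + \<epsilon> m) ^ k * nrm (dual ?Z) Q * nrm ?W \<xi>"
        using ev_snd[of m]
      proof eventually_elim
        case (elim i)
        note p(2)[OF Q, of i]
        also have "nrm (dual ?Z) Q * (l + \<epsilon> (snd i)) ^ k \<le> nrm (dual ?Z) Q * (l + \<epsilon> m) ^ k"
          using \<epsilon>(2)[OF elim] l0 \<epsilon>(1)[of "snd i"] nrm_nonneg[OF normed_space_dual[OF nZ] Q]
          by (intro mult_left_mono power_mono) auto
        finally have "nrm ?W \<xi> * nrm ?P (p i Q) \<le> nrm ?W \<xi> * (nrm (dual ?Z) Q * (l + \<epsilon> m) ^ k)"
          by (rule mult_left_mono[OF _ nrm_nonneg[OF nW \<xi>]])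
        moreover have "norm (\<xi> (p i Q)) \<le> nrm ?W \<xi> * nrm ?P (p i Q)"
          using dual_bound[OF nP \<xi>' p(1)[OF Q]] by (simp add: Wd)
        ultimately show ?case by (simp add: mult_ac)
      qed
    qed
    then show "\<exists>M. \<forall>m\<ge>M. norm (LIM' (\<lambda>i. \<xi> (p i Q))) \<le> (l + \<epsilon> m) ^ k * nrm (dual ?Z) Q * nrm ?W \<xi>" by blast
  qed
  have E: "E Q \<in> car (dual ?W)" "nrm (dual ?W) (E Q) \<le> l ^ k * nrm (dual ?Z) Q" if Q: "Q \<in> car (dual ?Z)" for Q
  proof -
    have K: "0 \<le> l ^ k * nrm (dual ?Z) Q" using l0 nrm_nonneg[OF normed_space_dual[OF nZ] Q] by simp
    have a: "LIM' (\<lambda>i. (\<xi> + \<eta>) (p i Q)) = LIM' (\<lambda>i. \<xi> (p i Q)) + LIM' (\<lambda>i. \<eta> (p i Q))" for \<xi> \<eta>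
      using L(1)[rule_format, of "\<lambda>i. \<xi> (p i Q)" "\<lambda>i. \<eta> (p i Q)"] by (simp only: plus_fun_apply)
    have s: "LIM' (\<lambda>i. smul ?W c \<xi> (p i Q)) = c * LIM' (\<lambda>i. \<xi> (p i Q))" for c \<xi>
      using L(2)[rule_format, of c "\<lambda>i. \<xi> (p i Q)"] by (simp only: dual_simps fscale_apply)
    from zero_off_dual[OF nW, of "\<lambda>\<xi>. LIM' (\<lambda>i. \<xi> (p i Q))", OF a s K Eb[OF _ Q]]
    show "E Q \<in> car (dual ?W)" "nrm (dual ?W) (E Q) \<le> l ^ k * nrm (dual ?Z) Q"
      unfolding E_def dual_simps(2)[of ?W] by simp_all
  qed
  have E_lin: "E (Q + fscale c Q') = E Q + fscale c (E Q')"
    if Q: "Q \<in> car (dual ?Z)" "Q' \<in> car (dual ?Z)" for Q Q' c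
  proof
    fix \<xi>
    show "E (Q + fscale c Q') \<xi> = (E Q + fscale c (E Q')) \<xi>"
    proof (cases "\<xi> \<in> car ?W")
      case True
      then have \<xi>: "\<xi> \<in> car (dual ?P)" by (simp add: Wd)
      have "\<xi> (p i (Q + fscale c Q')) = \<xi> (p i Q) + c * \<xi> (p i Q')" for i
        using dual_add[OF \<xi> p(1)[OF Q(1)], of "fscale c (p i Q')"] dual_smul[OF \<xi> p(1)[OF Q(2)], of c]
          ns_smul[OF nP p(1)[OF Q(2)], of c] p_lin[OF Q] by (simp add: Pd)
      then show ?thesis using True L(1)[rule_format, of "\<lambda>i. \<xi> (p i Q)" "\<lambda>i. c * \<xi> (p i Q')"]
          L(2)[rule_format, of c "\<lambda>i. \<xi> (p i Q')"] by (simp add: E_def)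
    qed (simp add: E_def zero_off_def)
  qed
  note DZ = normed_space_dual[OF nZ]
  have lE: "lin_op (dual ?Z) (dual ?W) E"
    unfolding lin_op_def
  proof (intro conjI ballI allI)
    show "E ` car (dual ?Z) \<subseteq> car (dual ?W)" using E by auto
    show "E (Q + Q') = E Q + E Q'" if "Q \<in> car (dual ?Z)" "Q' \<in> car (dual ?Z)" for Q Q'
      using E_lin[OF that, of 1] by (simp add: fscale_def)
    show "E (smul (dual ?Z) c Q) = smul (dual ?W) c (E Q)" if Q: "Q \<in> car (dual ?Z)" for c Q
    proof -
      have z: "0 \<in> car (dual ?Z)" by (rule ns_zero[OF DZ])
      have "nrm (dual ?W) (E 0) = 0"
        using E(2)[OF z] nrm_nonneg[OF normed_space_dual[OF nW] E(1)[OF z]] nrm_zero[OF DZ] by simp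
      then have "E 0 = 0" using nrm_eq_0[OF normed_space_dual[OF nW] E(1)[OF z]] by blast
      then show ?thesis using E_lin[OF z Q, of c] by simp
    qed
  qed
  show "dual_complemented (l ^ k) ?Z ?W (Theta k \<beta> \<beta>' X)"
    unfolding dual_complemented_def
  proof (intro exI[of _ E] conjI ballI)
    show "bdd_op (dual ?Z) (dual ?W) E" by (rule bdd_opI[OF lE E(2)])
    show "op_norm (dual ?Z) (dual ?W) E \<le> l ^ k"
      using l0 by (intro op_norm_le[OF DZ lE _ E(2)]) simp_all
    fix Q assume Q: "Q \<in> car (dual ?Z)"
    then have Q': "Q \<in> car (dual (completion S'))" by (simp add: Zc)
    define g where "g = fnl_restrict S' Q"
    have g: "g \<in> car (dual S')" unfolding g_def by (rule fnl_restrict_dual(1)[OF nS' Q'])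
    have Th: "lin_op ?Z ?W (Theta k \<beta> \<beta>' X)" using Theta_bdd_op by (simp add: bdd_op_def)
    have "E Q (Theta k \<beta> \<beta>' X w) = Q w" if w: "w \<in> car ?Z" for w
    proof -
      have wc: "w \<in> car (completion S')" using w by (simp add: Zc)
      have "Theta k \<beta> \<beta>' X w (p i Q) = w (h i g)" for i
      proof -
        have "fnl_restrict S (p i Q) = pull (R i) g"
          unfolding p_def g_def[symmetric] by (rule fnl_restrict_ext[OF nS pull_dual(1)[OF R g]])
        then show ?thesis using Theta_apply[OF w p(1)[OF Q], of i] by (simp only: h_def)
      qed
      then have "E Q (Theta k \<beta> \<beta>' X w) = LIM' (\<lambda>i. w (h i g))"
        using lin_op_in[OF Th w] by (simp add: E_def)
      also have "\<dots> = w g" using L(4) h_lim[OF g wc] by blast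
      also have "\<dots> = Q w" unfolding g_def by (rule completion_apply[OF nS' Q' wc, symmetric])
      finally show ?thesis .
    qed
    then show "adjoint ?Z (Theta k \<beta> \<beta>' X) (E Q) = Q"
      using dual_off[OF Q] by (auto simp: adjoint_def)
  qed
qed

end

theorem theorem3p3:
  fixes k :: nat
    and X :: "('k::real_or_complex, 'v::ab_group_add) nspace"
    and \<beta> :: "('k, 'v) norm_assignment"
    and \<beta>' :: "('k, ('v \<Rightarrow> 'k) \<Rightarrow> 'k) norm_assignment"
    and l :: real
  assumes "k \<ge> 1"
    and "s_tensor_norm k \<beta> \<beta>'"
    and "banach_space X"
    and "approximation_property l (bidual X)"
  shows "embedding (completed_tensors k \<beta>' (bidual X)) (bidual (completed_tensors k \<beta> X))
           (Theta k \<beta> \<beta>' X) \<and>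
         (\<forall>c > l ^ k. locally_complemented c (completed_tensors k \<beta>' (bidual X))
           (bidual (completed_tensors k \<beta> X)) (Theta k \<beta> \<beta>' X)) \<and>
         dual_complemented (l ^ k) (completed_tensors k \<beta>' (bidual X))
           (bidual (completed_tensors k \<beta> X)) (Theta k \<beta> \<beta>' X)"
proof -
  note st = assms(2)
  have X: "normed_space X" using assms(3) by (simp add: banach_space_def)
  interpret two_tensor_norms k X \<beta> \<beta>' by unfold_locales (rule st X)+
  let ?S = "sym_tensor_space k \<beta> X" and ?S' = "sym_tensor_space k \<beta>' (bidual X)"
  let ?Z = "completed_tensors k \<beta>' (bidual X)" and ?W = "bidual (completed_tensors k \<beta> X)"
  note nS = s_tensor_normD(1)[OF st X] and nS' = s_tensor_normD(2)[OF st normed_space_bidual[OF X]]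
  have nZ: "normed_space ?Z" and nW: "normed_space ?W"
    unfolding completed_tensors_def
    by (intro normed_space_completion[OF nS'] normed_space_bidual[OF normed_space_completion[OF nS]])+
  have l0: "0 \<le> l" and dc: "dual_complemented (l ^ k) ?Z ?W (Theta k \<beta> \<beta>' X)"
    using dual_complemented_Theta[OF assms(4)] by auto
  note Th = Theta_bdd_op
  then have lTh: "lin_op ?Z ?W (Theta k \<beta> \<beta>' X)" by (simp add: bdd_op_def)
  obtain E where E: "bdd_op (dual ?Z) (dual ?W) E" "op_norm (dual ?Z) (dual ?W) E \<le> l ^ k"
    "\<forall>\<phi>\<in>car (dual ?Z). adjoint ?Z (Theta k \<beta> \<beta>' X) (E \<phi>) = \<phi>"
    using dc unfolding dual_complemented_def by (elim exE conjE)
  then have lE: "lin_op (dual ?Z) (dual ?W) E" by (simp add: bdd_op_def)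
  \<comment> \<open>Evaluations at functionals \<open>g\<close> of norm one are functionals \<open>Q\<close> on \<open>?Z\<close> that norm it, and \<open>Q w\<close> is the value of \<open>E Q\<close> at
    the image of \<open>w\<close>.\<close>
  have below: "nrm ?Z w \<le> l ^ k * nrm ?W (Theta k \<beta> \<beta>' X w)" if w: "w \<in> car ?Z" for w
    unfolding completed_tensors_def
  proof (rule completion_norm_le[OF nS'])
    show wc: "w \<in> car (completion ?S')" using w by (simp add: completed_tensors_def)
    note tw = lin_op_in[OF lTh w]
    show "0 \<le> l ^ k * nrm (bidual (completion ?S)) (Theta k \<beta> \<beta>' X w)"
      using l0 nrm_nonneg[OF nW tw] by (simp add: completed_tensors_def)
    fix g assume g: "g \<in> car (dual ?S')"
    define Q where "Q = fnl_ext ?S' g"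
    have Q: "Q \<in> car (dual ?Z)" "nrm (dual ?Z) Q \<le> op_norm ?S' scalars g"
      using fnl_ext_dual[OF nS' g] by (simp_all add: Q_def completed_tensors_def)
    have "w g = Q w" using wc by (simp add: Q_def fnl_ext_def)
    also have "Q w = E Q (Theta k \<beta> \<beta>' X w)"
      using fun_cong[OF E(3)[rule_format, OF Q(1)], of w] w by (simp add: adjoint_def)
    also have "norm \<dots> \<le> nrm (dual ?W) (E Q) * nrm ?W (Theta k \<beta> \<beta>' X w)"
      using dual_bound[OF nW lin_op_in[OF lE Q(1)] tw] by simp
    also have "\<dots> \<le> (l ^ k * op_norm ?S' scalars g) * nrm ?W (Theta k \<beta> \<beta>' X w)"
    proof (rule mult_right_mono[OF _ nrm_nonneg[OF nW tw]])
      have "nrm (dual ?W) (E Q) \<le> op_norm (dual ?Z) (dual ?W) E * nrm (dual ?Z) Q"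
        by (rule op_norm_bound[OF normed_space_dual[OF nZ] normed_space_dual[OF nW] E(1) Q(1)])
      also have "\<dots> \<le> l ^ k * op_norm ?S' scalars g"
        using E(2) Q(2) l0 nrm_nonneg[OF normed_space_dual[OF nZ] Q(1)] by (intro mult_mono) auto
      finally show "nrm (dual ?W) (E Q) \<le> l ^ k * op_norm ?S' scalars g" .
    qed
    finally show "norm (w g) \<le> l ^ k * nrm (bidual (completion ?S)) (Theta k \<beta> \<beta>' X w) * op_norm ?S' scalars g"
      by (simp add: mult_ac completed_tensors_def)
  qed
  have "embedding ?Z ?W (Theta k \<beta> \<beta>' X)"
    unfolding embedding_def
  proof (intro conjI Th exI[of _ "1 / (l ^ k + 1)"] ballI)
    have lk: "0 < l ^ k + 1" using l0 by (simp add: add_nonneg_pos)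
    then show "0 < 1 / (l ^ k + 1)" by simp
    fix w assume w: "w \<in> car ?Z"
    have "nrm ?Z w \<le> (l ^ k + 1) * nrm ?W (Theta k \<beta> \<beta>' X w)"
      using below[OF w] nrm_nonneg[OF nW lin_op_in[OF lTh w]] by (simp add: distrib_right)
    then show "1 / (l ^ k + 1) * nrm ?Z w \<le> nrm ?W (Theta k \<beta> \<beta>' X w)"
      using lk by (simp add: pos_divide_le_eq mult.commute)
  qed
  moreover have "locally_complemented c ?Z ?W (Theta k \<beta> \<beta>' X)" if "c > l ^ k" for c
  proof (rule locally_complemented_if_dual_complemented[OF nZ nW lTh _ dc _ that])
    show "w = 0" if "w \<in> car ?Z" "Theta k \<beta> \<beta>' X w = 0" for w
    proof -
      have "nrm ?Z w \<le> 0" using below[OF that(1)] that(2) nrm_zero[OF nW] by simp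
      then show ?thesis using nrm_nonneg[OF nZ that(1)] nrm_eq_0[OF nZ that(1)] by simp
    qed
    show "0 \<le> l ^ k" using l0 by simp
  qed
  ultimately show ?thesis using dc by blast
qed

end
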